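(* Let $k\geq2$ be fixed. For each $p\geq1$ let $n_i=n_i(p)$, $1\le i\le k$, be integers with $n_i>p+1$ and $\lim_{p\to\infty}p/n_i=y_i\in(0,1]$. Let $\{\mathbf{y}_{ij};1\le i\le k,1\le j\le n_i\}$ be independent $p$-dimensional random vectors with $\mathbf{y}_{i1},\dots,\mathbf{y}_{in_i}$ i.i.d. $N_p(\boldsymbol\mu_i,\boldsymbol\Sigma_i)$, $\boldsymbol\Sigma_i$ positive definite. Put $n=\sum_{i=1}^kn_i$, $\bar{\mathbf{y}}_i=\frac1{n_i}\sum_{j=1}^{n_i}\mathbf{y}_{ij}$, $\bar{\mathbf{y}}=\frac1n\sum_{i=1}^kn_i\bar{\mathbf{y}}_i$, $$\mathbf{A}=\sum_{i=1}^kn_i(\bar{\mathbf{y}}_i-\bar{\mathbf{y}})(\bar{\mathbf{y}}_i-\bar{\mathbf{y}})',\quad \mathbf{B}_i=\sum_{j=1}^{n_i}(\mathbf{y}_{ij}-\bar{\mathbf{y}}_i)(\mathbf{y}_{ij}-\bar{\mathbf{y}}_i)',\quad \mathbf{B}=\sum_{i=1}^k\mathbf{B}_i,$$ $$\Lambda_n=\frac{\prod_{i=1}^k|\mathbf{B}_i|^{n_i/2}}{|\mathbf{A}+\mathbf{B}|^{n/2}}\cdot\frac{n^{pn/2}}{\prod_{i=1}^kn_i^{pn_i/2}}.$$ Assume $H_0:\boldsymbol\mu_1=\dots=\boldsymbol\mu_k$ and $\boldsymbol\Sigma_1=\dots=\boldsymbol\Sigma_k$. Then $\frac{\log\Lambda_n-\mu_n}{n\sigma_n}$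 converges in distribution to $N(0,1)$ as $p\to\infty$, where $$\mu_n=\frac14\Big[-2kp-\sum_{i=1}^ky_i+nr_n^2(2p-2n+3)-\sum_{i=1}^kn_ir_{n_i'}^2(2p-2n_i+3)\Big],\qquad \sigma_n^2=\frac12\Big(\sum_{i=1}^k\frac{n_i^2}{n^2}r_{n_i'}^2-r_n^2\Big)>0,$$ $n_i'=n_i-1$, and $r_x=(-\log(1-\frac px))^{1/2}$ for $x>p$.
   Context: $|\cdot|$ denotes the determinant. $\Lambda_n$ is the likelihood ratio statistic for testing that $k$ normal distributions are identical. *)

theory Defs
  imports "HOL-Probability.Probability" "Jordan_Normal_Form.Determinant"
begin

text \<open>A random vector X (values: functions on {..<p}, i.e. points of R^p)
  is N_p(mu, S) (S positive definite): X is a measurable random vector and every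
  nontrivial linear combination a'X is univariate normal with mean a'mu and
  variance a'Sa (Cramer-Wold characterisation of the multivariate normal law).\<close>
definition mvn :: "'a measure \<Rightarrow> nat \<Rightarrow> ('a \<Rightarrow> nat \<Rightarrow> real) \<Rightarrow> (nat \<Rightarrow> real)
    \<Rightarrow> (nat \<Rightarrow> nat \<Rightarrow> real) \<Rightarrow> bool" where
  "mvn M p X mu S \<longleftrightarrow>
     X \<in> measurable M (PiM {..<p} (\<lambda>_. borel)) \<and>
     (\<forall>a. (\<exists>l<p. a l \<noteq> 0) \<longrightarrow>
        distributed M lborel (\<lambda>\<omega>. \<Sum>l<p. a l * X \<omega> l)
          (normal_density (\<Sum>l<p. a l * mu l) (sqrt (\<Sum>l<p. \<Sum>m<p. a l * S l m * a m))))"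

definition pos_def_mat :: "nat \<Rightarrow> (nat \<Rightarrow> nat \<Rightarrow> real) \<Rightarrow> bool" where
  "pos_def_mat p S \<longleftrightarrow> (\<forall>l<p. \<forall>m<p. S l m = S m l) \<and>
     (\<forall>a. (\<exists>l<p. a l \<noteq> 0) \<longrightarrow> (\<Sum>l<p. \<Sum>m<p. a l * S l m * a m) > 0)"

text \<open>Sample statistics; z i j l = l-th coordinate of y_ij, ns i = n_i, groups i < k.\<close>
definition ntot :: "nat \<Rightarrow> (nat \<Rightarrow> nat) \<Rightarrow> nat" where
  "ntot k ns = (\<Sum>i<k. ns i)"

definition ybar_i :: "(nat \<Rightarrow> nat \<Rightarrow> nat \<Rightarrow> real) \<Rightarrow> (nat \<Rightarrow> nat) \<Rightarrow> nat \<Rightarrow> nat \<Rightarrow> real" where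
  "ybar_i z ns i l = (1 / real (ns i)) * (\<Sum>j<ns i. z i j l)"

definition ybar :: "nat \<Rightarrow> (nat \<Rightarrow> nat \<Rightarrow> nat \<Rightarrow> real) \<Rightarrow> (nat \<Rightarrow> nat) \<Rightarrow> nat \<Rightarrow> real" where
  "ybar k z ns l = (1 / real (ntot k ns)) * (\<Sum>i<k. real (ns i) * ybar_i z ns i l)"

definition Amat :: "nat \<Rightarrow> nat \<Rightarrow> (nat \<Rightarrow> nat \<Rightarrow> nat \<Rightarrow> real) \<Rightarrow> (nat \<Rightarrow> nat) \<Rightarrow> real mat" where
  "Amat p k z ns = mat p p (\<lambda>(a, b). \<Sum>i<k. real (ns i) *
      (ybar_i z ns i a - ybar k z ns a) * (ybar_i z ns i b - ybar k z ns b))"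

definition Bmat_i :: "nat \<Rightarrow> (nat \<Rightarrow> nat \<Rightarrow> nat \<Rightarrow> real) \<Rightarrow> (nat \<Rightarrow> nat) \<Rightarrow> nat \<Rightarrow> real mat" where
  "Bmat_i p z ns i = mat p p (\<lambda>(a, b). \<Sum>j<ns i.
      (z i j a - ybar_i z ns i a) * (z i j b - ybar_i z ns i b))"

definition Bmat :: "nat \<Rightarrow> nat \<Rightarrow> (nat \<Rightarrow> nat \<Rightarrow> nat \<Rightarrow> real) \<Rightarrow> (nat \<Rightarrow> nat) \<Rightarrow> real mat" where
  "Bmat p k z ns = mat p p (\<lambda>(a, b). \<Sum>i<k. Bmat_i p z ns i $$ (a, b))"

definition Lambda :: "nat \<Rightarrow> nat \<Rightarrow> (nat \<Rightarrow> nat \<Rightarrow> nat \<Rightarrow> real) \<Rightarrow> (nat \<Rightarrow> nat) \<Rightarrow> real" where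
  "Lambda p k z ns =
     (\<Prod>i<k. det (Bmat_i p z ns i) powr (real (ns i) / 2))
       / det (Amat p k z ns + Bmat p k z ns) powr (real (ntot k ns) / 2)
     * (real (ntot k ns) powr (real p * real (ntot k ns) / 2)
        / (\<Prod>i<k. real (ns i) powr (real p * real (ns i) / 2)))"

definition r_fun :: "nat \<Rightarrow> real \<Rightarrow> real" where
  "r_fun p x = sqrt (- ln (1 - real p / x))"

definition mu_n :: "nat \<Rightarrow> nat \<Rightarrow> (nat \<Rightarrow> nat) \<Rightarrow> (nat \<Rightarrow> real) \<Rightarrow> real" where
  "mu_n p k ns y = (1/4) * (- 2 * real k * real p - (\<Sum>i<k. y i)
     + real (ntot k ns) * (r_fun p (real (ntot k ns)))\<^sup>2 * (2 * real p - 2 * real (ntot k ns) + 3)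
     - (\<Sum>i<k. real (ns i) * (r_fun p (real (ns i) - 1))\<^sup>2 * (2 * real p - 2 * real (ns i) + 3)))"

definition sigma2_n :: "nat \<Rightarrow> nat \<Rightarrow> (nat \<Rightarrow> nat) \<Rightarrow> real" where
  "sigma2_n p k ns = (1/2) * ((\<Sum>i<k. (real (ns i))\<^sup>2 / (real (ntot k ns))\<^sup>2 * (r_fun p (real (ns i) - 1))\<^sup>2)
     - (r_fun p (real (ntot k ns)))\<^sup>2)"

end

theory Submission
  imports Defs
begin

text \<open>
  Append the columns of the data matrix one at a time and write every determinant as a product of
  ratios of successive Gram determinants (the intercept being column 0). After whitening, the new
  column is a standard Gaussian vector independent of the previous ones, and the group ratios \<open>R i\<close>
  and the pooled ratio \<open>T\<close> are sums of squares over parts of one orthonormal basis. The direction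
  and the length of a Gaussian vector being independent, the contribution of column \<open>m\<close> to the
  characteristic function of \<open>ln Lambda\<close> is an explicit quotient of Gamma functions, which does not
  depend on the previous columns; so the characteristic function is the product of these quotients.

  A third order Taylor expansion of \<open>ln_Gamma\<close> along the imaginary direction reduces the limit to sums
  of digamma and trigamma values at half integers. All errors are bounded by a multiple of
  \<open>\<Sum> 1 / ((n_i - p) sigma)\<close>, which tends to 0: if \<open>y_i < 1\<close> then \<open>n_i - p\<close> diverges and \<open>sigma\<close>
  stays away from 0, and if \<open>y_i = 1\<close> then \<open>sigma\<close> diverges. Levy's continuity theorem concludes.
\<close>

section \<open>Digamma and trigamma asymptotics\<close>

text \<open>The obstacle is \<open>y_i = 1\<close>: the last column then may have as few as
  \<open>n_i - p = 2\<close> degrees of freedom, so expansions in powers of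
  \<open>1 / (n_i - p)\<close> are of no use. Moreover the imaginary shift \<open>t n_i / 2\<close>
  of the Gamma arguments need not tend to 0; it is only bounded by \<open>|s| / (2 sigma)\<close>.
  Hence every remainder is explicit, holds for all real shifts, and is a constant times
  \<open>1 / M^2\<close> at the argument \<open>M / 2\<close>; summing over
  \<open>M >= n_i - p\<close> gives multiples of \<open>1 / (n_i - p)\<close>. The assumption
  \<open>n_i > p + 1\<close> enters as \<open>M / 2 >= 1\<close>. The 3 in \<open>mu_n\<close> comes
  from summing \<open>Digamma (M / 2)\<close>, which is \<open>ln (M / 2) - 1 / M\<close> up to
  \<open>O(1 / M^2)\<close>: the discrete antiderivative is \<open>(m - 3/2) ln m - m\<close>, apart
  from \<open>ln 2\<close>, where \<open>1/2\<close> is the one of Stirling's formula and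
  \<open>1\<close> stems from \<open>- 1 / M\<close>. The summand \<open>- 2 k p\<close> comes from
  evaluating \<open>r\<close> at \<open>n_i - 1\<close> instead of \<open>n_i\<close> in the
  groups.\<close>

lemma telescope_sum_inverse:
  fixes x :: real
  assumes "x > 0"
  shows "(\<Sum>k<m. 1 / ((x + real k) * (x + real k + 1))) = 1 / x - 1 / (x + real m)"
proof (induction m)
  case (Suc m)
  have "1 / (a * (a + 1)) = 1 / a - 1 / (a + 1)" if "a > 0" for a :: real
    using that by (simp add: field_simps)
  from this[of "x + real m"] show ?case using Suc assms by (simp add: add_ac)
qed simp

text \<open>The telescoping series with terms \<open>1 / ((x + k) (x + k + 1))\<close> and sum
  \<open>1 / x\<close> lies termwise below the series of \<open>1 / (x + k)^2\<close> and above the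
  same series without its first term.\<close>

lemma Polygamma1_real_bounds:
  fixes x :: real
  assumes x: "x > 0"
  shows "1 / x \<le> Polygamma 1 x" and "Polygamma 1 x \<le> 1 / x + 1 / x\<^sup>2"
proof -
  define f where "f k = inverse ((x + real k)^2)" for k
  have sm: "summable f" unfolding f_def using Polygamma_converges'[of x 2] x by simp
  have P: "Polygamma 1 x = suminf f" by (simp add: Polygamma_def f_def[abs_def] numeral_2_eq_2)
  have "(\<lambda>m. 1 / x - 1 / (x + real m)) \<longlonglongrightarrow> 1 / x - 0"
    by (intro tendsto_intros) real_asymp
  hence T: "(\<lambda>k. 1 / ((x + real k) * (x + real k + 1))) sums (1 / x)"
    using telescope_sum_inverse[OF x] by (simp add: sums_def)
  have "1 / x \<le> suminf f"
    unfolding sums_unique[OF T]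
  proof (rule suminf_le)
    fix k
    have pos: "x + real k > 0" using x by (simp add: add_pos_nonneg)
    show "1 / ((x + real k) * (x + real k + 1)) \<le> f k"
      using pos by (auto simp: f_def inverse_eq_divide power2_eq_square intro!: frac_le mult_mono)
  qed (use T sm in \<open>auto simp: sums_iff\<close>)
  thus "1 / x \<le> Polygamma 1 x" using P by simp
  have "suminf f = f 0 + (\<Sum>k. f (Suc k))" using suminf_split_head[OF sm] by simp
  also have "(\<Sum>k. f (Suc k)) \<le> 1 / x"
    unfolding sums_unique[OF T]
  proof (rule suminf_le)
    fix k
    have pos: "x + real k > 0" using x by (simp add: add_pos_nonneg)
    show "f (Suc k) \<le> 1 / ((x + real k) * (x + real k + 1))"
      using pos by (auto simp: f_def inverse_eq_divide power2_eq_square add_ac intro!: frac_le mult_mono)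
  qed (use T sm in \<open>auto simp: sums_iff summable_Suc_iff\<close>)
  finally show "Polygamma 1 x \<le> 1 / x + 1 / x\<^sup>2"
    using P by (simp add: f_def divide_inverse)
qed

text \<open>Since \<open>|z + k| >= a + k\<close>, the cube is at least \<open>a (a + k)^2\<close>,
  which reduces the cubic series to \<open>Polygamma 1 a / a\<close>. The constant 4 is the factor 2
  in \<open>Polygamma 2\<close> times the 2 from \<open>1 / a + 1 / a^2 <= 2 / a\<close>.\<close>

lemma Polygamma2_complex_bound:
  fixes z :: complex
  assumes z: "1 \<le> a" "a \<le> Re z"
  shows "norm (Polygamma 2 z) \<le> 4 / a\<^sup>2"
proof -
  define g where "g k = inverse a * inverse ((a + real k)^2)" for k
  have a0: "a > 0" using z by simp
  have le: "norm (inverse ((z + of_nat k) ^ Suc 2)) \<le> g k" for k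
  proof -
    have pos: "a + real k > 0" using a0 by (simp add: add_pos_nonneg)
    have "a + real k \<le> Re (z + of_nat k)" using z by simp
    also have "\<dots> \<le> norm (z + of_nat k)" by (rule complex_Re_le_cmod)
    finally have n: "a + real k \<le> norm (z + of_nat k)" .
    have "a * (a + real k)^2 \<le> (a + real k) * (a + real k)^2"
      using a0 by (intro mult_right_mono) auto
    also have "\<dots> = (a + real k)^3" by (simp add: power2_eq_square power3_eq_cube)
    also have "\<dots> \<le> norm (z + of_nat k)^3" using n pos by (intro power_mono) auto
    finally have "inverse (norm (z + of_nat k)^3) \<le> inverse (a * (a + real k)^2)"
      using a0 pos by (intro le_imp_inverse_le) auto
    moreover have "Suc 2 = 3" by simp
    ultimately show ?thesis by (simp only: norm_inverse norm_power g_def inverse_mult_distrib)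
  qed
  have sg: "summable g" unfolding g_def
    using Polygamma_converges'[of a 2] a0 by (intro summable_mult) simp
  have "Polygamma 2 z = - 2 * (\<Sum>k. inverse ((z + of_nat k) ^ Suc 2))"
    by (simp add: Polygamma_def)
  hence "norm (Polygamma 2 z) = 2 * norm (\<Sum>k. inverse ((z + of_nat k) ^ Suc 2))"
    by (simp add: norm_mult)
  also have "norm (\<Sum>k. inverse ((z + of_nat k) ^ Suc 2)) \<le> suminf g"
    by (rule norm_suminf_le[OF le sg])
  also have "suminf g = inverse a * Polygamma 1 a"
    unfolding g_def using Polygamma_converges'[of a 2] a0
    by (subst suminf_mult) (auto simp: Polygamma_def power2_eq_square)
  also have "\<dots> \<le> inverse a * (1 / a + 1 / a\<^sup>2)"
    using Polygamma1_real_bounds[OF a0] a0 by (intro mult_left_mono) auto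
  also have "\<dots> \<le> inverse a * (2 / a)"
    using z a0 by (intro mult_left_mono) (auto simp: field_simps power2_eq_square)
  finally show ?thesis by (simp add: power2_eq_square divide_inverse mult.assoc)
qed

text \<open>Taylor's formula on the convex half-plane \<open>a <= Re z\<close>, where the third
  derivative is uniformly bounded; hence the estimate is valid for every \<open>b\<close>, small or
  large.\<close>

lemma ln_Gamma_taylor:
  fixes a b :: real
  assumes a: "1 \<le> a"
  shows "norm (ln_Gamma (Complex a b) - ln_Gamma (complex_of_real a)
            - (\<i> * of_real (b * Digamma a) - of_real (b\<^sup>2 / 2 * Polygamma 1 a)))
          \<le> 2 * \<bar>b\<bar>^3 / a\<^sup>2"
proof -
  define f where "f k = (if k = 0 then ln_Gamma else Polygamma (k - 1) :: complex \<Rightarrow> complex)" for k :: nat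
  define S where "S = {z. a \<le> Re z}"
  define w where "w = complex_of_real a"
  define z where "z = Complex a b"
  have zw: "z - w = \<i> * of_real b" by (simp add: z_def w_def complex_eq_iff)
  have conv: "convex S" unfolding S_def by (rule convex_halfspace_Re_ge)
  have np: "x \<notin> \<int>\<^sub>\<le>\<^sub>0" "x \<notin> \<real>\<^sub>\<le>\<^sub>0" if "x \<in> S" for x
    using that a by (auto simp: S_def complex_nonpos_Reals_iff elim!: nonpos_Ints_cases)
  have D: "(f i has_field_derivative f (Suc i) x) (at x within S)" if "x \<in> S" "i \<le> 2" for i x
  proof (cases "i = 0")
    case True
    thus ?thesis using np[OF that(1)]
      by (auto simp: f_def intro: DERIV_subset[OF has_field_derivative_ln_Gamma_complex])
  next
    case False
    then obtain j where "i = Suc j" by (cases i) auto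
    thus ?thesis using has_field_derivative_Polygamma[OF np(1)[OF that(1)], of j S]
      by (simp add: f_def)
  qed
  have B: "norm (f (Suc 2) x) \<le> 4 / a\<^sup>2" if "x \<in> S" for x
    using Polygamma2_complex_bound[OF a, of x] that by (simp add: f_def S_def)
  \<comment> \<open>The remainder of \<open>complex_Taylor\<close> is divided by
    \<open>fact 2\<close> and not \<open>fact 3\<close>, so the final constant is
    \<open>4 / 2 = 2\<close>.\<close>
  have "norm (f 0 z - (\<Sum>i\<le>2. f i w * (z - w) ^ i / fact i)) \<le> 4 / a\<^sup>2 * norm (z - w) ^ Suc 2 / fact 2"
    by (rule complex_Taylor[OF conv D B]) (auto simp: S_def z_def w_def)
  moreover have "(\<Sum>i\<le>2. f i w * (z - w) ^ i / fact i) = ln_Gamma w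
     + (\<i> * of_real (b * Digamma a) - of_real (b\<^sup>2 / 2 * Polygamma 1 a))"
  proof -
    have "(\<Sum>i\<le>2. f i w * (z - w) ^ i / fact i) = f 0 w + f 1 w * (z - w) + f 2 w * (z - w)\<^sup>2 / 2"
      by (simp add: numeral_2_eq_2)
    also have "\<dots> = ln_Gamma w + of_real (Digamma a) * (\<i> * of_real b)
        + of_real (Polygamma 1 a) * (\<i> * of_real b)\<^sup>2 / 2"
      unfolding zw using a by (simp add: f_def w_def Polygamma_of_real)
    finally show ?thesis by (simp add: power_mult_distrib)
  qed
  moreover have "norm (z - w) ^ Suc 2 = \<bar>b\<bar>^3" by (simp add: zw norm_mult eval_nat_numeral)
  ultimately show ?thesis
    by (simp add: f_def z_def w_def diff_diff_eq)
qed

lemma ln_1p_bounds: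
  fixes u :: real
  assumes u: "0 \<le> u"
  shows "ln (1 + u) \<le> u" "u - u\<^sup>2 / 2 \<le> ln (1 + u)" "ln (1 + u) \<le> u - u\<^sup>2 / 2 + u^3 / 3"
proof -
  show "ln (1 + u) \<le> u" using u by (intro ln_add_one_self_le_self) auto
  have "(\<lambda>u. ln (1 + u) - u + u\<^sup>2 / 2) 0 \<le> (\<lambda>u. ln (1 + u) - u + u\<^sup>2 / 2) u"
  proof (rule DERIV_nonneg_imp_nondecreasing[OF u])
    fix x :: real assume x: "0 \<le> x" "x \<le> u"
    have "((\<lambda>u. ln (1 + u) - u + u\<^sup>2 / 2) has_real_derivative (x\<^sup>2 / (1 + x))) (at x)"
      using x by (auto intro!: derivative_eq_intros simp: field_simps power2_eq_square)
    thus "\<exists>y. ((\<lambda>u. ln (1 + u) - u + u\<^sup>2 / 2) has_real_derivative y) (at x) \<and> 0 \<le> y"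
      using x by (intro exI[of _ "x\<^sup>2 / (1 + x)"] conjI) auto
  qed
  thus "u - u\<^sup>2 / 2 \<le> ln (1 + u)" by simp
  have "(\<lambda>u. u - u\<^sup>2 / 2 + u^3 / 3 - ln (1 + u)) 0 \<le> (\<lambda>u. u - u\<^sup>2 / 2 + u^3 / 3 - ln (1 + u)) u"
  proof (rule DERIV_nonneg_imp_nondecreasing[OF u])
    fix x :: real assume x: "0 \<le> x" "x \<le> u"
    have "((\<lambda>u. u - u\<^sup>2 / 2 + u^3 / 3 - ln (1 + u)) has_real_derivative (x^3 / (1 + x))) (at x)"
      using x by (auto intro!: derivative_eq_intros simp: field_simps power2_eq_square power3_eq_cube)
    thus "\<exists>y. ((\<lambda>u. u - u\<^sup>2 / 2 + u^3 / 3 - ln (1 + u)) has_real_derivative y) (at x) \<and> 0 \<le> y"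
      using x by (intro exI[of _ "x^3 / (1 + x)"] conjI) auto
  qed
  thus "ln (1 + u) \<le> u - u\<^sup>2 / 2 + u^3 / 3" by simp
qed

lemma neg_ln_1m_bounds:
  fixes v :: real
  assumes v: "0 \<le> v" "v \<le> 1 / 2"
  shows "v \<le> - ln (1 - v)" "- ln (1 - v) \<le> v + 2 * v\<^sup>2" "- ln (1 - v) \<le> 2 * v"
proof -
  show "v \<le> - ln (1 - v)" using ln_add_one_self_le_self2[of "- v"] v by simp
  show B: "- ln (1 - v) \<le> v + 2 * v\<^sup>2" using ln_one_minus_pos_lower_bound[of v] v by simp
  have "v * v \<le> v * (1/2)" using v by (intro mult_left_mono) auto
  thus "- ln (1 - v) \<le> 2 * v" using B
    by (simp add: power2_eq_square)
qed

text \<open>One step of \<open>x \<mapsto> Digamma x - ln x + 1/(2x)\<close> is the error of the trapezoidal rule for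
  \<open>1/t\<close> on \<open>[x, x + 1]\<close>.\<close>
lemma trapezoid_ln_1p:
  fixes u :: real
  assumes u: "0 \<le> u"
  shows "0 \<le> u / 2 + u / (2 * (1 + u)) - ln (1 + u)" "u / 2 + u / (2 * (1 + u)) - ln (1 + u) \<le> u^3 / 6"
proof -
  define f where "f u = u / 2 + u / (2 * (1 + u)) - ln (1 + u)" for u :: real
  have D: "(f has_real_derivative (x\<^sup>2 / (2 * (1 + x)\<^sup>2))) (at x)" if "0 \<le> x" for x
  proof -
    have "(f has_real_derivative (1 / 2 + (1 * (2 * (1 + x)) - x * 2) / (2 * (1 + x))\<^sup>2 - 1 / (1 + x))) (at x)"
      unfolding f_def[abs_def] using that
      by (auto intro!: derivative_eq_intros simp: power2_eq_square)
    also have "1 / 2 + (1 * (2 * (1 + x)) - x * 2) / (2 * (1 + x))\<^sup>2 - 1 / (1 + x) = x\<^sup>2 / (2 * (1 + x)\<^sup>2)"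
      using that by (simp add: divide_simps power2_eq_square) (simp add: algebra_simps)
    finally show ?thesis .
  qed
  have "f 0 \<le> f u"
  proof (rule DERIV_nonneg_imp_nondecreasing[OF u])
    fix x :: real assume x: "0 \<le> x" "x \<le> u"
    show "\<exists>y. (f has_real_derivative y) (at x) \<and> 0 \<le> y"
      using D[OF x(1)] by (intro exI conjI) auto
  qed
  thus "0 \<le> u / 2 + u / (2 * (1 + u)) - ln (1 + u)" by (simp add: f_def)
  have "(\<lambda>x. x^3 / 6 - f x) 0 \<le> (\<lambda>x. x^3 / 6 - f x) u"
  proof (rule DERIV_nonneg_imp_nondecreasing[OF u])
    fix x :: real assume x: "0 \<le> x" "x \<le> u"
    have "((\<lambda>x. x^3 / 6 - f x) has_real_derivative (x\<^sup>2 / 2 - x\<^sup>2 / (2 * (1 + x)\<^sup>2))) (at x)"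
      using D[OF x(1)] by (auto intro!: derivative_eq_intros)
    moreover have "x\<^sup>2 / (2 * (1 + x)\<^sup>2) \<le> x\<^sup>2 / 2"
      using x by (intro divide_left_mono) (auto simp: power2_eq_square algebra_simps add_pos_nonneg)
    ultimately show "\<exists>y. ((\<lambda>x. x^3 / 6 - f x) has_real_derivative y) (at x) \<and> 0 \<le> y"
      by (intro exI[of _ "x\<^sup>2 / 2 - x\<^sup>2 / (2 * (1 + x)\<^sup>2)"] conjI) auto
  qed
  thus "u / 2 + u / (2 * (1 + u)) - ln (1 + u) \<le> u^3 / 6" by (simp add: f_def)
qed

text \<open>Along \<open>x, x + 1, x + 2, ...\<close> the error \<open>e\<close> increases and
  \<open>e + 1 / y^2\<close> decreases, and both tend to 0; so
  \<open>e x <= 0 <= e x + 1 / x^2\<close>.\<close>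

lemma Digamma_real_asymp:
  fixes x :: real
  assumes x: "1 \<le> x"
  shows "\<bar>Digamma x - ln x + 1 / (2 * x)\<bar> \<le> 1 / x\<^sup>2"
proof -
  define e where "e y = Digamma y - ln y + 1 / (2 * y)" for y :: real
  define g where "g y = e y + 1 / y\<^sup>2" for y :: real
  have step: "e y \<le> e (y + 1)" "g (y + 1) \<le> g y" if y: "1 \<le> y" for y
  proof -
    define u where "u = 1 / y"
    have u: "0 < u" "u \<le> 1" using y by (auto simp: u_def)
    have yu: "y = 1 / u" by (simp add: u_def)
    have "e (y + 1) - e y = 1 / y - (ln (y + 1) - ln y) + 1 / (2 * (y + 1)) - 1 / (2 * y)"
      using y by (simp add: e_def Digamma_plus1)
    also have "ln (y + 1) - ln y = ln (1 + u)"
      using y ln_div[of "y + 1" y] by (simp add: u_def add_divide_distrib)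
    also have "1 / y - ln (1 + u) + 1 / (2 * (y + 1)) - 1 / (2 * y) = u / 2 + u / (2 * (1 + u)) - ln (1 + u)"
      using u by (simp add: yu divide_simps) (simp add: algebra_simps)
    finally have E: "e (y + 1) - e y = u / 2 + u / (2 * (1 + u)) - ln (1 + u)" .
    show "e y \<le> e (y + 1)" using E trapezoid_ln_1p(1)[of u] u by simp
    \<comment> \<open>The increase of \<open>e\<close>, at most \<open>u^3 / 6\<close>, has to be
      outweighed by the decrease of \<open>1 / y^2\<close> in one step. For \<open>u <= 1\<close>
      the crude bound \<open>(1 + u)^2 <= 4 <= 12\<close> is enough.\<close>
    have "(1 + u)\<^sup>2 \<le> 2\<^sup>2" using u by (intro power_mono) auto
    hence "u^3 * (1 + u)\<^sup>2 \<le> u^3 * 12" using u by (intro mult_left_mono) auto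
    also have "\<dots> \<le> 6 * (u\<^sup>2 * (2 * u + u\<^sup>2))"
      using u by (simp add: power2_eq_square power3_eq_cube algebra_simps)
    finally have "u^3 / 6 \<le> u\<^sup>2 * (2 * u + u\<^sup>2) / (1 + u)\<^sup>2"
      using u by (simp add: field_simps)
    also have "\<dots> = 1 / y\<^sup>2 - 1 / (y + 1)\<^sup>2"
      using u by (simp add: yu divide_simps) (simp add: algebra_simps power2_eq_square)
    finally have "u^3 / 6 \<le> 1 / y\<^sup>2 - 1 / (y + 1)\<^sup>2" .
    moreover have "e (y + 1) - e y \<le> u^3 / 6" unfolding E using trapezoid_ln_1p(2)[of u] u by simp
    ultimately show "g (y + 1) \<le> g y" unfolding g_def by linarith
  qed
  have lim: "(\<lambda>m. e (x + real m)) \<longlonglongrightarrow> 0"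
  proof -
    \<comment> \<open>By the recurrence, the partial sums in the limit formula for
      \<open>Digamma x\<close> turn into \<open>Digamma (x + m)\<close>, so that formula says that
      \<open>e (x + m)\<close> tends to 0.\<close>
    have D: "Digamma (x + real m) = Digamma x + (\<Sum>k<m. inverse (x + real k))" for m
    proof (induction m)
      case (Suc m)
      have "Digamma (x + real (Suc m)) = Digamma (x + real m) + 1 / (x + real m)"
        using Digamma_plus1[of "x + real m"] x by (simp add: add_ac)
      thus ?case using Suc by (simp add: divide_inverse)
    qed simp
    have "(\<lambda>m. ln (real m) - (\<Sum>k<m. inverse (x + real k))) \<longlonglongrightarrow> Digamma x"
      using Digamma_LIMSEQ[of x] x by simp
    hence "(\<lambda>m. Digamma x - (ln (real m) - (\<Sum>k<m. inverse (x + real k)))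
              - (ln (x + real m) - ln (real m)) + 1 / (2 * (x + real m))) \<longlonglongrightarrow> Digamma x - Digamma x - 0 + 0"
      by (intro tendsto_intros) (assumption | real_asymp)+
    thus ?thesis by (simp add: e_def D algebra_simps)
  qed
  have "(\<lambda>m. 1 / (x + real m)\<^sup>2) \<longlonglongrightarrow> 0" by real_asymp
  from tendsto_add[OF lim this] have limg: "(\<lambda>m. g (x + real m)) \<longlonglongrightarrow> 0" by (simp add: g_def)
  have "incseq (\<lambda>m. e (x + real m))"
    by (rule incseq_SucI) (use step(1)[of "x + real _"] x in \<open>simp add: add_ac\<close>)
  from incseq_le[OF this lim, of 0] have "e x \<le> 0" by simp
  moreover have "decseq (\<lambda>m. g (x + real m))"
    by (rule decseq_SucI) (use step(2)[of "x + real _"] x in \<open>simp add: add_ac\<close>)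
  from decseq_ge[OF this limg, of 0] have "g x \<ge> 0" by simp
  ultimately show ?thesis by (simp add: e_def g_def)
qed

section \<open>Sums of digamma and trigamma values at half integers\<close>

lemma sum_inverse_squares_le:
  assumes d: "2 \<le> d"
  shows "(\<Sum>M=d..<d+p. 1 / (real M)\<^sup>2) \<le> 2 / real d"
proof -
  have "(\<Sum>M=d..<d+p. 1 / (real M)\<^sup>2) \<le> (\<Sum>M=d..<d+p. (- 1 / (real (Suc M) - 1)) - (- 1 / (real M - 1)))"
  proof (rule sum_mono)
    fix M assume "M \<in> {d..<d+p}"
    hence M: "real M \<ge> 2" using d by auto
    hence "1 / (real M)\<^sup>2 \<le> 1 / (real M * (real M - 1))"
      unfolding power2_eq_square by (intro divide_left_mono mult_left_mono) auto
    also have "\<dots> = (- 1 / (real (Suc M) - 1)) - (- 1 / (real M - 1))"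
      using M by (simp add: field_simps)
    finally show "1 / (real M)\<^sup>2 \<le> (- 1 / (real (Suc M) - 1)) - (- 1 / (real M - 1))" .
  qed
  also have "\<dots> = - 1 / (real (d + p) - 1) - (- 1 / (real d - 1))"
    by (rule sum_Suc_diff') simp
  also have "\<dots> \<le> 1 / (real d - 1)" using d by simp
  also have "\<dots> \<le> 2 / real d" using d by (simp add: field_simps)
  finally show ?thesis .
qed

text \<open>After expanding \<open>ln (m + 1) - ln m\<close> in \<open>u = 1 / m\<close>, the
  coefficient \<open>3/2\<close> is the one for which the terms of order \<open>u\<close>
  cancel.\<close>

lemma log_stirling_step:
  fixes m :: real
  assumes m: "m \<ge> 1"
  defines "G \<equiv> \<lambda>m. (m - 3 / 2) * ln m - m"
  shows "\<bar>ln m - 1 / m - (G (m + 1) - G m)\<bar> \<le> 1 / m\<^sup>2"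
proof -
  define u L where "u = 1 / m" and "L = ln (1 + u)"
  have u: "0 < u" "u \<le> 1" and mu: "m * u = 1" using m by (auto simp: u_def)
  have "ln (m + 1) = ln m + L"
  proof -
    have "m + 1 = m * (1 + u)" using mu by (simp add: algebra_simps)
    thus ?thesis using m u ln_mult[of m "1 + u"] by (simp add: L_def)
  qed
  hence "G (m + 1) - G m - (ln m - u) = m * L - L / 2 - 1 + u"
    by (simp add: G_def algebra_simps)
  also have "\<dots> = (m * (L - (u - u\<^sup>2 / 2))) - (L - u) / 2"
  proof -
    have "m * u\<^sup>2 = u" by (simp add: power2_eq_square mu mult.assoc[symmetric])
    thus ?thesis using mu by (simp add: algebra_simps diff_divide_distrib add_divide_distrib)
  qed
  also have "\<dots> = (m * (L - (u - u\<^sup>2 / 2))) + (u - L) / 2"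
    by (simp only: minus_divide_left diff_conv_add_uminus minus_add_distrib minus_minus add.commute)
  finally have E: "G (m + 1) - G m - (ln m - u) = (m * (L - (u - u\<^sup>2 / 2))) + (u - L) / 2" .
  have b: "0 \<le> L - (u - u\<^sup>2 / 2)" "L - (u - u\<^sup>2 / 2) \<le> u^3 / 3" "0 \<le> u - L" "u - L \<le> u\<^sup>2 / 2"
    using ln_1p_bounds[of u] u by (auto simp: L_def)
  have "m * (L - (u - u\<^sup>2 / 2)) \<le> m * (u^3 / 3)" using b m by (intro mult_left_mono) auto
  also have "\<dots> = (m * u) * u\<^sup>2 / 3" by (simp add: power2_eq_square power3_eq_cube)
  finally have "m * (L - (u - u\<^sup>2 / 2)) \<le> u\<^sup>2 / 3" using mu by simp
  moreover have "0 \<le> m * (L - (u - u\<^sup>2 / 2))" using b m by simp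
  moreover have "0 \<le> u\<^sup>2" by simp
  moreover have "\<bar>w + e / 2\<bar> \<le> t" if "w \<le> t / 3" "0 \<le> w" "0 \<le> t" "0 \<le> e" "e \<le> t / 2"
    for w t e :: real
    using that by auto
  ultimately have "\<bar>G (m + 1) - G m - (ln m - u)\<bar> \<le> u\<^sup>2" unfolding E using b by blast
  thus ?thesis by (simp add: u_def power_divide abs_minus_commute)
qed

text \<open>The result is arranged so that \<open>ln (d + p) - ln d\<close> is the square of
  \<open>r_fun\<close> at \<open>d + p\<close> and \<open>d - 3/2\<close> is half of the factor
  \<open>2 n - 2 p - 3\<close> in \<open>mu_n\<close>. Each summand contributes an error
  \<open>4 / M^2\<close> from \<open>Digamma\<close> at \<open>M / 2\<close> and
  \<open>1 / M^2\<close> from \<open>log_stirling_step\<close>.\<close>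

lemma sum_Digamma_half_integers:
  assumes d: "2 \<le> d"
  shows "\<bar>(\<Sum>M=d..<d+p. Digamma (real M / 2)) + real p * ln 2 - real p * ln (real (d + p))
          - ((real d - 3 / 2) * (ln (real (d + p)) - ln (real d)) - real p)\<bar> \<le> 10 / real d"
proof -
  define G where "G m = (m - 3 / 2) * ln m - m" for m :: real
  have "\<bar>(\<Sum>M=d..<d+p. Digamma (real M / 2) + ln 2 - (G (real (Suc M)) - G (real M)))\<bar>
       \<le> (\<Sum>M=d..<d+p. \<bar>Digamma (real M / 2) + ln 2 - (G (real (Suc M)) - G (real M))\<bar>)"
    by (rule sum_abs)
  also have "\<dots> \<le> (\<Sum>M=d..<d+p. 5 * (1 / (real M)\<^sup>2))"
  proof (rule sum_mono)
    fix M assume "M \<in> {d..<d+p}"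
    hence M: "real M \<ge> 2" using d by auto
    have "\<bar>Digamma (real M / 2) - ln (real M / 2) + 1 / (2 * (real M / 2))\<bar> \<le> 1 / (real M / 2)\<^sup>2"
      using M by (intro Digamma_real_asymp) simp
    hence "\<bar>Digamma (real M / 2) + ln 2 - ln (real M) + 1 / real M\<bar> \<le> 4 * (1 / (real M)\<^sup>2)"
      using M by (simp add: ln_div power_divide algebra_simps)
    moreover have "\<bar>ln (real M) - 1 / real M - (G (real M + 1) - G (real M))\<bar> \<le> 1 / (real M)\<^sup>2"
      unfolding G_def using M by (intro log_stirling_step) simp
    ultimately show "\<bar>Digamma (real M / 2) + ln 2 - (G (real (Suc M)) - G (real M))\<bar> \<le> 5 * (1 / (real M)\<^sup>2)"
      by (simp add: add.commute)
  qed
  also have "\<dots> = 5 * (\<Sum>M=d..<d+p. 1 / (real M)\<^sup>2)" by (simp add: sum_distrib_left)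
  also have "\<dots> \<le> 5 * (2 / real d)" using sum_inverse_squares_le[OF d] by (intro mult_left_mono) auto
  finally have "\<bar>\<Sum>M=d..<d+p. Digamma (real M / 2) + ln 2 - (G (real (Suc M)) - G (real M))\<bar> \<le> 10 / real d"
    by simp
  moreover have "(\<Sum>M=d..<d+p. Digamma (real M / 2) + ln 2 - (G (real (Suc M)) - G (real M)))
      = (\<Sum>M=d..<d+p. Digamma (real M / 2)) + real p * ln 2 - (\<Sum>M=d..<d+p. G (real (Suc M)) - G (real M))"
    by (simp add: sum.distrib sum_subtractf)
  moreover have "(\<Sum>M=d..<d+p. G (real (Suc M)) - G (real M)) = G (real (d + p)) - G (real d)"
    by (rule sum_Suc_diff') simp
  moreover have "G (real (d + p)) - G (real d) = real p * ln (real (d + p)) +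
      ((real d - 3 / 2) * (ln (real (d + p)) - ln (real d)) - real p)"
    by (simp add: G_def algebra_simps)
  ultimately show ?thesis by simp
qed

lemma ln_ratio_pred:
  assumes "2 \<le> d"
  shows "ln (real (d + p) - 1) - ln (real d - 1) - (ln (real (d + p)) - ln (real d))
        = - ln (1 - 1 / real d) - (- ln (1 - 1 / real (d + p)))"
  using assms by (simp add: ln_div diff_divide_eq_iff)

text \<open>The version for the groups, which enter \<open>mu_n\<close> through \<open>r_fun\<close>
  at \<open>n_i - 1\<close>. Lowering both logarithms' arguments by one changes the main term by
  \<open>d (1 / d - 1 / (d + p)) = p / (d + p)\<close> up to \<open>O(1 / d)\<close>; this is the
  additional summand.\<close>

lemma sum_Digamma_half_integers_pred:
  assumes d: "2 \<le> d"
  shows "\<bar>(\<Sum>M=d..<d+p. Digamma (real M / 2)) + real p * ln 2 - real p * ln (real (d + p))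
          - ((real d - 3 / 2) * (ln (real (d + p) - 1) - ln (real d - 1)) - real p - real p / real (d + p))\<bar>
        \<le> 20 / real d"
proof -
  define N where "N = real (d + p)"
  define x where "x = real d"
  have x: "2 \<le> x" "x \<le> N" using d by (auto simp: x_def N_def)
  define e1 where "e1 = - ln (1 - 1 / x) - 1 / x"
  define e2 where "e2 = - ln (1 - 1 / N) - 1 / N"
  have v: "0 \<le> 1 / x" "1 / x \<le> 1 / 2" "0 \<le> 1 / N" "1 / N \<le> 1 / x" "1 / N \<le> 1 / 2"
    using x by (auto simp: frac_le divide_left_mono)
  have e1: "0 \<le> e1" "e1 \<le> 2 * (1 / x)\<^sup>2" using neg_ln_1m_bounds[of "1 / x"] v by (auto simp: e1_def)
  have e2: "0 \<le> e2" "e2 \<le> 2 * (1 / N)\<^sup>2" using neg_ln_1m_bounds[of "1 / N"] v by (auto simp: e2_def)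
  have "(1 / N)\<^sup>2 \<le> (1 / x)\<^sup>2" using v by (intro power_mono) auto
  hence "\<bar>e1 - e2\<bar> \<le> 2 * (1 / x)\<^sup>2" using e1 e2 by linarith
  hence "\<bar>(x - 3 / 2) * (e1 - e2)\<bar> \<le> x * (2 * (1 / x)\<^sup>2)"
    unfolding abs_mult using x by (intro mult_mono) auto
  also have "\<dots> = 2 * (1 / x)" using x by (simp add: power2_eq_square)
  finally have A: "\<bar>(x - 3 / 2) * (e1 - e2)\<bar> \<le> 2 * (1 / x)" .
  have dist: "a * b - c - a * d = a * (b - d) - c" for a b c d :: real by (simp add: algebra_simps)
  have "(x - 3 / 2) * (ln (N - 1) - ln (x - 1)) - real p / N - (x - 3 / 2) * (ln N - ln x)
     = (x - 3 / 2) * (ln (N - 1) - ln (x - 1) - (ln N - ln x)) - real p / N" by (rule dist)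
  also have "ln (N - 1) - ln (x - 1) - (ln N - ln x) = (e1 - e2) + (1 / x - 1 / N)"
    using ln_ratio_pred[OF d, of p] by (simp add: e1_def e2_def N_def x_def)
  also have "(x - 3 / 2) * ((e1 - e2) + (1 / x - 1 / N)) - real p / N
      = (x - 3 / 2) * (e1 - e2) - 3 / 2 * (1 / x) + 3 / 2 * (1 / N)"
  proof -
    have "real p = N - x" by (simp add: N_def x_def)
    hence pN: "real p / N = 1 - x * (1 / N)" using x by (simp add: diff_divide_distrib)
    have gen: "(x - 3 / 2) * (e + (i - j)) - (1 - x * j) = (x - 3 / 2) * e - 3 / 2 * i + 3 / 2 * j"
      if "x * i = 1" for i j e :: real
      using that by (simp add: algebra_simps diff_divide_distrib add_divide_distrib)
    show ?thesis unfolding pN by (rule gen) (use x in simp)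
  qed
  finally have "\<bar>(x - 3 / 2) * (ln (N - 1) - ln (x - 1)) - real p / N - (x - 3 / 2) * (ln N - ln x)\<bar> \<le> 5 * (1 / x)"
    using A v by linarith
  moreover have "\<bar>(\<Sum>M=d..<d+p. Digamma (real M / 2)) + real p * ln 2 - real p * ln N
          - ((x - 3 / 2) * (ln N - ln x) - real p)\<bar> \<le> 10 * (1 / x)"
    using sum_Digamma_half_integers[OF d, of p] by (simp add: N_def x_def)
  ultimately have "\<bar>(\<Sum>M=d..<d+p. Digamma (real M / 2)) + real p * ln 2 - real p * ln N
          - ((x - 3 / 2) * (ln (N - 1) - ln (x - 1)) - real p - real p / N)\<bar> \<le> 20 * (1 / x)"
    using v(1) by linarith
  thus ?thesis by (simp add: N_def x_def)
qed

text \<open>Both \<open>Polygamma 1 (M / 2) / 2\<close> and the increment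
  \<open>- ln (1 - 1 / M)\<close> of the telescoping logarithm lie between \<open>1 / M\<close> and
  \<open>1 / M + 2 / M^2\<close>.\<close>

lemma sum_Polygamma1_half_integers_pred:
  assumes d: "2 \<le> d"
  shows "\<bar>(\<Sum>M=d..<d+p. Polygamma 1 (real M / 2)) / 2 - (ln (real (d + p) - 1) - ln (real d - 1))\<bar> \<le> 4 / real d"
proof -
  have tel: "(\<Sum>M=d..<d+p. ln (real (Suc M) - 1) - ln (real M - 1)) = ln (real (d + p) - 1) - ln (real d - 1)"
    by (rule sum_Suc_diff') simp
  have "\<bar>(\<Sum>M=d..<d+p. Polygamma 1 (real M / 2) / 2 - (ln (real (Suc M) - 1) - ln (real M - 1)))\<bar>
     \<le> (\<Sum>M=d..<d+p. \<bar>Polygamma 1 (real M / 2) / 2 - (ln (real (Suc M) - 1) - ln (real M - 1))\<bar>)"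
    by (rule sum_abs)
  also have "\<dots> \<le> (\<Sum>M=d..<d+p. 2 * (1 / (real M)\<^sup>2))"
  proof (rule sum_mono)
    fix M assume "M \<in> {d..<d+p}"
    hence M: "real M \<ge> 2" using d by auto
    have "1 / real M \<le> Polygamma 1 (real M / 2) / 2" "Polygamma 1 (real M / 2) / 2 \<le> 1 / real M + 2 * (1 / (real M)\<^sup>2)"
      using Polygamma1_real_bounds[of "real M / 2"] M by (auto simp: power_divide)
    moreover have "ln (real (Suc M) - 1) - ln (real M - 1) = - ln (1 - 1 / real M)"
      using M by (simp add: ln_div diff_divide_eq_iff)
    moreover have "1 / real M \<le> - ln (1 - 1 / real M)" "- ln (1 - 1 / real M) \<le> 1 / real M + 2 * (1 / real M)\<^sup>2"
      using M by (auto intro!: neg_ln_1m_bounds)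
    ultimately show "\<bar>Polygamma 1 (real M / 2) / 2 - (ln (real (Suc M) - 1) - ln (real M - 1))\<bar> \<le> 2 * (1 / (real M)\<^sup>2)"
      by (simp only: power_divide abs_le_iff) simp
  qed
  also have "\<dots> = 2 * (\<Sum>M=d..<d+p. 1 / (real M)\<^sup>2)" by (simp add: sum_distrib_left)
  also have "\<dots> \<le> 2 * (2 / real d)" using sum_inverse_squares_le[OF d] by (intro mult_left_mono) auto
  finally show ?thesis using tel by (simp add: sum_subtractf sum_divide_distrib)
qed

lemma ln_ratio_pred_bound:
  assumes d: "2 \<le> d"
  shows "\<bar>ln (real (d + p) - 1) - ln (real d - 1) - (ln (real (d + p)) - ln (real d))\<bar> \<le> 4 / real d"
proof -
  have v: "0 \<le> 1 / real d" "1 / real d \<le> 1 / 2" "0 \<le> 1 / real (d + p)" "1 / real (d + p) \<le> 1 / real d"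
    using d by (auto simp: frac_le)
  hence v2: "1 / real (d + p) \<le> 1 / 2" by linarith
  show ?thesis unfolding ln_ratio_pred[OF d]
    using neg_ln_1m_bounds[OF v(1,2)] neg_ln_1m_bounds[OF v(3) v2] v by simp
qed

lemma sum_Polygamma1_half_integers:
  assumes d: "2 \<le> d"
  shows "\<bar>(\<Sum>M=d..<d+p. Polygamma 1 (real M / 2)) / 2 - (ln (real (d + p)) - ln (real d))\<bar> \<le> 8 / real d"
  using sum_Polygamma1_half_integers_pred[OF d, of p] ln_ratio_pred_bound[OF d, of p] by simp

text \<open>In column \<open>Suc l\<close> a sample of size \<open>d + p\<close> has
  \<open>d + p - Suc l\<close> degrees of freedom; over all \<open>p\<close> columns these run once
  through \<open>d, ..., d + p - 1\<close>.\<close>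

lemma sum_lessThan_reflect:
  "(\<Sum>l<p. f (d + p - Suc l)) = (\<Sum>M=d..<d+p. f M)"
  for f :: "nat \<Rightarrow> 'a :: comm_monoid_add"
proof -
  have "(\<Sum>l<p. f (d + p - Suc l)) = (\<Sum>l<p. f (d + l))"
    using sum.nat_diff_reindex[of "\<lambda>l. f (d + l)" p] by simp
  also have "\<dots> = (\<Sum>M=d..<d+p. f M)"
    using sum.shift_bounds_nat_ivl[of f 0 d p] by (simp add: lessThan_atLeast0 add.commute)
  finally show ?thesis .
qed

section \<open>The characteristic function exponent\<close>

lemma r_fun_sq:
  assumes "real p < x"
  shows "(r_fun p x)\<^sup>2 = ln x - ln (x - real p)"
proof -
  have "- ln (1 - real p / x) = ln x - ln (x - real p)"
    using assms ln_div[of "x - real p" x] by (simp add: diff_divide_distrib)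
  moreover have "ln (x - real p) \<le> ln x" using assms by simp
  ultimately show ?thesis by (simp add: r_fun_def)
qed

lemma r_fun_sq_nat: "2 \<le> d \<Longrightarrow> (r_fun p (real (d + p)))\<^sup>2 = ln (real (d + p)) - ln (real d)"
  using r_fun_sq[of p "real (d + p)"] by simp

lemma r_fun_sq_nat_pred:
  "2 \<le> d \<Longrightarrow> (r_fun p (real (d + p) - 1))\<^sup>2 = ln (real (d + p) - 1) - ln (real d - 1)"
  using r_fun_sq[of p "real (d + p) - 1"] by (simp add: algebra_simps)

text \<open>The quadratic coefficient of the upper bound must stay below 1, because it competes with
  \<open>k / 2 >= 1\<close> in the lower bound for the variance. The cubic coefficient
  \<open>2/3\<close> makes the derivative nonnegative up to \<open>1/2\<close>, and
  \<open>5/6 = 1/2 + 1/3\<close>.\<close>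

lemma neg_ln_1m_quadratic:
  fixes x :: real
  assumes x: "0 \<le> x" "x < 1"
  shows "x + x\<^sup>2 / 2 \<le> - ln (1 - x)" and "x \<le> 1 / 2 \<Longrightarrow> - ln (1 - x) \<le> x + 5 / 6 * x\<^sup>2"
proof -
  have "(\<lambda>x. - ln (1 - x) - x - x\<^sup>2 / 2) 0 \<le> (\<lambda>x. - ln (1 - x) - x - x\<^sup>2 / 2) x"
  proof (rule DERIV_nonneg_imp_nondecreasing[OF x(1)])
    fix z :: real assume z: "0 \<le> z" "z \<le> x"
    hence z1: "z < 1" using x by simp
    have "((\<lambda>x. - ln (1 - x) - x - x\<^sup>2 / 2) has_real_derivative z\<^sup>2 / (1 - z)) (at z)"
      using z z1 by (auto intro!: derivative_eq_intros simp: field_simps power2_eq_square)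
    thus "\<exists>y. ((\<lambda>x. - ln (1 - x) - x - x\<^sup>2 / 2) has_real_derivative y) (at z) \<and> 0 \<le> y"
      using z1 by (intro exI[of _ "z\<^sup>2 / (1 - z)"]) auto
  qed
  thus "x + x\<^sup>2 / 2 \<le> - ln (1 - x)" by simp
  assume x2: "x \<le> 1 / 2"
  have "(\<lambda>x. x + x\<^sup>2 / 2 + 2 / 3 * x^3 + ln (1 - x)) 0 \<le> (\<lambda>x. x + x\<^sup>2 / 2 + 2 / 3 * x^3 + ln (1 - x)) x"
  proof (rule DERIV_nonneg_imp_nondecreasing[OF x(1)])
    fix z :: real assume z: "0 \<le> z" "z \<le> x"
    hence z1: "z \<le> 1 / 2" using x2 by simp
    have "((\<lambda>x. x + x\<^sup>2 / 2 + 2 / 3 * x^3 + ln (1 - x)) has_real_derivative z\<^sup>2 * (1 - 2 * z) / (1 - z)) (at z)"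
      using z z1 by (auto intro!: derivative_eq_intros simp: field_simps power2_eq_square power3_eq_cube)
    thus "\<exists>y. ((\<lambda>x. x + x\<^sup>2 / 2 + 2 / 3 * x^3 + ln (1 - x)) has_real_derivative y) (at z) \<and> 0 \<le> y"
      using z z1 by (intro exI[of _ "z\<^sup>2 * (1 - 2 * z) / (1 - z)"]) auto
  qed
  hence "- ln (1 - x) \<le> x + x\<^sup>2 / 2 + 2 / 3 * x^3" by simp
  also have "x^3 \<le> x\<^sup>2 / 2" using x x2 mult_left_mono[of x "1/2" "x\<^sup>2"] by (simp add: power2_eq_square power3_eq_cube)
  finally show "- ln (1 - x) \<le> x + 5 / 6 * x\<^sup>2" by simp
qed

lemma ntot_ge_double:
  assumes k: "2 \<le> k" and ns: "\<And>i. i < k \<Longrightarrow> ns i > p + 1"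
  shows "2 * real p + 2 \<le> real (ntot k ns)"
proof -
  have "real p + 1 \<le> real (ns i)" if "i < k" for i using ns[OF that] by linarith
  hence "real k * (real p + 1) \<le> real (ntot k ns)"
    unfolding ntot_def of_nat_sum by (intro order.trans[OF _ sum_bounded_below[where K = "real p + 1"]]) auto
  moreover have "2 * (real p + 1) \<le> real k * (real p + 1)" using k by (intro mult_right_mono) auto
  ultimately show ?thesis by simp
qed

text \<open>Put \<open>x = p / N\<close>. The lower quadratic bound at \<open>p / n_i\<close>,
  weighted by \<open>n_i^2 / N^2\<close>, sums to \<open>x + k x^2 / 2\<close>, while the pooled
  term is at most \<open>x + 5 x^2 / 6\<close>. The linear terms cancel, and \<open>k >= 2\<close>
  leaves \<open>x^2 / 6\<close>, halved by the factor in \<open>sigma2_n\<close>.\<close>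

lemma sigma2_n_lower_bound:
  assumes k: "2 \<le> k" and ns: "\<And>i. i < k \<Longrightarrow> ns i > p + 1" and p: "1 \<le> p"
  shows "(real p / real (ntot k ns))\<^sup>2 / 12 \<le> sigma2_n p k ns"
proof -
  define N where "N = real (ntot k ns)"
  define x where "x = real p / N"
  have Nsum: "N = (\<Sum>i<k. real (ns i))" by (simp add: N_def ntot_def)
  have N: "N \<ge> 2 * real p + 2" unfolding N_def using k ns by (rule ntot_ge_double)
  hence N0: "N > 0" by simp
  have x: "0 < x" "x \<le> 1 / 2" using N p by (auto simp: x_def field_simps)
  have "ln (1 - x) \<le> 0" using x by simp
  hence R: "(r_fun p N)\<^sup>2 = - ln (1 - x)"
    by (simp add: r_fun_def x_def)
  have Ri: "real (ns i) * x + x\<^sup>2 * N / 2 \<le> (real (ns i))\<^sup>2 / N * (r_fun p (real (ns i) - 1))\<^sup>2" if i: "i < k" for i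
  proof -
    define z where "z = real p / real (ns i)"
    have m: "real (ns i) > real p + 1" using ns[OF i] by linarith
    have z: "0 < z" "z < 1" using m p by (auto simp: z_def)
    \<comment> \<open>Replacing \<open>n_i - 1\<close> by \<open>n_i\<close> only decreases the
      logarithmic term, which is harmless for a lower bound.\<close>
    have "real p / real (ns i) \<le> real p / (real (ns i) - 1)" using m by (intro divide_left_mono) auto
    moreover have l: "real p / (real (ns i) - 1) < 1" using m by simp
    ultimately have "ln (1 - real p / (real (ns i) - 1)) \<le> ln (1 - z)"
      by (simp add: z_def)
    moreover have "z + z\<^sup>2 / 2 \<le> - ln (1 - z)" using z by (intro neg_ln_1m_quadratic) auto
    moreover have "(r_fun p (real (ns i) - 1))\<^sup>2 = - ln (1 - real p / (real (ns i) - 1))"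
      using l m by (simp add: r_fun_def)
    ultimately have "z + z\<^sup>2 / 2 \<le> (r_fun p (real (ns i) - 1))\<^sup>2" by simp
    hence "(real (ns i))\<^sup>2 / N * (z + z\<^sup>2 / 2) \<le> (real (ns i))\<^sup>2 / N * (r_fun p (real (ns i) - 1))\<^sup>2"
      using N0 by (intro mult_left_mono) auto
    moreover have "(real (ns i))\<^sup>2 / N * (z + z\<^sup>2 / 2) = real (ns i) * x + x\<^sup>2 * N / 2"
      using m N0 by (simp add: z_def x_def field_simps power2_eq_square)
    ultimately show ?thesis by simp
  qed
  have "(\<Sum>i<k. real (ns i) * x + x\<^sup>2 * N / 2) \<le> (\<Sum>i<k. (real (ns i))\<^sup>2 / N * (r_fun p (real (ns i) - 1))\<^sup>2)"
    using Ri by (intro sum_mono) auto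
  also have "(\<Sum>i<k. real (ns i) * x + x\<^sup>2 * N / 2) = N * x + real k * (x\<^sup>2 * N / 2)"
    by (simp add: sum.distrib Nsum sum_distrib_right)
  finally have "(N * x + real k * (x\<^sup>2 * N / 2)) / N \<le> (\<Sum>i<k. (real (ns i))\<^sup>2 / N * (r_fun p (real (ns i) - 1))\<^sup>2) / N"
    using N0 by (intro divide_right_mono) auto
  also have "\<dots> = (\<Sum>i<k. (real (ns i))\<^sup>2 / N\<^sup>2 * (r_fun p (real (ns i) - 1))\<^sup>2)"
    by (simp add: sum_divide_distrib power2_eq_square)
  also have "(N * x + real k * (x\<^sup>2 * N / 2)) / N = x + real k / 2 * x\<^sup>2"
    using N0 by (simp add: field_simps)
  finally have A: "x + real k / 2 * x\<^sup>2 \<le> (\<Sum>i<k. (real (ns i))\<^sup>2 / N\<^sup>2 * (r_fun p (real (ns i) - 1))\<^sup>2)" .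
  have "1 * x\<^sup>2 \<le> real k / 2 * x\<^sup>2" using k by (intro mult_right_mono) auto
  moreover have "(r_fun p N)\<^sup>2 \<le> x + 5 / 6 * x\<^sup>2" unfolding R using x by (intro neg_ln_1m_quadratic) auto
  ultimately show ?thesis using A by (simp add: sigma2_n_def N_def[symmetric] x_def[symmetric])
qed

text \<open>Contribution of column \<open>m\<close> to the characteristic function of \<open>ln (Lambda p k z ns)\<close>.\<close>
definition column_cf :: "nat \<Rightarrow> (nat \<Rightarrow> nat) \<Rightarrow> nat \<Rightarrow> real \<Rightarrow> complex" where
  "column_cf k ns m t =
     (\<Prod>i<k. Gamma (Complex (real (ns i - m) / 2) (t * real (ns i) / 2)) / Gamma (complex_of_real (real (ns i - m) / 2)))
     * (Gamma (complex_of_real (real (ntot k ns - m) / 2)) /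
        Gamma (Complex (real (ntot k ns - m) / 2) (t * real (ntot k ns) / 2)))"

text \<open>The shift \<open>b\<close> is the same in all columns of a group. The constant is
  \<open>16 = 2 * 4 * 2\<close>: the Taylor remainder, the square of \<open>M / 2\<close>, and the
  sum of \<open>1 / M^2\<close>.\<close>

lemma sum_ln_Gamma_taylor:
  fixes b :: real
  assumes d: "2 \<le> d"
  shows "norm ((\<Sum>M=d..<d+p. ln_Gamma (Complex (real M / 2) b) - ln_Gamma (complex_of_real (real M / 2)))
     - (\<i> * of_real (b * (\<Sum>M=d..<d+p. Digamma (real M / 2)))
        - of_real (b\<^sup>2 / 2 * (\<Sum>M=d..<d+p. Polygamma 1 (real M / 2))))) \<le> 16 * \<bar>b\<bar>^3 / real d"
proof -
  have "(\<Sum>M=d..<d+p. ln_Gamma (Complex (real M / 2) b) - ln_Gamma (complex_of_real (real M / 2)))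
     - (\<i> * of_real (b * (\<Sum>M=d..<d+p. Digamma (real M / 2)))
        - of_real (b\<^sup>2 / 2 * (\<Sum>M=d..<d+p. Polygamma 1 (real M / 2))))
    = (\<Sum>M=d..<d+p. ln_Gamma (Complex (real M / 2) b) - ln_Gamma (complex_of_real (real M / 2))
         - (\<i> * of_real (b * Digamma (real M / 2)) - of_real (b\<^sup>2 / 2 * Polygamma 1 (real M / 2))))"
    (is "_ = ?S")
    by (simp add: sum_subtractf sum_distrib_left sum_distrib_right)
  moreover have "norm ?S \<le> (\<Sum>M=d..<d+p. 8 * \<bar>b\<bar>^3 * (1 / (real M)\<^sup>2))"
  proof (rule sum_norm_le)
    fix M assume "M \<in> {d..<d+p}"
    hence "1 \<le> real M / 2" using d by auto
    from ln_Gamma_taylor[OF this, of b]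
    show "norm (ln_Gamma (Complex (real M / 2) b) - ln_Gamma (complex_of_real (real M / 2))
         - (\<i> * of_real (b * Digamma (real M / 2)) - of_real (b\<^sup>2 / 2 * Polygamma 1 (real M / 2))))
        \<le> 8 * \<bar>b\<bar>^3 * (1 / (real M)\<^sup>2)"
      by (simp add: power_divide)
  qed
  moreover have "(\<Sum>M=d..<d+p. 8 * \<bar>b\<bar>^3 * (1 / (real M)\<^sup>2)) = 8 * \<bar>b\<bar>^3 * (\<Sum>M=d..<d+p. 1 / (real M)\<^sup>2)"
    by (simp add: sum_distrib_left)
  moreover have "\<dots> \<le> 8 * \<bar>b\<bar>^3 * (2 / real d)"
    using sum_inverse_squares_le[OF d] by (intro mult_left_mono) auto
  ultimately show ?thesis by simp
qed

text \<open>Writing the product as \<open>exp\<close> of a sum avoids every question of branches: no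
  logarithm of a product is taken, and only \<open>exp (ln_Gamma z) = Gamma z\<close> is
  used.\<close>

lemma prod_Gamma_ratio_eq_exp:
  fixes b :: real
  assumes d: "2 \<le> d"
  shows "(\<Prod>l<p. Gamma (Complex (real (d + p - Suc l) / 2) b) / Gamma (complex_of_real (real (d + p - Suc l) / 2)))
     = exp (\<Sum>M=d..<d+p. ln_Gamma (Complex (real M / 2) b) - ln_Gamma (complex_of_real (real M / 2)))"
proof -
  have G: "exp (ln_Gamma (Complex (real M / 2) b) - ln_Gamma (complex_of_real (real M / 2)))
      = Gamma (Complex (real M / 2) b) / Gamma (complex_of_real (real M / 2))" if "M \<ge> 1" for M
  proof -
    have "Complex (real M / 2) b \<notin> \<int>\<^sub>\<le>\<^sub>0" "complex_of_real (real M / 2) \<notin> \<int>\<^sub>\<le>\<^sub>0"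
      using that by (auto elim!: nonpos_Ints_cases simp: complex_eq_iff)
    thus ?thesis by (simp add: exp_diff Gamma_complex_altdef)
  qed
  have "(\<Prod>l<p. Gamma (Complex (real (d + p - Suc l) / 2) b) / Gamma (complex_of_real (real (d + p - Suc l) / 2)))
     = (\<Prod>l<p. exp (ln_Gamma (Complex (real (d + p - Suc l) / 2) b) - ln_Gamma (complex_of_real (real (d + p - Suc l) / 2))))"
  proof (rule prod.cong[OF refl])
    fix l assume "l \<in> {..<p}"
    hence "d + p - Suc l \<ge> 1" using d by auto
    from G[OF this, symmetric] show "Gamma (Complex (real (d + p - Suc l) / 2) b) / Gamma (complex_of_real (real (d + p - Suc l) / 2))
      = exp (ln_Gamma (Complex (real (d + p - Suc l) / 2) b) - ln_Gamma (complex_of_real (real (d + p - Suc l) / 2)))" .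
  qed
  thus ?thesis
    by (simp only: exp_sum[OF finite_lessThan, symmetric]
          sum_lessThan_reflect[of "\<lambda>M. ln_Gamma (Complex (real M / 2) b) - ln_Gamma (complex_of_real (real M / 2))" d p])
qed

text \<open>The logarithm of the deterministic factor of \<open>Lambda\<close>. Its summands cancel
  against the terms \<open>p ln n_i\<close> and \<open>p ln N\<close> of the digamma sums.\<close>

definition ln_norm_const :: "nat \<Rightarrow> nat \<Rightarrow> (nat \<Rightarrow> nat) \<Rightarrow> real" where
  "ln_norm_const p k ns = real p * real (ntot k ns) / 2 * ln (real (ntot k ns))
      - (\<Sum>i<k. real p * real (ns i) / 2 * ln (real (ns i)))"

text \<open>The constants are explicit and uniform in all parameters, so that the limit can be taken
  whether \<open>sig\<close> stays bounded or diverges. An exponent is estimated rather than the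
  product itself, because the errors of the columns add up in the exponent.\<close>

lemma cf_exponent_bound:
  fixes s :: real
  assumes k: "2 \<le> k" and ns: "\<And>i. i < k \<Longrightarrow> ns i > p + 1" and p: "1 \<le> p"
    and y: "\<And>i. i < k \<Longrightarrow> 0 < y i \<and> y i \<le> 1"
    and sig: "0 < sig" "sig\<^sup>2 = sigma2_n p k ns"
  defines "N \<equiv> ntot k ns"
  defines "t \<equiv> s / (real N * sig)"
  defines "E \<equiv> (\<Sum>i<k. 1 / (real (ns i - p)))"
  shows "\<exists>\<Xi>. exp (\<i> * of_real (t * (ln_norm_const p k ns - mu_n p k ns y))) * (\<Prod>l<p. column_cf k ns (Suc l) t) = exp \<Xi>
        \<and> norm (\<Xi> - of_real (- s\<^sup>2 / 2)) \<le> 16 * \<bar>s\<bar> * (E / sig) + 3 * s\<^sup>2 * (E / sig\<^sup>2) + 4 * \<bar>s\<bar>^3 * (E / sig^3)"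
proof -
  define d where "d i = ns i - p" for i
  define D where "D = N - p"
  have d: "2 \<le> d i" "d i + p = ns i" if "i < k" for i using ns[OF that] by (auto simp: d_def)
  have ns_le: "ns i \<le> N" if "i < k" for i
    unfolding N_def ntot_def using that by (intro member_le_sum) auto
  have D: "2 \<le> D" "D + p = N" using ns_le[of 0] ns[of 0] k by (auto simp: D_def)
  have dD: "d i \<le> D" if "i < k" for i using ns_le[OF that] by (simp add: d_def D_def)
  have N0: "real N > 0" using D by auto
  have Nsum: "real N = (\<Sum>i<k. real (ns i))" by (simp add: N_def ntot_def)
  define Di where "Di i = (\<Sum>M=d i..<d i+p. Digamma (real M / 2))" for i
  define DN where "DN = (\<Sum>M=D..<D+p. Digamma (real M / 2))"
  define Pi where "Pi i = (\<Sum>M=d i..<d i+p. Polygamma 1 (real M / 2))" for i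
  define PN where "PN = (\<Sum>M=D..<D+p. Polygamma 1 (real M / 2))"
  define Li where "Li i = (\<Sum>M=d i..<d i+p. ln_Gamma (Complex (real M / 2) (t * real (ns i) / 2)) - ln_Gamma (complex_of_real (real M / 2)))" for i
  define LN where "LN = (\<Sum>M=D..<D+p. ln_Gamma (Complex (real M / 2) (t * real N / 2)) - ln_Gamma (complex_of_real (real M / 2)))"
  define b where "b i = t * real (ns i) / 2" for i
  define bN where "bN = t * real N / 2"
  define \<theta> where "\<theta> = t * (ln_norm_const p k ns - mu_n p k ns y)"
  define \<Xi> where "\<Xi> = \<i> * of_real \<theta> + (\<Sum>i<k. Li i) - LN"
  have E0: "E \<ge> 0" unfolding E_def by (intro sum_nonneg) auto
  have Ed: "(\<Sum>i<k. 1 / real (d i)) = E" by (simp add: E_def d_def)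
  have ED: "1 / real D \<le> E"
  proof -
    have "1 / real D \<le> 1 / real (d 0)" using dD[of 0] d[of 0] k by (intro divide_left_mono) auto
    also have "\<dots> \<le> (\<Sum>i<k. 1 / real (d i))" using k by (intro member_le_sum) auto
    finally show ?thesis using Ed by simp
  qed
  have "(\<Prod>l<p. column_cf k ns (Suc l) t)
     = (\<Prod>i<k. \<Prod>l<p. Gamma (Complex (real (ns i - Suc l) / 2) (t * real (ns i) / 2)) / Gamma (complex_of_real (real (ns i - Suc l) / 2)))
       * inverse (\<Prod>l<p. Gamma (Complex (real (N - Suc l) / 2) (t * real N / 2)) / Gamma (complex_of_real (real (N - Suc l) / 2)))"
    unfolding column_cf_def N_def[symmetric]
    by (simp only: prod.distrib prod_inversef[symmetric] inverse_divide o_def, subst prod.swap, rule refl)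
  also have "(\<Prod>i<k. \<Prod>l<p. Gamma (Complex (real (ns i - Suc l) / 2) (t * real (ns i) / 2)) / Gamma (complex_of_real (real (ns i - Suc l) / 2)))
     = (\<Prod>i<k. exp (Li i))"
  proof (rule prod.cong[OF refl])
    fix i assume "i \<in> {..<k}"
    hence i: "i < k" by simp
    show "(\<Prod>l<p. Gamma (Complex (real (ns i - Suc l) / 2) (t * real (ns i) / 2)) / Gamma (complex_of_real (real (ns i - Suc l) / 2))) = exp (Li i)"
      using prod_Gamma_ratio_eq_exp[OF d(1)[OF i], of p "t * real (ns i) / 2"] unfolding Li_def d(2)[OF i] .
  qed
  also have "(\<Prod>l<p. Gamma (Complex (real (N - Suc l) / 2) (t * real N / 2)) / Gamma (complex_of_real (real (N - Suc l) / 2))) = exp LN"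
    unfolding LN_def using prod_Gamma_ratio_eq_exp[OF D(1), of p] D(2) by simp
  finally have eq: "exp (\<i> * of_real \<theta>) * (\<Prod>l<p. column_cf k ns (Suc l) t) = exp \<Xi>"
    by (simp add: \<Xi>_def exp_add exp_diff exp_sum divide_inverse mult.assoc)
  \<comment> \<open>\<open>A\<close> collects the centring and the first-order Taylor terms and has
    to be small; \<open>B\<close> collects the second-order terms and has to be close to
    \<open>s^2 / 2\<close>.\<close>
  define A where "A = \<theta> + (\<Sum>i<k. b i * Di i) - bN * DN"
  define B where "B = (\<Sum>i<k. (b i)\<^sup>2 / 2 * Pi i) - bN\<^sup>2 / 2 * PN"
  have bound_b: "\<bar>b i\<bar> \<le> \<bar>s\<bar> / (2 * sig)" if "i < k" for i
  proof -
    have "\<bar>b i\<bar> = (real (ns i) / real N) * (\<bar>s\<bar> / (2 * sig))"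
      using N0 sig(1) by (simp add: b_def t_def abs_mult mult_ac)
    also have "\<dots> \<le> 1 * (\<bar>s\<bar> / (2 * sig))" using ns_le[OF that] N0 sig by (intro mult_right_mono) auto
    finally show ?thesis by simp
  qed
  have bN: "bN = s / (2 * sig)" using N0 by (simp add: bN_def t_def)
  have main: "norm (\<Xi> - (\<i> * of_real A - of_real B)) \<le> 4 * \<bar>s\<bar>^3 * (E / sig^3)"
  proof -
    have "\<Xi> - (\<i> * of_real A - of_real B) =
       (\<Sum>i<k. Li i - (\<i> * of_real (b i * Di i) - of_real ((b i)\<^sup>2 / 2 * Pi i)))
       - (LN - (\<i> * of_real (bN * DN) - of_real (bN\<^sup>2 / 2 * PN)))"
      by (simp add: \<Xi>_def A_def B_def sum_subtractf sum.distrib sum_distrib_left algebra_simps)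
    also have "norm \<dots> \<le> (\<Sum>i<k. 2 * (\<bar>s\<bar>^3 / sig^3) * (1 / real (d i))) + 2 * (\<bar>s\<bar>^3 / sig^3) * (1 / real D)"
    proof (rule norm_triangle_le_diff, rule add_mono, rule sum_norm_le)
      fix i assume "i \<in> {..<k}" hence i: "i < k" by simp
      have "norm (Li i - (\<i> * of_real (b i * Di i) - of_real ((b i)\<^sup>2 / 2 * Pi i))) \<le> 16 * \<bar>b i\<bar>^3 / real (d i)"
        unfolding Li_def Di_def Pi_def b_def by (rule sum_ln_Gamma_taylor[OF d(1)[OF i]])
      also have "\<dots> \<le> 16 * (\<bar>s\<bar> / (2 * sig))^3 / real (d i)"
        using bound_b[OF i] by (intro divide_right_mono mult_left_mono power_mono) auto
      finally show "norm (Li i - (\<i> * of_real (b i * Di i) - of_real ((b i)\<^sup>2 / 2 * Pi i))) \<le> 2 * (\<bar>s\<bar>^3 / sig^3) * (1 / real (d i))"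
        by (simp add: power_divide power_mult_distrib)
    next
      have "norm (LN - (\<i> * of_real (bN * DN) - of_real (bN\<^sup>2 / 2 * PN))) \<le> 16 * \<bar>bN\<bar>^3 / real D"
        unfolding LN_def DN_def PN_def bN_def by (rule sum_ln_Gamma_taylor[OF D(1)])
      also have "\<dots> = 2 * (\<bar>s\<bar>^3 / sig^3) * (1 / real D)"
        using sig by (simp add: bN power_divide power_mult_distrib)
      finally show "norm (LN - (\<i> * of_real (bN * DN) - of_real (bN\<^sup>2 / 2 * PN))) \<le> 2 * (\<bar>s\<bar>^3 / sig^3) * (1 / real D)" .
    qed
    also have "\<dots> = 2 * (\<bar>s\<bar>^3 / sig^3) * E + 2 * (\<bar>s\<bar>^3 / sig^3) * (1 / real D)"
      by (simp only: sum_distrib_left[symmetric] Ed)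
    also have "\<dots> \<le> 2 * (\<bar>s\<bar>^3 / sig^3) * E + 2 * (\<bar>s\<bar>^3 / sig^3) * E"
      using ED sig by (intro add_left_mono mult_left_mono) auto
    finally show ?thesis by (simp add: algebra_simps)
  qed
  define Ri where "Ri i = (r_fun p (real (ns i) - 1))\<^sup>2" for i
  define RN where "RN = (r_fun p (real N))\<^sup>2"
  have Ri: "Ri i = ln (real (d i + p) - 1) - ln (real (d i) - 1)" if "i < k" for i
    using r_fun_sq_nat_pred[OF d(1)[OF that], of p] d(2)[OF that] by (simp add: Ri_def)
  have RN: "RN = ln (real (D + p)) - ln (real D)"
    using r_fun_sq_nat[OF D(1), of p] D(2) by (simp add: RN_def)
  \<comment> \<open>Errors of the digamma sums, in the form dictated by \<open>mu_n\<close>: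
    \<open>r_fun\<close> is taken at \<open>n_i - 1\<close> in the groups and at \<open>N\<close>
    for the pooled sample.\<close>
  define ei where "ei i = Di i + real p * ln 2 - real p * ln (real (ns i))
      - ((real (d i) - 3 / 2) * Ri i - real p - real p / real (ns i))" for i
  define eN where "eN = DN + real p * ln 2 - real p * ln (real N) - ((real D - 3 / 2) * RN - real p)"
  have ei: "\<bar>ei i\<bar> \<le> 20 / real (d i)" if "i < k" for i
    using sum_Digamma_half_integers_pred[OF d(1)[OF that], of p] Ri[OF that] d(2)[OF that]
    by (simp add: ei_def Di_def)
  have eN: "\<bar>eN\<bar> \<le> 10 / real D"
    using sum_Digamma_half_integers[OF D(1), of p] RN D(2) by (simp add: eN_def DN_def)
  have Abound: "\<bar>A\<bar> \<le> 16 * \<bar>s\<bar> * (E / sig)"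
  proof -
    \<comment> \<open>An exact identity: \<open>mu_n\<close> and \<open>ln_norm_const\<close> cancel
      the main terms, leaving the errors and the \<open>y\<close> part of \<open>mu_n\<close>. The
      terms with \<open>ln 2\<close> cancel because the shifts \<open>b i\<close> add up to
      \<open>bN\<close>.\<close>
    have A1: "A = (\<Sum>i<k. b i * ei i) - bN * eN + t * (\<Sum>i<k. y i) / 4"
    proof -
      have "(\<Sum>i<k. b i * ei i) = (\<Sum>i<k. b i * Di i) + (t * real N / 2) * real p * ln 2
           - t * (\<Sum>i<k. real p * real (ns i) / 2 * ln (real (ns i)))
           - t / 2 * (\<Sum>i<k. real (ns i) * Ri i * (real (ns i) - real p - 3 / 2)) + (t * real N / 2) * real p + t / 2 * (real k * real p)"
      proof -
        have "b i * ei i = b i * Di i + (t * real p * ln 2 / 2) * real (ns i)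
           - t * (real p * real (ns i) / 2 * ln (real (ns i)))
           - t / 2 * (real (ns i) * Ri i * (real (ns i) - real p - 3 / 2)) + (t * real p / 2) * real (ns i) + t / 2 * real p" if "i < k" for i
        proof -
          have di: "real (d i) = real (ns i) - real p" and n0: "real (ns i) \<noteq> 0" using d[OF that] by auto
          show ?thesis unfolding b_def ei_def di using n0 by (simp add: field_simps)
        qed
        hence "(\<Sum>i<k. b i * ei i) = (\<Sum>i<k. b i * Di i + (t * real p * ln 2 / 2) * real (ns i)
           - t * (real p * real (ns i) / 2 * ln (real (ns i)))
           - t / 2 * (real (ns i) * Ri i * (real (ns i) - real p - 3 / 2)) + (t * real p / 2) * real (ns i) + t / 2 * real p)"
          by (intro sum.cong) auto
        also have "\<dots> = (\<Sum>i<k. b i * Di i) + (t * real p * ln 2 / 2) * real N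
           - t * (\<Sum>i<k. real p * real (ns i) / 2 * ln (real (ns i)))
           - t / 2 * (\<Sum>i<k. real (ns i) * Ri i * (real (ns i) - real p - 3 / 2)) + (t * real p / 2) * real N + real k * (t / 2 * real p)"
          unfolding Nsum by (simp only: sum.distrib sum_subtractf sum_distrib_left[symmetric]) simp
        finally show ?thesis by (simp add: algebra_simps)
      qed
      moreover have "bN * eN = bN * DN + (t * real N / 2) * real p * ln 2 - t * (real p * real N / 2 * ln (real N))
          - t / 2 * (real N * RN * (real N - real p - 3 / 2)) + (t * real N / 2) * real p"
      proof -
        have RD: "real D = real N - real p" using D by auto
        show ?thesis unfolding bN_def eN_def RD by (simp add: algebra_simps)
      qed
      moreover have "t * ln_norm_const p k ns = t * (real p * real N / 2 * ln (real N)) - t * (\<Sum>i<k. real p * real (ns i) / 2 * ln (real (ns i)))"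
        by (simp add: ln_norm_const_def N_def[symmetric] right_diff_distrib)
      moreover have "t * mu_n p k ns y = - t / 2 * (real k * real p) - t * (\<Sum>i<k. y i) / 4
          - t / 2 * (real N * RN * (real N - real p - 3 / 2)) + t / 2 * (\<Sum>i<k. real (ns i) * Ri i * (real (ns i) - real p - 3 / 2))"
      proof -
        have "(\<Sum>i<k. real (ns i) * Ri i * (2 * real p - 2 * real (ns i) + 3)) = - 2 * (\<Sum>i<k. real (ns i) * Ri i * (real (ns i) - real p - 3 / 2))"
          unfolding sum_distrib_left by (intro sum.cong) (auto simp: algebra_simps)
        hence mu: "mu_n p k ns y = (1/4) * (- 2 * real k * real p - (\<Sum>i<k. y i) + real N * RN * (2 * real p - 2 * real N + 3)
            + 2 * (\<Sum>i<k. real (ns i) * Ri i * (real (ns i) - real p - 3 / 2)))"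
          unfolding mu_n_def N_def[symmetric] Ri_def[symmetric] RN_def[symmetric] by simp
        show ?thesis unfolding mu by (simp add: algebra_simps)
      qed
      ultimately show ?thesis unfolding A_def \<theta>_def right_diff_distrib by simp
    qed
    have "\<bar>\<Sum>i<k. b i * ei i\<bar> \<le> (\<Sum>i<k. 10 * (\<bar>s\<bar> / sig) * (1 / real (d i)))"
    proof (rule order.trans[OF sum_abs sum_mono])
      fix i assume "i \<in> {..<k}" hence i: "i < k" by simp
      have "\<bar>b i * ei i\<bar> \<le> (\<bar>s\<bar> / (2 * sig)) * (20 / real (d i))"
        unfolding abs_mult using ei[OF i] bound_b[OF i] sig by (intro mult_mono) auto
      thus "\<bar>b i * ei i\<bar> \<le> 10 * (\<bar>s\<bar> / sig) * (1 / real (d i))" by simp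
    qed
    also have "\<dots> = 10 * (\<bar>s\<bar> / sig) * E" by (simp only: sum_distrib_left[symmetric] Ed)
    finally have 1: "\<bar>\<Sum>i<k. b i * ei i\<bar> \<le> 10 * (\<bar>s\<bar> / sig) * E" .
    have "\<bar>bN * eN\<bar> \<le> (\<bar>s\<bar> / (2 * sig)) * (10 / real D)"
      unfolding abs_mult using eN sig by (intro mult_mono) (auto simp: bN abs_mult)
    also have "\<dots> = 5 * (\<bar>s\<bar> / sig) * (1 / real D)" by simp
    also have "\<dots> \<le> 5 * (\<bar>s\<bar> / sig) * E" using ED sig by (intro mult_left_mono) auto
    finally have 2: "\<bar>bN * eN\<bar> \<le> 5 * (\<bar>s\<bar> / sig) * E" .
    have "\<bar>y i\<bar> \<le> 1" if "i < k" for i using y[OF that] by simp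
    hence "\<bar>\<Sum>i<k. y i\<bar> \<le> (\<Sum>i<k. 1)" by (intro order.trans[OF sum_abs sum_mono]) auto
    hence yk: "\<bar>\<Sum>i<k. y i\<bar> \<le> real k" by simp
    \<comment> \<open>Each \<open>d i\<close> is at most \<open>N\<close>. Hence the
      \<open>y\<close> part, at most \<open>|t| k = |s| k / (N sig)\<close>, fits into the same
      error \<open>E / sig\<close>.\<close>
    have "real k / real N \<le> E"
    proof -
      have "(\<Sum>i<k. 1 / real N) \<le> E" unfolding Ed[symmetric]
      proof (intro sum_mono divide_left_mono)
        fix i assume "i \<in> {..<k}"
        hence "d i \<le> D" "2 \<le> d i" using dD d by auto
        moreover have "D \<le> N" using D by simp
        ultimately show "real (d i) \<le> real N" "0 < real N * real (d i)" using N0 by auto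
      qed simp
      thus ?thesis by simp
    qed
    hence "(\<bar>s\<bar> / sig) * (real k / real N) \<le> (\<bar>s\<bar> / sig) * E" using sig by (intro mult_left_mono) auto
    moreover have "\<bar>t * (\<Sum>i<k. y i) / 4\<bar> \<le> (\<bar>s\<bar> / sig) * (real k / real N)"
    proof -
      have "\<bar>t * (\<Sum>i<k. y i) / 4\<bar> = \<bar>t\<bar> * \<bar>\<Sum>i<k. y i\<bar> / 4" by (simp add: abs_mult)
      also have "\<dots> \<le> \<bar>t\<bar> * real k" using mult_left_mono[OF yk, of "\<bar>t\<bar>"] mult_nonneg_nonneg[of "\<bar>t\<bar>" "real k"]
        by linarith
      also have "\<dots> = (\<bar>s\<bar> / sig) * (real k / real N)" using sig N0 by (simp add: t_def abs_mult)
      finally show ?thesis .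
    qed
    ultimately have 3: "\<bar>t * (\<Sum>i<k. y i) / 4\<bar> \<le> (\<bar>s\<bar> / sig) * E" by linarith
    \<comment> \<open>Here \<open>16 = 10 + 5 + 1\<close>: the groups, the pooled sample, and the
      \<open>y\<close> part.\<close>
    have "\<bar>A\<bar> \<le> 10 * (\<bar>s\<bar> / sig) * E + 5 * (\<bar>s\<bar> / sig) * E + (\<bar>s\<bar> / sig) * E"
      unfolding A1
      by (rule order.trans[OF abs_triangle_ineq add_mono[OF order.trans[OF abs_triangle_ineq4 add_mono[OF 1 2]] 3]])
    thus ?thesis by (simp add: algebra_simps)
  qed
  have Bbound: "\<bar>B - s\<^sup>2 / 2\<bar> \<le> 3 * s\<^sup>2 * (E / sig\<^sup>2)"
  proof -
    define fi where "fi i = Pi i / 2 - Ri i" for i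
    define fN where "fN = PN / 2 - RN"
    have fi: "\<bar>fi i\<bar> \<le> 4 / real (d i)" if "i < k" for i
      using sum_Polygamma1_half_integers_pred[OF d(1)[OF that], of p] Ri[OF that] by (simp add: fi_def Pi_def)
    have fN: "\<bar>fN\<bar> \<le> 8 / real D"
      using sum_Polygamma1_half_integers[OF D(1), of p] RN by (simp add: fN_def PN_def)
    have "B = (\<Sum>i<k. (b i)\<^sup>2 * fi i) - bN\<^sup>2 * fN + ((\<Sum>i<k. (b i)\<^sup>2 * Ri i) - bN\<^sup>2 * RN)"
      by (simp add: B_def fi_def fN_def right_diff_distrib sum_subtractf)
    also have "(\<Sum>i<k. (b i)\<^sup>2 * Ri i) - bN\<^sup>2 * RN = s\<^sup>2 / (4 * sig\<^sup>2) * ((\<Sum>i<k. (real (ns i))\<^sup>2 / (real N)\<^sup>2 * Ri i) - RN)"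
      by (simp add: right_diff_distrib sum_distrib_left bN b_def t_def power_divide power_mult_distrib mult_ac)
    \<comment> \<open>The origin of \<open>sigma2_n\<close>: it is the leading part of the trigamma
      sums, weighted with the squares of the shifts.\<close>
    also have "(\<Sum>i<k. (real (ns i))\<^sup>2 / (real N)\<^sup>2 * Ri i) - RN = 2 * sig\<^sup>2"
      unfolding sig(2) sigma2_n_def by (simp add: N_def Ri_def RN_def)
    also have "s\<^sup>2 / (4 * sig\<^sup>2) * (2 * sig\<^sup>2) = s\<^sup>2 / 2" using sig(1) by simp
    finally have B1: "B - s\<^sup>2 / 2 = (\<Sum>i<k. (b i)\<^sup>2 * fi i) - bN\<^sup>2 * fN" by simp
    have sq: "(\<bar>s\<bar> / (2 * sig))\<^sup>2 = s\<^sup>2 / sig\<^sup>2 / 4" by (simp add: power_divide power_mult_distrib)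
    have "\<bar>\<Sum>i<k. (b i)\<^sup>2 * fi i\<bar> \<le> (\<Sum>i<k. (s\<^sup>2 / sig\<^sup>2) * (1 / real (d i)))"
    proof (rule order.trans[OF sum_abs sum_mono])
      fix i assume "i \<in> {..<k}" hence i: "i < k" by simp
      have "\<bar>b i\<bar>\<^sup>2 \<le> (\<bar>s\<bar> / (2 * sig))\<^sup>2" using bound_b[OF i] by (intro power_mono) auto
      hence "\<bar>(b i)\<^sup>2 * fi i\<bar> \<le> (s\<^sup>2 / sig\<^sup>2 / 4) * (4 / real (d i))"
        unfolding abs_mult sq using fi[OF i] by (intro mult_mono) auto
      thus "\<bar>(b i)\<^sup>2 * fi i\<bar> \<le> (s\<^sup>2 / sig\<^sup>2) * (1 / real (d i))" by simp
    qed
    also have "\<dots> = (s\<^sup>2 / sig\<^sup>2) * E" by (simp only: sum_distrib_left[symmetric] Ed)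
    finally have 1: "\<bar>\<Sum>i<k. (b i)\<^sup>2 * fi i\<bar> \<le> (s\<^sup>2 / sig\<^sup>2) * E" .
    have "\<bar>bN\<^sup>2 * fN\<bar> \<le> (s\<^sup>2 / sig\<^sup>2 / 4) * (8 / real D)"
      unfolding abs_mult bN using fN by (intro mult_mono) (auto simp: power_divide power_mult_distrib)
    also have "\<dots> = 2 * (s\<^sup>2 / sig\<^sup>2) * (1 / real D)" by simp
    also have "\<dots> \<le> 2 * (s\<^sup>2 / sig\<^sup>2) * E" using ED by (intro mult_left_mono) auto
    finally have 2: "\<bar>bN\<^sup>2 * fN\<bar> \<le> 2 * (s\<^sup>2 / sig\<^sup>2) * E" .
    have "\<bar>B - s\<^sup>2 / 2\<bar> \<le> (s\<^sup>2 / sig\<^sup>2) * E + 2 * (s\<^sup>2 / sig\<^sup>2) * E"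
      unfolding B1 by (rule order.trans[OF abs_triangle_ineq4 add_mono[OF 1 2]])
    thus ?thesis by (simp add: algebra_simps)
  qed
  have "\<Xi> - of_real (- s\<^sup>2 / 2) = (\<Xi> - (\<i> * of_real A - of_real B)) + \<i> * of_real A - of_real (B - s\<^sup>2 / 2)"
    by simp
  also have "norm \<dots> \<le> norm (\<Xi> - (\<i> * of_real A - of_real B)) + \<bar>A\<bar> + \<bar>B - s\<^sup>2 / 2\<bar>"
    by (rule order.trans[OF norm_triangle_ineq4 add_mono[OF order.trans[OF norm_triangle_ineq]]])
       (auto simp: norm_mult simp del: of_real_diff)
  finally have "norm (\<Xi> - of_real (- s\<^sup>2 / 2)) \<le> 16 * \<bar>s\<bar> * (E / sig) + 3 * s\<^sup>2 * (E / sig\<^sup>2) + 4 * \<bar>s\<bar>^3 * (E / sig^3)"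
    using main Abound Bbound by linarith
  thus ?thesis using eq unfolding \<theta>_def by blast
qed

section \<open>Limits of the variance and of the product of Gamma quotients\<close>

locale high_dim_samples =
  fixes k :: nat and n :: "nat \<Rightarrow> nat \<Rightarrow> nat" and y :: "nat \<Rightarrow> real"
  assumes k2: "k \<ge> 2"
    and n_gt: "\<And>p i. p \<ge> 1 \<Longrightarrow> i < k \<Longrightarrow> n p i > p + 1"
    and y_lim: "\<And>i. i < k \<Longrightarrow> (\<lambda>p. real p / real (n p i)) \<longlonglongrightarrow> y i"
    and y_rng: "\<And>i. i < k \<Longrightarrow> 0 < y i \<and> y i \<le> 1"
begin

abbreviation "N p \<equiv> real (ntot k (n p))"
abbreviation "sg p \<equiv> sqrt (sigma2_n p k (n p))"

text \<open>The limit of \<open>N p / p\<close>.\<close>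

definition "Yinv = (\<Sum>i<k. 1 / y i)"

lemma Yinv_pos: "Yinv > 0"
  unfolding Yinv_def using k2 y_rng by (intro sum_pos) (auto simp: lessThan_empty_iff)

lemma p_over_N: "(\<lambda>p. real p / N p) \<longlonglongrightarrow> 1 / Yinv"
proof -
  have "(\<lambda>p. 1 / (\<Sum>i<k. 1 / (real p / real (n p i)))) \<longlonglongrightarrow> 1 / (\<Sum>i<k. 1 / y i)"
  proof (intro tendsto_divide tendsto_sum tendsto_const)
    fix i assume "i \<in> {..<k}"
    thus "(\<lambda>p. real p / real (n p i)) \<longlonglongrightarrow> y i" "y i \<noteq> 0" using y_lim y_rng[of i] by auto
  next
    show "(\<Sum>i<k. 1 / y i) \<noteq> 0" using Yinv_pos by (simp add: Yinv_def)
  qed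
  moreover have "\<forall>\<^sub>F p in sequentially. 1 / (\<Sum>i<k. 1 / (real p / real (n p i))) = real p / N p"
    using eventually_ge_at_top[of 1]
    by eventually_elim (simp add: ntot_def sum_divide_distrib[symmetric])
  ultimately show ?thesis unfolding Yinv_def by (rule Lim_transform_eventually)
qed

lemma sigma2_lower: "p \<ge> 1 \<Longrightarrow> (real p / N p)\<^sup>2 / 12 \<le> sigma2_n p k (n p)"
  using sigma2_n_lower_bound[OF k2, where ns = "n p" and p = p] n_gt by simp

lemma sigma2_pos: "p \<ge> 1 \<Longrightarrow> sigma2_n p k (n p) > 0"
proof -
  assume p: "p \<ge> 1"
  have "N p > 0" using ntot_ge_double[OF k2, where ns = "n p" and p = p] n_gt[OF p] by auto
  hence "(real p / N p)\<^sup>2 / 12 > 0" using p by auto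
  thus ?thesis using sigma2_lower[OF p] by linarith
qed

text \<open>\<open>p / N p\<close> tends to the positive number \<open>1 / Yinv\<close>, hence
  eventually exceeds half of it, and \<open>sigma2_lower\<close> applies.\<close>

lemma sg_lower: obtains c where "c > 0" "\<forall>\<^sub>F p in sequentially. c \<le> sg p"
proof -
  define c where "c = sqrt ((1 / (2 * Yinv))\<^sup>2 / 12)"
  have "c > 0" using Yinv_pos by (simp add: c_def)
  moreover have "\<forall>\<^sub>F p in sequentially. 1 / (2 * Yinv) < real p / N p"
    using Yinv_pos by (intro order_tendstoD(1)[OF p_over_N]) (simp add: field_simps)
  hence "\<forall>\<^sub>F p in sequentially. c \<le> sg p"
    using eventually_ge_at_top[of 1]
  proof eventually_elim
    case (elim p)
    have "(1 / (2 * Yinv))\<^sup>2 \<le> (real p / N p)\<^sup>2" using elim Yinv_pos by (intro power_mono) auto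
    thus ?case using sigma2_lower[OF elim(2)] by (simp add: c_def)
  qed
  ultimately show ?thesis using that by blast
qed

text \<open>The summand of group \<open>i\<close> in \<open>sigma2_n\<close> has the weight
  \<open>n_i^2 / N^2\<close>, which tends to a positive limit, and a logarithm that diverges. The
  subtracted pooled term is at most \<open>ln 2 < 1\<close>, because
  \<open>N >= 2 p + 2\<close>.\<close>

lemma sg_at_top:
  assumes i: "i < k" and yi: "y i = 1"
  shows "filterlim sg at_top sequentially"
proof -
  have lim1: "(\<lambda>p. (real p / N p)\<^sup>2 / (real p / real (n p i))\<^sup>2) \<longlonglongrightarrow> (1 / Yinv)\<^sup>2 / (y i)\<^sup>2"
    using yi by (intro tendsto_intros p_over_N y_lim[OF i]) auto
  have "(\<lambda>p. 1 - real p / real (n p i)) \<longlonglongrightarrow> 1 - 1"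
    using y_lim[OF i] yi by (intro tendsto_intros) auto
  moreover have "\<forall>\<^sub>F p in sequentially. 1 - real p / real (n p i) \<in> {0<..}"
    using eventually_ge_at_top[of 1]
  proof eventually_elim
    case (elim p)
    show ?case using n_gt[OF elim i] by simp
  qed
  ultimately have "filterlim (\<lambda>p. 1 - real p / real (n p i)) (at_right 0) sequentially"
    by (auto simp: filterlim_at elim: eventually_mono)
  hence "filterlim (\<lambda>p. ln (1 - real p / real (n p i))) at_bot sequentially"
    by (rule filterlim_compose[OF ln_at_0])
  hence "filterlim (\<lambda>p. - ln (1 - real p / real (n p i))) at_top sequentially"
    by (simp add: filterlim_uminus_at_top)
  hence "filterlim (\<lambda>p. (real p / N p)\<^sup>2 / (real p / real (n p i))\<^sup>2 * (- ln (1 - real p / real (n p i)))) at_top sequentially"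
    using Yinv_pos yi by (intro filterlim_tendsto_pos_mult_at_top[OF lim1]) auto
  hence "filterlim (\<lambda>p. - 1 + (real p / N p)\<^sup>2 / (real p / real (n p i))\<^sup>2 * (- ln (1 - real p / real (n p i)))) at_top sequentially"
    by (rule filterlim_tendsto_add_at_top[OF tendsto_const])
  hence "filterlim (\<lambda>p. (1/2) * (- 1 + (real p / N p)\<^sup>2 / (real p / real (n p i))\<^sup>2 * (- ln (1 - real p / real (n p i))))) at_top sequentially"
    by (intro filterlim_tendsto_pos_mult_at_top[OF tendsto_const]) auto
  moreover have "\<forall>\<^sub>F p in sequentially. (1/2) * (- 1 + (real p / N p)\<^sup>2 / (real p / real (n p i))\<^sup>2 * (- ln (1 - real p / real (n p i)))) \<le> sigma2_n p k (n p)"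
    using eventually_ge_at_top[of 1]
  proof eventually_elim
    case (elim p)
    note n = n_gt[OF elim]
    have m: "real (n p i) > real p + 1" using n[OF i] by linarith
    have NN: "2 * real p + 2 \<le> N p" using n by (intro ntot_ge_double[OF k2])
    have "ln (1 - real p / N p) \<ge> ln (1 / 2)" using NN by (subst ln_le_cancel_iff) (auto simp: field_simps)
    hence "- ln (1 - real p / N p) \<le> 1" using ln_2_less_1 by (simp add: ln_div)
    moreover have "ln (1 - real p / N p) \<le> 0" using NN by simp
    ultimately have RN: "(r_fun p (N p))\<^sup>2 \<le> 1" by (simp add: r_fun_def)
    have "real p / real (n p i) \<le> real p / (real (n p i) - 1)" using m by (intro divide_left_mono) auto
    moreover have l: "real p / (real (n p i) - 1) < 1" using m by simp
    ultimately have "- ln (1 - real p / real (n p i)) \<le> - ln (1 - real p / (real (n p i) - 1))" by simp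
    also have "\<dots> = (r_fun p (real (n p i) - 1))\<^sup>2" using l m by (simp add: r_fun_def)
    finally have "(real (n p i))\<^sup>2 / (N p)\<^sup>2 * (- ln (1 - real p / real (n p i))) \<le> (real (n p i))\<^sup>2 / (N p)\<^sup>2 * (r_fun p (real (n p i) - 1))\<^sup>2"
      by (intro mult_left_mono) auto
    also have "\<dots> \<le> (\<Sum>i<k. (real (n p i))\<^sup>2 / (N p)\<^sup>2 * (r_fun p (real (n p i) - 1))\<^sup>2)"
      using i by (intro member_le_sum) auto
    finally have "(real (n p i))\<^sup>2 / (N p)\<^sup>2 * (- ln (1 - real p / real (n p i))) \<le> (\<Sum>i<k. (real (n p i))\<^sup>2 / (N p)\<^sup>2 * (r_fun p (real (n p i) - 1))\<^sup>2)" .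
    with RN have "- 1 + (real (n p i))\<^sup>2 / (N p)\<^sup>2 * (- ln (1 - real p / real (n p i)))
       \<le> (\<Sum>i<k. (real (n p i))\<^sup>2 / (N p)\<^sup>2 * (r_fun p (real (n p i) - 1))\<^sup>2) - (r_fun p (N p))\<^sup>2" by linarith
    moreover have "(real p / N p)\<^sup>2 / (real p / real (n p i))\<^sup>2 = (real (n p i))\<^sup>2 / (N p)\<^sup>2"
      using elim m by (simp add: power_divide)
    ultimately show ?case unfolding sigma2_n_def by (simp only: mult_left_mono)
  qed
  ultimately have "filterlim (\<lambda>p. sigma2_n p k (n p)) at_top sequentially"
    by (rule filterlim_at_top_mono)
  thus ?thesis by (rule filterlim_compose[OF sqrt_at_top])
qed

lemma inv_excess_sg: assumes i: "i < k" shows "(\<lambda>p. 1 / real (n p i - p) / sg p) \<longlonglongrightarrow> 0"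
proof -
  obtain c where c: "c > 0" "\<forall>\<^sub>F p in sequentially. c \<le> sg p" by (rule sg_lower)
  have nonneg: "\<forall>\<^sub>F p in sequentially. 0 \<le> 1 / real (n p i - p) / sg p"
    using c(2)
  proof eventually_elim
    case (elim p)
    have "0 < sg p" using elim c(1) by linarith
    thus ?case by (rule divide_nonneg_pos[OF divide_nonneg_nonneg[OF zero_le_one of_nat_0_le_iff]])
  qed
  show ?thesis
  proof (cases "y i = 1")
    case True
    have "(\<lambda>p. 1 / sg p) \<longlonglongrightarrow> 0"
      using sg_at_top[OF i True] by (intro tendsto_divide_0[OF tendsto_const] filterlim_at_top_imp_at_infinity)
    moreover have "\<forall>\<^sub>F p in sequentially. 1 / real (n p i - p) / sg p \<le> 1 / sg p"
      using c(2) eventually_ge_at_top[of 1]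
    proof eventually_elim
      case (elim p)
      have "1 / real (n p i - p) \<le> 1" using n_gt[OF elim(2) i] by simp
      moreover have "0 < sg p" using elim(1) c(1) by linarith
      ultimately show ?case by (intro divide_right_mono) auto
    qed
    ultimately show ?thesis by (intro tendsto_sandwich[OF nonneg _ tendsto_const])
  next
    case False
    hence yi: "0 < y i" "y i < 1" using y_rng[OF i] by auto
    have "(\<lambda>p. 1 / (real p / real (n p i)) - 1) \<longlonglongrightarrow> 1 / y i - 1"
      using yi by (intro tendsto_intros y_lim[OF i]) auto
    \<comment> \<open>For \<open>y i < 1\<close> the excess is
      \<open>n_i - p = (n_i / p - 1) p\<close>, whose first factor has a positive limit.\<close>
    hence "filterlim (\<lambda>p. (1 / (real p / real (n p i)) - 1) * real p) at_top sequentially"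
      by (rule filterlim_tendsto_pos_mult_at_top[OF _ _ filterlim_real_sequentially]) (use yi in auto)
    moreover have "\<forall>\<^sub>F p in sequentially. (1 / (real p / real (n p i)) - 1) * real p = real (n p i - p)"
      using eventually_ge_at_top[of 1]
    proof eventually_elim
      case (elim p)
      show ?case using n_gt[OF elim i] elim by (simp add: field_simps of_nat_diff)
    qed
    ultimately have "filterlim (\<lambda>p. real (n p i - p)) at_top sequentially"
      by (simp cong: filterlim_cong)
    hence "(\<lambda>p. 1 / real (n p i - p)) \<longlonglongrightarrow> 0"
      by (intro tendsto_divide_0[OF tendsto_const] filterlim_at_top_imp_at_infinity)
    hence "(\<lambda>p. 1 / real (n p i - p) / c) \<longlonglongrightarrow> 0 / c" using c(1) by (intro tendsto_divide) auto
    hence "(\<lambda>p. 1 / real (n p i - p) / c) \<longlonglongrightarrow> 0" by simp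
    moreover have "\<forall>\<^sub>F p in sequentially. 1 / real (n p i - p) / sg p \<le> 1 / real (n p i - p) / c"
      using c(2)
    proof eventually_elim
      case (elim p)
      have "0 < sg p" using elim c(1) by linarith
      thus ?case by (intro divide_left_mono[OF elim] mult_pos_pos c(1)) auto
    qed
    ultimately show ?thesis by (intro tendsto_sandwich[OF nonneg _ tendsto_const])
  qed
qed

theorem cf_limit:
  "(\<lambda>p. exp (\<i> * of_real (s / (N p * sg p) * (ln_norm_const p k (n p) - mu_n p k (n p) y)))
        * (\<Prod>l<p. column_cf k (n p) (Suc l) (s / (N p * sg p)))) \<longlonglongrightarrow> exp (of_real (- s\<^sup>2 / 2))"
proof -
  define E where "E p = (\<Sum>i<k. 1 / real (n p i - p))" for p
  \<comment> \<open>The three errors are \<open>F\<close> divided by 1, \<open>sg\<close> and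
    \<open>sg^2\<close>. Since \<open>sg\<close> is eventually at least \<open>c > 0\<close>, it is
    enough that \<open>F\<close> tends to 0.\<close>
  define F where "F p = E p / sg p" for p
  obtain c where c: "c > 0" "\<forall>\<^sub>F p in sequentially. c \<le> sg p" by (rule sg_lower)
  have "(\<lambda>p. \<Sum>i<k. 1 / real (n p i - p) / sg p) \<longlonglongrightarrow> (\<Sum>i<k. 0)"
    by (intro tendsto_sum inv_excess_sg) auto
  hence F: "F \<longlonglongrightarrow> 0" by (simp add: F_def[abs_def] E_def sum_divide_distrib)
  define \<Phi> where "\<Phi> p = exp (\<i> * of_real (s / (N p * sg p) * (ln_norm_const p k (n p) - mu_n p k (n p) y)))
        * (\<Prod>l<p. column_cf k (n p) (Suc l) (s / (N p * sg p)))" for p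
  have "\<forall>p. \<exists>\<Xi>. 1 \<le> p \<longrightarrow> \<Phi> p = exp \<Xi> \<and> norm (\<Xi> - of_real (- s\<^sup>2 / 2))
       \<le> 16 * \<bar>s\<bar> * (E p / sg p) + 3 * s\<^sup>2 * (E p / (sg p)\<^sup>2) + 4 * \<bar>s\<bar>^3 * (E p / (sg p)^3)"
  proof
    fix p
    show "\<exists>\<Xi>. 1 \<le> p \<longrightarrow> \<Phi> p = exp \<Xi> \<and> norm (\<Xi> - of_real (- s\<^sup>2 / 2))
       \<le> 16 * \<bar>s\<bar> * (E p / sg p) + 3 * s\<^sup>2 * (E p / (sg p)\<^sup>2) + 4 * \<bar>s\<bar>^3 * (E p / (sg p)^3)"
    proof (cases "1 \<le> p")
      case True
      have "0 < sg p" "(sg p)\<^sup>2 = sigma2_n p k (n p)" using sigma2_pos[OF True] by auto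
      from cf_exponent_bound[where ns = "n p" and y = y and s = s, OF k2 n_gt[OF True] True y_rng this]
      show ?thesis unfolding \<Phi>_def E_def by blast
    qed auto
  qed
  then obtain \<Xi> where \<Xi>: "\<And>p. 1 \<le> p \<Longrightarrow> \<Phi> p = exp (\<Xi> p)"
     "\<And>p. 1 \<le> p \<Longrightarrow> norm (\<Xi> p - of_real (- s\<^sup>2 / 2))
       \<le> 16 * \<bar>s\<bar> * (E p / sg p) + 3 * s\<^sup>2 * (E p / (sg p)\<^sup>2) + 4 * \<bar>s\<bar>^3 * (E p / (sg p)^3)"
    by metis
  have "(\<lambda>p. \<Xi> p - of_real (- s\<^sup>2 / 2)) \<longlonglongrightarrow> 0"
  proof (rule Lim_null_comparison)
    show "(\<lambda>p. 16 * \<bar>s\<bar> * F p + 3 * s\<^sup>2 * (F p / c) + 4 * \<bar>s\<bar>^3 * (F p / c\<^sup>2)) \<longlonglongrightarrow> 0"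
      using c(1) by (auto intro!: tendsto_eq_intros F)
    show "\<forall>\<^sub>F p in sequentially. norm (\<Xi> p - of_real (- s\<^sup>2 / 2)) \<le> 16 * \<bar>s\<bar> * F p + 3 * s\<^sup>2 * (F p / c) + 4 * \<bar>s\<bar>^3 * (F p / c\<^sup>2)"
      using c(2) eventually_ge_at_top[of 1]
    proof eventually_elim
      case (elim p)
      have E0: "E p \<ge> 0" unfolding E_def by (intro sum_nonneg) auto
      have sg0: "sg p > 0" using elim(1) c(1) by linarith
      hence F0: "F p \<ge> 0" unfolding F_def using E0 by (intro divide_nonneg_nonneg) linarith+
      have e: "E p / sg p = F p" "E p / (sg p)\<^sup>2 = F p / sg p" "E p / (sg p)^3 = F p / (sg p)\<^sup>2"
        by (simp_all only: F_def power2_eq_square power3_eq_cube divide_divide_eq_left)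
      have 1: "3 * s\<^sup>2 * (F p / sg p) \<le> 3 * s\<^sup>2 * (F p / c)"
        by (rule mult_left_mono[OF divide_left_mono[OF elim(1) F0 mult_pos_pos[OF sg0 c(1)]]]) simp
      have "c\<^sup>2 \<le> (sg p)\<^sup>2" by (rule power_mono[OF elim(1)]) (use c(1) in linarith)
      hence 2: "4 * \<bar>s\<bar>^3 * (F p / (sg p)\<^sup>2) \<le> 4 * \<bar>s\<bar>^3 * (F p / c\<^sup>2)"
        by (rule mult_left_mono[OF divide_left_mono[OF _ F0 mult_pos_pos[OF zero_less_power[OF sg0] zero_less_power[OF c(1)]]]]) simp
      have "16 * \<bar>s\<bar> * (E p / sg p) + 3 * s\<^sup>2 * (E p / (sg p)\<^sup>2) + 4 * \<bar>s\<bar>^3 * (E p / (sg p)^3)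
         \<le> 16 * \<bar>s\<bar> * F p + 3 * s\<^sup>2 * (F p / c) + 4 * \<bar>s\<bar>^3 * (F p / c\<^sup>2)"
        unfolding e by (rule add_mono[OF add_mono[OF order.refl 1] 2])
      thus ?case using \<Xi>(2)[OF elim(2)] by linarith
    qed
  qed
  hence "\<Xi> \<longlonglongrightarrow> of_real (- s\<^sup>2 / 2)" by (rule LIM_zero_cancel)
  hence "(\<lambda>p. exp (\<Xi> p)) \<longlonglongrightarrow> exp (of_real (- s\<^sup>2 / 2))" by (intro tendsto_exp)
  moreover have "\<forall>\<^sub>F p in sequentially. exp (\<Xi> p) = \<Phi> p"
    using eventually_ge_at_top[of 1] by eventually_elim (simp add: \<Xi>(1))
  ultimately show ?thesis unfolding \<Phi>_def by (rule Lim_transform_eventually)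
qed

end

section \<open>Independence from product characteristic functions\<close>

text \<open>Normalising \<open>w\<close> to a probability density turns the hypothesis into an
  equality of characteristic functions on the real line, so Levy uniqueness applies to the law of
  \<open>X\<close> under the reweighted measure. The lower bound on \<open>w\<close> keeps the
  normaliser positive.\<close>

lemma weighted_law_eqI:
  fixes X w :: "'a \<Rightarrow> real"
  assumes "prob_space M" and [measurable]: "X \<in> borel_measurable M" "w \<in> borel_measurable M"
    and w: "\<And>\<omega>. 1 \<le> w \<omega>" "\<And>\<omega>. w \<omega> \<le> c"
    and N: "real_distribution N"
    and cf: "\<And>s. (CLINT \<omega>|M. iexp (s * X \<omega>) * of_real (w \<omega>)) = char N s * of_real (LINT \<omega>|M. w \<omega>)"
    and B: "B \<in> sets borel"
  shows "(LINT \<omega>|M. indicat_real B (X \<omega>) * w \<omega>) = measure N B * (LINT \<omega>|M. w \<omega>)"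
proof -
  interpret M: prob_space M by fact
  interpret N: real_distribution N by fact
  have iw: "integrable M w"
    using w by (intro M.integrable_const_bound[where B = c]) (auto intro!: AE_I2 simp: abs_if less_le_trans order.trans[OF _ w(1)], smt (verit, best) w)
  have "(LINT \<omega>|M. 1) \<le> (LINT \<omega>|M. w \<omega>)" using w by (intro integral_mono iw) auto
  hence m: "(LINT \<omega>|M. w \<omega>) \<ge> 1" by (simp add: M.prob_space)
  define m where "m = (LINT \<omega>|M. w \<omega>)"
  have m0: "m > 0" using m by (simp add: m_def)
  have w0: "w \<omega> > 0" for \<omega> using w(1)[of \<omega>] by simp
  define M' where "M' = density M (\<lambda>\<omega>. ennreal (w \<omega> / m))"
  have "emeasure M' (space M') = (\<integral>\<^sup>+\<omega>. ennreal (w \<omega> / m) \<partial>M)"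
    by (auto simp: M'_def emeasure_density cong: nn_integral_cong)
  also have "\<dots> = ennreal (LINT \<omega>|M. w \<omega> / m)"
    using w0 m0 iw by (intro nn_integral_eq_integral) (auto intro!: AE_I2 less_imp_le)
  also have "(LINT \<omega>|M. w \<omega> / m) = 1" using m0 by (simp add: m_def)
  finally have "prob_space M'" by (intro prob_spaceI) simp
  then interpret M': prob_space M' .
  have X': "X \<in> borel_measurable M'" by (simp add: M'_def)
  have "char (distr M' borel X) s = char N s" for s
  proof -
    have "char (distr M' borel X) s = (CLINT \<omega>|M'. iexp (s * X \<omega>))"
      unfolding char_def using X' by (subst integral_distr) auto
    also have "\<dots> = (CLINT \<omega>|M. (w \<omega> / m) *\<^sub>R iexp (s * X \<omega>))"
      unfolding M'_def using w0 m0 by (subst integral_density) (auto intro!: AE_I2 less_imp_le)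
    also have "\<dots> = (CLINT \<omega>|M. iexp (s * X \<omega>) * of_real (w \<omega>)) / of_real m"
      by (subst integral_divide_zero[symmetric]) (simp add: scaleR_conv_of_real mult_ac)
    also have "\<dots> = char N s" using cf[of s] m0 by (simp add: m_def)
    finally show ?thesis .
  qed
  hence "distr M' borel X = N"
    using X' by (intro Levy_uniqueness M'.real_distribution_distr N) auto
  hence "measure N B = measure (distr M' borel X) B" by simp
  also have "\<dots> = (LINT x|distr M' borel X. indicat_real B x)" using B by simp
  also have "\<dots> = (LINT \<omega>|M'. indicat_real B (X \<omega>))" using X' B by (subst integral_distr) auto
  also have "\<dots> = (LINT \<omega>|M. (w \<omega> / m) * indicat_real B (X \<omega>))"
    unfolding M'_def using w0 m0 B by (subst integral_density) (auto intro!: AE_I2 less_imp_le)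
  also have "\<dots> = (LINT \<omega>|M. indicat_real B (X \<omega>) * w \<omega>) / m"
    by (subst integral_divide_zero[symmetric]) (simp add: mult_ac)
  finally show ?thesis using m0 by (simp add: m_def field_simps)
qed

lemma iexp_cos_sin:
  fixes z :: real
  shows "complex_of_real (cos z) = (iexp z + iexp (- z)) / 2"
    and "complex_of_real (sin z) = (iexp z - iexp (- z)) / (2 * \<i>)"
  by (simp_all add: cos_exp_eq sin_exp_eq flip: cos_of_real sin_of_real)

text \<open>The complex weight \<open>iexp Z\<close> is reached through the positive weights
  \<open>2 + cos Z\<close> and \<open>2 + sin Z\<close>, which lie in \<open>[1, 3]\<close>, by
  subtracting the constant weight 2. They are combinations of \<open>1\<close>,
  \<open>iexp Z\<close> and \<open>iexp (- Z)\<close>, whence the three values of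
  \<open>\<epsilon>\<close>.\<close>

lemma indicator_iexp_factor:
  fixes X Z :: "'a \<Rightarrow> real"
  assumes "prob_space M" and [measurable]: "X \<in> borel_measurable M" "Z \<in> borel_measurable M"
    and N: "real_distribution N"
    and cf: "\<And>s \<epsilon>. \<epsilon> \<in> {-1, 0, 1} \<Longrightarrow> (CLINT \<omega>|M. iexp (s * X \<omega> + \<epsilon> * Z \<omega>)) = char N s * (CLINT \<omega>|M. iexp (\<epsilon> * Z \<omega>))"
    and B: "B \<in> sets borel"
  shows "(CLINT \<omega>|M. of_real (indicat_real B (X \<omega>)) * iexp (Z \<omega>)) = of_real (measure N B) * (CLINT \<omega>|M. iexp (Z \<omega>))"
proof -
  interpret M: prob_space M by fact
  interpret N: real_distribution N by fact
  note [measurable] = B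
  have int: "integrable M (\<lambda>\<omega>. iexp (f \<omega>))" if "f \<in> borel_measurable M" for f
    using that M.integrable_iexp[of "\<lambda>\<omega>. of_real (f \<omega>)"] by simp
  have ib: "integrable M f" if "f \<in> borel_measurable M" "\<And>\<omega>. \<bar>f \<omega>\<bar> \<le> 3" for f :: "'a \<Rightarrow> real"
    using that by (intro M.integrable_const_bound[where B = 3]) auto
  have F: "(LINT \<omega>|M. indicat_real B (X \<omega>) * w \<omega>) = measure N B * (LINT \<omega>|M. w \<omega>)"
    if w: "\<And>\<omega>. complex_of_real (w \<omega>) = 2 + a * iexp (Z \<omega>) + b * iexp (- Z \<omega>)"
      "\<And>\<omega>. 1 \<le> w \<omega>" "\<And>\<omega>. w \<omega> \<le> 3" and [measurable]: "w \<in> borel_measurable M" for w a b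
  proof (rule weighted_law_eqI[where c = 3, OF _ _ _ _ _ N _ B])
    fix s
    have e: "iexp (s * X \<omega>) * of_real (w \<omega>) = 2 * iexp (s * X \<omega> + 0 * Z \<omega>) + a * iexp (s * X \<omega> + 1 * Z \<omega>) + b * iexp (s * X \<omega> + (- 1) * Z \<omega>)" for \<omega> s
      unfolding w by (simp add: exp_add[symmetric] algebra_simps flip: exp_diff)
    have "(CLINT \<omega>|M. iexp (s * X \<omega>) * of_real (w \<omega>))
       = 2 * (CLINT \<omega>|M. iexp (s * X \<omega> + 0 * Z \<omega>)) + a * (CLINT \<omega>|M. iexp (s * X \<omega> + 1 * Z \<omega>)) + b * (CLINT \<omega>|M. iexp (s * X \<omega> + (- 1) * Z \<omega>))" for s
      unfolding e by (subst Bochner_Integration.integral_add, (intro Bochner_Integration.integrable_add integrable_mult_right int; simp)+)+ simp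
    hence A: "(CLINT \<omega>|M. iexp (s * X \<omega>) * of_real (w \<omega>))
       = char N s * (2 * (CLINT \<omega>|M. iexp (0 * Z \<omega>)) + a * (CLINT \<omega>|M. iexp (1 * Z \<omega>)) + b * (CLINT \<omega>|M. iexp ((- 1) * Z \<omega>)))" for s
      by (simp only: cf insertI1 insertI2 insert_iff simp_thms) (simp add: algebra_simps)
    from A[of 0] have "(CLINT \<omega>|M. of_real (w \<omega>)) = 2 * (CLINT \<omega>|M. iexp (0 * Z \<omega>)) + a * (CLINT \<omega>|M. iexp (1 * Z \<omega>)) + b * (CLINT \<omega>|M. iexp ((- 1) * Z \<omega>))"
      by (simp add: N.char_zero)
    with A[of s] show "(CLINT \<omega>|M. iexp (s * X \<omega>) * of_real (w \<omega>)) = char N s * of_real (LINT \<omega>|M. w \<omega>)"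
      by simp
  qed (use w assms in auto)
  have F0: "(LINT \<omega>|M. indicat_real B (X \<omega>)) = measure N B"
    using F[of "\<lambda>_. 2" 0 0] by (simp add: M.prob_space)
  have cs: "\<bar>cos x\<bar> \<le> 1" "\<bar>sin x\<bar> \<le> 1" "\<bar>indicat_real B x\<bar> \<le> 1" for x :: real by (auto simp: indicator_def)
  have cs': "- 1 \<le> cos x" "- 1 \<le> sin x" "cos x \<le> 1" "sin x \<le> 1" for x :: real by auto
  have Fc: "(LINT \<omega>|M. indicat_real B (X \<omega>) * cos (Z \<omega>)) = measure N B * (LINT \<omega>|M. cos (Z \<omega>))"
  proof -
    have "(LINT \<omega>|M. indicat_real B (X \<omega>) * (2 + cos (Z \<omega>))) = measure N B * (LINT \<omega>|M. 2 + cos (Z \<omega>))"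
    proof (rule F[of _ "1/2" "1/2"])
      show "complex_of_real (2 + cos (Z \<omega>)) = 2 + 1 / 2 * iexp (Z \<omega>) + 1 / 2 * iexp (- Z \<omega>)" for \<omega>
        by (simp only: of_real_add iexp_cos_sin) (simp add: field_simps)
      show "1 \<le> 2 + cos (Z \<omega>)" "2 + cos (Z \<omega>) \<le> 3" for \<omega> using cs'[of "Z \<omega>"] by linarith+
    qed simp
    also have "(LINT \<omega>|M. 2 + cos (Z \<omega>)) = 2 + (LINT \<omega>|M. cos (Z \<omega>))"
      by (subst Bochner_Integration.integral_add) (auto intro!: ib simp: M.prob_space intro: order.trans[OF cs(1)])
    also have "(LINT \<omega>|M. indicat_real B (X \<omega>) * (2 + cos (Z \<omega>)))
        = (LINT \<omega>|M. indicat_real B (X \<omega>) * 2) + (LINT \<omega>|M. indicat_real B (X \<omega>) * cos (Z \<omega>))"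
      unfolding distrib_left
      by (intro Bochner_Integration.integral_add ib)
         (auto simp: indicator_def intro: order.trans[OF cs(1)])
    finally show ?thesis using F0 by (simp add: algebra_simps)
  qed
  have Fs: "(LINT \<omega>|M. indicat_real B (X \<omega>) * sin (Z \<omega>)) = measure N B * (LINT \<omega>|M. sin (Z \<omega>))"
  proof -
    have "(LINT \<omega>|M. indicat_real B (X \<omega>) * (2 + sin (Z \<omega>))) = measure N B * (LINT \<omega>|M. 2 + sin (Z \<omega>))"
    proof (rule F[of _ "1/(2*\<i>)" "-1/(2*\<i>)"])
      show "complex_of_real (2 + sin (Z \<omega>)) = 2 + 1 / (2 * \<i>) * iexp (Z \<omega>) + - 1 / (2 * \<i>) * iexp (- Z \<omega>)" for \<omega>
        by (simp only: of_real_add iexp_cos_sin) (simp add: field_simps)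
      show "1 \<le> 2 + sin (Z \<omega>)" "2 + sin (Z \<omega>) \<le> 3" for \<omega> using cs'[of "Z \<omega>"] by linarith+
    qed simp
    also have "(LINT \<omega>|M. 2 + sin (Z \<omega>)) = 2 + (LINT \<omega>|M. sin (Z \<omega>))"
      by (subst Bochner_Integration.integral_add) (auto intro!: ib simp: M.prob_space intro: order.trans[OF cs(2)])
    also have "(LINT \<omega>|M. indicat_real B (X \<omega>) * (2 + sin (Z \<omega>)))
        = (LINT \<omega>|M. indicat_real B (X \<omega>) * 2) + (LINT \<omega>|M. indicat_real B (X \<omega>) * sin (Z \<omega>))"
      unfolding distrib_left
      by (intro Bochner_Integration.integral_add ib)
         (auto simp: indicator_def intro: order.trans[OF cs(2)])
    finally show ?thesis using F0 by (simp add: algebra_simps)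
  qed
  have e: "iexp z = of_real (cos z) + \<i> * of_real (sin z)" for z :: real
    by (simp add: exp_Euler cos_of_real sin_of_real)
  have i1: "integrable M (\<lambda>\<omega>. cos (Z \<omega>))" "integrable M (\<lambda>\<omega>. sin (Z \<omega>))"
     "integrable M (\<lambda>\<omega>. indicat_real B (X \<omega>) * cos (Z \<omega>))" "integrable M (\<lambda>\<omega>. indicat_real B (X \<omega>) * sin (Z \<omega>))"
    using order.trans[OF cs(1), of 3] order.trans[OF cs(2), of 3] by (auto intro!: ib simp: indicator_def)
  have r: "(CLINT \<omega>|M. of_real (f \<omega>) + \<i> * of_real (g \<omega>)) = of_real (LINT \<omega>|M. f \<omega>) + \<i> * of_real (LINT \<omega>|M. g \<omega>)"
    if "integrable M f" "integrable M g" for f g :: "'a \<Rightarrow> real"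
    using that by (subst Bochner_Integration.integral_add) auto
  have "(CLINT \<omega>|M. of_real (indicat_real B (X \<omega>)) * iexp (Z \<omega>)) =
     (CLINT \<omega>|M. of_real (indicat_real B (X \<omega>) * cos (Z \<omega>)) + \<i> * of_real (indicat_real B (X \<omega>) * sin (Z \<omega>)))"
    unfolding e by (simp add: algebra_simps)
  also have "\<dots> = of_real (measure N B) * (CLINT \<omega>|M. iexp (Z \<omega>))"
    unfolding e r[OF i1(3,4)] r[OF i1(1,2)] Fc Fs by (simp add: algebra_simps)
  finally show ?thesis .
qed

text \<open>Induction over \<open>J\<close> for all probability measures at once: conditioning on
  \<open>X i\<close> being in \<open>A i\<close> changes \<open>M\<close>, but by
  \<open>indicator_iexp_factor\<close> the characteristic functions of the remaining combinations
  stay the same. In this way only uniqueness in dimension one is used.\<close>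

lemma prod_cf_imp_prod_law:
  fixes X :: "'j \<Rightarrow> 'a \<Rightarrow> real"
  assumes "finite J" and "prob_space M" and "\<And>j. j \<in> J \<Longrightarrow> X j \<in> borel_measurable M"
    and N: "\<And>j. real_distribution (N j)"
    and "\<And>c. (CLINT \<omega>|M. iexp (\<Sum>j\<in>J. c j * X j \<omega>)) = (\<Prod>j\<in>J. char (N j) (c j))"
    and "\<And>j. j \<in> J \<Longrightarrow> A j \<in> sets borel"
  shows "measure M {\<omega>\<in>space M. \<forall>j\<in>J. X j \<omega> \<in> A j} = (\<Prod>j\<in>J. measure (N j) (A j))"
  using assms(1-3,5-6)
proof (induction J arbitrary: M rule: finite_induct)
  case empty
  then show ?case by (simp add: prob_space.prob_space)
next
  case (insert i J)
  interpret M: prob_space M by fact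
  interpret Ni: real_distribution "N i" by fact
  have X[measurable]: "X j \<in> borel_measurable M" if "j \<in> insert i J" for j using insert.prems that by blast
  have A: "A j \<in> sets borel" if "j \<in> insert i J" for j using insert.prems that by blast
  have N1: "char (N j) 0 = 1" for j using real_distribution.char_zero[OF N] .
  have cfi: "(CLINT \<omega>|M. iexp (s * X i \<omega> + (\<Sum>j\<in>J. c j * X j \<omega>))) = char (N i) s * (\<Prod>j\<in>J. char (N j) (c j))" for s c
  proof -
    have "(\<Sum>j\<in>J. (c(i := s)) j * X j \<omega>) = (\<Sum>j\<in>J. c j * X j \<omega>)" for \<omega>
      using insert.hyps by (intro sum.cong) auto
    moreover have "(\<Prod>j\<in>J. char (N j) ((c(i := s)) j)) = (\<Prod>j\<in>J. char (N j) (c j))"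
      using insert.hyps by (intro prod.cong) auto
    ultimately show ?thesis using insert.prems(3)[of "c(i := s)"] insert.hyps by simp
  qed
  have cfJ: "(CLINT \<omega>|M. iexp (\<Sum>j\<in>J. c j * X j \<omega>)) = (\<Prod>j\<in>J. char (N j) (c j))" for c
    using cfi[of 0 c] by (simp add: N1)
  have sumJ: "(\<lambda>\<omega>. \<Sum>j\<in>J. c j * X j \<omega>) \<in> borel_measurable M" for c
    by (intro borel_measurable_sum borel_measurable_times X borel_measurable_const) auto
  have fac: "(CLINT \<omega>|M. of_real (indicat_real (A i) (X i \<omega>)) * iexp (\<Sum>j\<in>J. c j * X j \<omega>))
     = of_real (measure (N i) (A i)) * (\<Prod>j\<in>J. char (N j) (c j))" for c
    unfolding cfJ[symmetric]
  proof (rule indicator_iexp_factor[OF _ _ _ N])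
    fix s \<epsilon> :: real
    have e: "\<epsilon> * (\<Sum>j\<in>J. c j * X j \<omega>) = (\<Sum>j\<in>J. (\<epsilon> * c j) * X j \<omega>)" for \<omega>
      by (simp add: sum_distrib_left mult.assoc)
    show "(CLINT \<omega>|M. iexp (s * X i \<omega> + \<epsilon> * (\<Sum>j\<in>J. c j * X j \<omega>))) = char (N i) s * (CLINT \<omega>|M. iexp (\<epsilon> * (\<Sum>j\<in>J. c j * X j \<omega>)))"
      unfolding e cfi cfJ ..
  qed (use insert.prems(1) X sumJ A in auto)
  define B where "B = {\<omega>\<in>space M. X i \<omega> \<in> A i}"
  have Bm[measurable]: "B \<in> sets M" unfolding B_def using X[of i] A[of i] by measurable
  have PB: "measure M B = measure (N i) (A i)"
  proof -
    have "(CLINT \<omega>|M. of_real (indicat_real (A i) (X i \<omega>))) = of_real (measure (N i) (A i))"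
      using fac[of "\<lambda>_. 0"] by (simp add: N1)
    moreover have "(CLINT \<omega>|M. of_real (indicat_real (A i) (X i \<omega>))) = complex_of_real (LINT \<omega>|M. indicat_real B \<omega>)"
      unfolding integral_complex_of_real
      by (intro arg_cong[where f = complex_of_real] Bochner_Integration.integral_cong) (auto simp: B_def indicator_def)
    ultimately have "complex_of_real (measure (N i) (A i)) = complex_of_real (measure M B)" using Bm by simp
    thus ?thesis by (simp only: of_real_eq_iff)
  qed
  let ?C = "{\<omega>\<in>space M. \<forall>j\<in>insert i J. X j \<omega> \<in> A j}"
  show ?case
  \<comment> \<open>Conditioning requires an event of positive probability; otherwise both sides of
    the claim vanish.\<close>
  proof (cases "measure M B = 0")
    case True
    have "?C \<subseteq> B" by (auto simp: B_def)
    hence "measure M ?C \<le> measure M B" using Bm by (rule M.finite_measure_mono)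
    hence "measure M ?C = 0" using True measure_nonneg[of M ?C] by linarith
    thus ?thesis using True PB insert.hyps by simp
  next
    case False
    define b where "b = measure M B"
    have b: "b > 0" using False measure_nonneg[of M B] unfolding b_def by linarith
    define M' where "M' = density M (\<lambda>\<omega>. ennreal (indicator B \<omega> / b))"
    have sM': "space M' = space M" by (simp add: M'_def)
    have em: "emeasure M' S = ennreal (measure M (B \<inter> S) / b)" if "S \<in> sets M" for S
    proof -
      have "emeasure M' S = (\<integral>\<^sup>+\<omega>. ennreal (1 / b) * indicator (B \<inter> S) \<omega> \<partial>M)"
        unfolding M'_def using that by (subst emeasure_density) (auto intro!: nn_integral_cong simp: indicator_def)
      also have "\<dots> = ennreal (1 / b) * emeasure M (B \<inter> S)" using that by (intro nn_integral_cmult_indicator) auto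
      finally show ?thesis using b by (simp add: M.emeasure_eq_measure ennreal_mult[symmetric])
    qed
    have ps: "prob_space M'"
    proof (rule prob_spaceI)
      have "B \<inter> space M = B" using sets.sets_into_space[OF Bm] by auto
      thus "emeasure M' (space M') = 1" using em[OF sets.top] b by (simp add: sM' b_def)
    qed
    interpret M': prob_space M' by fact
    have XM': "X j \<in> borel_measurable M'" if "j \<in> J" for j using X that by (auto simp: M'_def)
    have cf': "(CLINT \<omega>|M'. iexp (\<Sum>j\<in>J. c j * X j \<omega>)) = (\<Prod>j\<in>J. char (N j) (c j))" for c
    proof -
      have "(CLINT \<omega>|M'. iexp (\<Sum>j\<in>J. c j * X j \<omega>)) = (CLINT \<omega>|M. (indicator B \<omega> / b) *\<^sub>R iexp (\<Sum>j\<in>J. c j * X j \<omega>))"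
        unfolding M'_def using b sumJ by (subst integral_density) auto
      also have "\<dots> = (CLINT \<omega>|M. (of_real (indicat_real (A i) (X i \<omega>)) * iexp (\<Sum>j\<in>J. c j * X j \<omega>)) / of_real b)"
        by (intro Bochner_Integration.integral_cong) (auto simp: B_def indicator_def scaleR_conv_of_real)
      also have "\<dots> = of_real (measure (N i) (A i)) * (\<Prod>j\<in>J. char (N j) (c j)) / of_real b"
        by (simp only: integral_divide_zero fac)
      finally show ?thesis using b PB by (simp add: b_def)
    qed
    have "measure M' {\<omega>\<in>space M'. \<forall>j\<in>J. X j \<omega> \<in> A j} = (\<Prod>j\<in>J. measure (N j) (A j))"
      by (rule insert.IH[OF ps XM' cf' A]) auto
    moreover have S: "{\<omega>\<in>space M'. \<forall>j\<in>J. X j \<omega> \<in> A j} \<in> sets M"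
      unfolding sM'
    proof (intro sets.sets_Collect_finite_All insert.hyps(1))
      fix j assume "j \<in> J"
      moreover have "{\<omega>\<in>space M. X j \<omega> \<in> A j} = X j -` A j \<inter> space M" by auto
      ultimately show "{\<omega>\<in>space M. X j \<omega> \<in> A j} \<in> sets M" using measurable_sets[OF X A, of j j] by simp
    qed
    moreover have "B \<inter> {\<omega>\<in>space M'. \<forall>j\<in>J. X j \<omega> \<in> A j} = ?C" by (auto simp: B_def sM')
    ultimately have "measure M ?C / b = (\<Prod>j\<in>J. measure (N j) (A j))"
      using em[OF S] b by (simp add: measure_def)
    thus ?thesis using b PB insert.hyps by (simp add: b_def field_simps)
  qed
qed

text \<open>The family \<open>X j\<close>, \<open>j \<in> J\<close>, consists of independent standard normal variables; by the Cramer-Wold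
  device this is a condition on the characteristic functions of linear combinations only, which makes
  it stable under orthonormal transformations.\<close>
definition std_gauss_family :: "'a measure \<Rightarrow> 'j set \<Rightarrow> ('j \<Rightarrow> 'a \<Rightarrow> real) \<Rightarrow> bool" where
  "std_gauss_family M J X \<longleftrightarrow> prob_space M \<and> (\<forall>j\<in>J. X j \<in> borel_measurable M) \<and>
     (\<forall>c. (CLINT \<omega>|M. iexp (\<Sum>j\<in>J. c j * X j \<omega>)) = of_real (exp (- (\<Sum>j\<in>J. (c j)\<^sup>2) / 2)))"

abbreviation std_gauss_PiM :: "'j set \<Rightarrow> ('j \<Rightarrow> real) measure" where
  "std_gauss_PiM J \<equiv> PiM J (\<lambda>_. std_normal_distribution)"

lemma prod_char_std_normal:
  "finite J \<Longrightarrow> (\<Prod>j\<in>J. char std_normal_distribution (c j)) = of_real (exp (- (\<Sum>j\<in>J. (c j)\<^sup>2) / 2))"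
  by (simp add: char_std_normal_distribution exp_sum sum_negf[symmetric] sum_divide_distrib)

text \<open>Boxes determine the product measure, and on boxes the claim is
  \<open>prod_cf_imp_prod_law\<close>.\<close>

lemma std_gauss_family_law:
  assumes J: "finite J" and G: "std_gauss_family M J X"
  shows "distr M (PiM J (\<lambda>_. borel)) (\<lambda>\<omega>. \<lambda>j\<in>J. X j \<omega>) = std_gauss_PiM J"
proof -
  interpret M: prob_space M using G by (simp add: std_gauss_family_def)
  interpret std: real_distribution std_normal_distribution by (rule real_dist_normal_dist)
  interpret P: finite_product_sigma_finite "\<lambda>_. std_normal_distribution" J
    by standard (simp_all add: J)
  have X: "j \<in> J \<Longrightarrow> X j \<in> borel_measurable M" for j using G by (simp add: std_gauss_family_def)
  have meas: "(\<lambda>\<omega>. \<lambda>j\<in>J. X j \<omega>) \<in> measurable M (PiM J (\<lambda>_. borel))"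
    using X by (intro measurable_restrict) auto
  show ?thesis
  proof (rule P.PiM_eqI)
    show "sets (distr M (PiM J (\<lambda>_. borel)) (\<lambda>\<omega>. \<lambda>j\<in>J. X j \<omega>)) = sets (std_gauss_PiM J)"
      by (simp cong: sets_PiM_cong)
  next
    fix A :: "'a \<Rightarrow> real set" assume "\<And>j. j \<in> J \<Longrightarrow> A j \<in> sets std_normal_distribution"
    hence A: "j \<in> J \<Longrightarrow> A j \<in> sets borel" for j by simp
    have "emeasure (distr M (PiM J (\<lambda>_. borel)) (\<lambda>\<omega>. \<lambda>j\<in>J. X j \<omega>)) (Pi\<^sub>E J A)
       = emeasure M ((\<lambda>\<omega>. \<lambda>j\<in>J. X j \<omega>) -` Pi\<^sub>E J A \<inter> space M)"
      using meas A J by (intro emeasure_distr sets_PiM_I_finite) auto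
    also have "(\<lambda>\<omega>. \<lambda>j\<in>J. X j \<omega>) -` Pi\<^sub>E J A \<inter> space M = {\<omega>\<in>space M. \<forall>j\<in>J. X j \<omega> \<in> A j}"
      by (auto simp: PiE_iff)
    also have "emeasure M \<dots> = ennreal (\<Prod>j\<in>J. measure std_normal_distribution (A j))"
      unfolding M.emeasure_eq_measure
      using prod_cf_imp_prod_law[OF J, of M X "\<lambda>_. std_normal_distribution" A] G X A M.prob_space_axioms real_dist_normal_dist
      by (simp add: std_gauss_family_def prod_char_std_normal[OF J])
    also have "\<dots> = (\<Prod>j\<in>J. emeasure std_normal_distribution (A j))"
      by (simp add: std.emeasure_eq_measure prod_ennreal)
    finally show "emeasure (distr M (PiM J (\<lambda>_. borel)) (\<lambda>\<omega>. \<lambda>j\<in>J. X j \<omega>)) (Pi\<^sub>E J A) = (\<Prod>j\<in>J. emeasure std_normal_distribution (A j))" .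
  qed (rule J)
qed

lemma std_gauss_family_PiM:
  assumes J: "finite J"
  shows "std_gauss_family (std_gauss_PiM J) J (\<lambda>j x. x j)"
proof -
  interpret std: real_distribution std_normal_distribution by (rule real_dist_normal_dist)
  interpret P: finite_product_prob_space "\<lambda>_. std_normal_distribution" J
    by standard (simp_all add: J)
  have "(CLINT x|std_gauss_PiM J. iexp (\<Sum>j\<in>J. c j * x j)) = of_real (exp (- (\<Sum>j\<in>J. (c j)\<^sup>2) / 2))" for c
  proof -
    have "(CLINT x|std_gauss_PiM J. iexp (\<Sum>j\<in>J. c j * x j)) = (CLINT x|std_gauss_PiM J. (\<Prod>j\<in>J. iexp (c j * x j)))"
      by (simp add: exp_sum[OF J, symmetric] sum_distrib_left)
    also have "\<dots> = (\<Prod>j\<in>J. CLINT x|std_normal_distribution. iexp (c j * x))"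
      by (intro P.product_integral_prod J std.integrable_iexp) auto
    finally show ?thesis using prod_char_std_normal[OF J] by (simp add: char_def)
  qed
  thus ?thesis
    unfolding std_gauss_family_def using P.P.prob_space_axioms by (auto intro: P.prob_space_axioms)
qed

text \<open>A combination of the new variables with coefficients \<open>c\<close> is one of the old
  variables whose coefficients have the same sum of squares, by orthonormality. No change of
  variables in an integral is involved.\<close>

lemma std_gauss_family_orthonormal:
  assumes J: "finite J" and R: "finite R" and G: "std_gauss_family M J X"
    and on: "\<And>r s. r \<in> R \<Longrightarrow> s \<in> R \<Longrightarrow> (\<Sum>j\<in>J. u r j * u s j) = (if r = s then 1 else 0)"
  shows "std_gauss_family M R (\<lambda>r \<omega>. \<Sum>j\<in>J. u r j * X j \<omega>)"
  unfolding std_gauss_family_def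
proof (intro conjI ballI allI)
  show "prob_space M" using G by (simp add: std_gauss_family_def)
  show "(\<lambda>\<omega>. \<Sum>j\<in>J. u r j * X j \<omega>) \<in> borel_measurable M" for r
    using G by (auto simp: std_gauss_family_def intro!: borel_measurable_sum borel_measurable_times)
  fix c
  have e: "(\<Sum>r\<in>R. c r * (\<Sum>j\<in>J. u r j * X j \<omega>)) = (\<Sum>j\<in>J. (\<Sum>r\<in>R. c r * u r j) * X j \<omega>)" for \<omega>
    unfolding sum_distrib_left sum_distrib_right by (subst sum.swap) (simp add: mult.assoc)
  have "(\<Sum>j\<in>J. (\<Sum>r\<in>R. c r * u r j)\<^sup>2) = (\<Sum>j\<in>J. \<Sum>r\<in>R. \<Sum>s\<in>R. c r * c s * (u r j * u s j))"
    by (simp add: power2_eq_square sum_product mult_ac)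
  also have "\<dots> = (\<Sum>r\<in>R. \<Sum>s\<in>R. c r * c s * (\<Sum>j\<in>J. u r j * u s j))"
    unfolding sum_distrib_left by (subst sum.swap, rule sum.cong[OF refl], rule sum.swap)
  also have "\<dots> = (\<Sum>r\<in>R. \<Sum>s\<in>R. if r = s then c r * c s else 0)"
    using on by (intro sum.cong) auto
  also have "\<dots> = (\<Sum>r\<in>R. (c r)\<^sup>2)" using R by (simp add: power2_eq_square)
  finally have sq: "(\<Sum>j\<in>J. (\<Sum>r\<in>R. c r * u r j)\<^sup>2) = (\<Sum>r\<in>R. (c r)\<^sup>2)" .
  have "\<forall>c. (CLINT \<omega>|M. iexp (\<Sum>j\<in>J. c j * X j \<omega>)) = of_real (exp (- (\<Sum>j\<in>J. (c j)\<^sup>2) / 2))"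
    using G unfolding std_gauss_family_def by blast
  from this[rule_format, of "\<lambda>j. \<Sum>r\<in>R. c r * u r j"]
  show "(CLINT \<omega>|M. iexp (\<Sum>r\<in>R. c r * (\<Sum>j\<in>J. u r j * X j \<omega>))) = of_real (exp (- (\<Sum>r\<in>R. (c r)\<^sup>2) / 2))"
    unfolding e sq .
qed

section \<open>Radial decomposition of the Gaussian measure\<close>

abbreviation lborel_PiM :: "'j set \<Rightarrow> ('j \<Rightarrow> real) measure" where
  "lborel_PiM J \<equiv> PiM J (\<lambda>_. lborel)"

definition radius :: "'j set \<Rightarrow> ('j \<Rightarrow> real) \<Rightarrow> real" where
  "radius J x = sqrt (\<Sum>j\<in>J. (x j)\<^sup>2)"

text \<open>Restricted to \<open>J\<close>, so that the scaled point stays in the extensional space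
  of the product measure.\<close>

definition scale_on :: "'j set \<Rightarrow> real \<Rightarrow> ('j \<Rightarrow> real) \<Rightarrow> 'j \<Rightarrow> real" where
  "scale_on J c x = (\<lambda>j\<in>J. c * x j)"

interpretation lborel_prod: product_sigma_finite "\<lambda>_. lborel :: real measure"
  by standard

lemma radius_nonneg: "0 \<le> radius J x"
  by (simp add: radius_def sum_nonneg)

lemma radius_scale_on: "c > 0 \<Longrightarrow> radius J (scale_on J c x) = c * radius J x"
  by (simp add: radius_def scale_on_def power_mult_distrib sum_distrib_left[symmetric] real_sqrt_mult)

lemma measurable_radius [measurable]:
  "finite J \<Longrightarrow> radius J \<in> borel_measurable (PiM J (\<lambda>_. lborel))"
  "finite J \<Longrightarrow> radius J \<in> borel_measurable (PiM J (\<lambda>_. borel))"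
  "finite J \<Longrightarrow> radius J \<in> borel_measurable (PiM J (\<lambda>_. std_normal_distribution))"
  unfolding radius_def[abs_def]
  by (auto intro!: borel_measurable_sqrt borel_measurable_sum borel_measurable_power
        measurable_compose[OF measurable_component_singleton] simp: measurable_def)

lemma measurable_scale_on [measurable]: "scale_on J c \<in> measurable (lborel_PiM J) (lborel_PiM J)"
  unfolding scale_on_def[abs_def] by (intro measurable_restrict) measurable

lemma nn_integral_scale_on:
  assumes "finite J" and c: "c > 0" and "f \<in> borel_measurable (lborel_PiM J)"
  shows "(\<integral>\<^sup>+x. f x \<partial>lborel_PiM J) = ennreal (c ^ card J) * (\<integral>\<^sup>+x. f (scale_on J c x) \<partial>lborel_PiM J)"
  using assms(1,3)
proof (induction J arbitrary: f rule: finite_induct)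
  case empty
  show ?case by (simp add: PiM_empty nn_integral_count_space_finite scale_on_def restrict_def)
next
  case (insert i J)
  note f[measurable] = insert.prems
  have upd[measurable]: "(\<lambda>(x, y). f (x(i := y))) \<in> borel_measurable (lborel_PiM J \<Otimes>\<^sub>M lborel)"
    using measurable_compose[OF measurable_add_dim f] by (simp add: case_prod_beta')
  have sc: "scale_on (insert i J) c (x(i := y)) = (scale_on J c x)(i := c * y)" for x y
    using insert.hyps by (auto simp: scale_on_def restrict_def fun_eq_iff)
  have meas2: "(\<lambda>x. f (scale_on (insert i J) c x)) \<in> borel_measurable (lborel_PiM (insert i J))"
    by measurable
  have "(\<integral>\<^sup>+x. f x \<partial>lborel_PiM (insert i J)) = (\<integral>\<^sup>+x. \<integral>\<^sup>+y. f (x(i := y)) \<partial>lborel \<partial>lborel_PiM J)"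
    using insert by (intro lborel_prod.product_nn_integral_insert) auto
  also have "\<dots> = ennreal (c ^ card J) * (\<integral>\<^sup>+x. \<integral>\<^sup>+y. f ((scale_on J c x)(i := y)) \<partial>lborel \<partial>lborel_PiM J)"
    by (rule insert.IH) (rule lborel.borel_measurable_nn_integral[OF upd])
  also have "(\<integral>\<^sup>+x. \<integral>\<^sup>+y. f ((scale_on J c x)(i := y)) \<partial>lborel \<partial>lborel_PiM J)
      = (\<integral>\<^sup>+x. ennreal c * (\<integral>\<^sup>+y. f ((scale_on J c x)(i := c * y)) \<partial>lborel) \<partial>lborel_PiM J)"
  proof (rule nn_integral_cong)
    fix x assume x: "x \<in> space (lborel_PiM J)"
    have "scale_on J c x \<in> space (lborel_PiM J)" by (auto simp: scale_on_def space_PiM)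
    hence "(\<lambda>y. f ((scale_on J c x)(i := y))) \<in> borel_measurable lborel"
      using measurable_Pair2[OF upd] by simp
    thus "(\<integral>\<^sup>+y. f ((scale_on J c x)(i := y)) \<partial>lborel) = ennreal c * (\<integral>\<^sup>+y. f ((scale_on J c x)(i := c * y)) \<partial>lborel)"
      using nn_integral_real_affine[of "\<lambda>y. f ((scale_on J c x)(i := y))" c 0] c by simp
  qed
  also have "\<dots> = ennreal c * (\<integral>\<^sup>+x. \<integral>\<^sup>+y. f ((scale_on J c x)(i := c * y)) \<partial>lborel \<partial>lborel_PiM J)"
  proof (rule nn_integral_cmult)
    have "(\<lambda>(x, y). f (scale_on (insert i J) c (x(i := y)))) \<in> borel_measurable (lborel_PiM J \<Otimes>\<^sub>M lborel)"
      using measurable_compose[OF measurable_add_dim meas2] by (simp add: case_prod_beta')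
    thus "(\<lambda>x. \<integral>\<^sup>+y. f ((scale_on J c x)(i := c * y)) \<partial>lborel) \<in> borel_measurable (lborel_PiM J)"
      unfolding sc by (rule lborel.borel_measurable_nn_integral)
  qed
  also have "(\<integral>\<^sup>+x. \<integral>\<^sup>+y. f ((scale_on J c x)(i := c * y)) \<partial>lborel \<partial>lborel_PiM J)
      = (\<integral>\<^sup>+x. f (scale_on (insert i J) c x) \<partial>lborel_PiM (insert i J))"
    using insert.hyps meas2 by (subst lborel_prod.product_nn_integral_insert) (auto simp: sc)
  finally show ?case using insert.hyps c by (simp add: ennreal_mult' mult_ac)
qed

text \<open>A cone measure \<open>H dx\<close> gives the ball of radius \<open>r\<close> the mass \<open>C r ^ N\<close>, so its radial law is
  known up to \<open>C\<close>.\<close>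
lemma cone_radial_law:
  fixes H :: "('j \<Rightarrow> real) \<Rightarrow> ennreal"
  assumes J: "finite J" "J \<noteq> {}" and H[measurable]: "H \<in> borel_measurable (lborel_PiM J)"
    and H1: "\<And>x. H x \<le> 1"
    and cone: "\<And>c x. c > 0 \<Longrightarrow> H (scale_on J c x) = H x"
  shows "\<exists>C\<ge>0. \<forall>\<phi>\<in>borel_measurable borel. (\<integral>\<^sup>+x. H x * \<phi> (radius J x) \<partial>lborel_PiM J)
      = ennreal C * (\<integral>\<^sup>+r. \<phi> r * ennreal (indicator {0..} r * r ^ (card J - 1)) \<partial>lborel)"
proof -
  let ?L = "lborel_PiM J"
  define N where "N = card J"
  have N: "N \<ge> 1" using J by (simp add: N_def card_gt_0_iff Suc_le_eq)
  define q where "q r = (\<integral>\<^sup>+x. H x * indicator {..r} (radius J x) \<partial>?L)" for r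
  note [measurable] = measurable_radius(1)[OF J(1)]
  have ind_scale: "indicator {..c * r} (radius J (scale_on J c x)) = (indicator {..r} (radius J x) :: ennreal)" if "c > 0" for c r x
    using that by (simp add: radius_scale_on indicator_def)
  have qs: "q (c * r) = ennreal (c ^ N) * q r" if "c > 0" for c r
    unfolding q_def N_def using that J
    by (subst nn_integral_scale_on[OF J(1) that]) (auto simp: cone ind_scale)
  \<comment> \<open>The unit ball lies in the cube \<open>[-1, 1]^J\<close>, whose Lebesgue measure
    is finite; so its mass is a real constant.\<close>
  have q1: "q 1 < \<infinity>"
  proof -
    have "q 1 \<le> (\<integral>\<^sup>+x. indicator (Pi\<^sub>E J (\<lambda>_. {-1..1})) x \<partial>?L)"
      unfolding q_def
    proof (rule nn_integral_mono)
      fix x assume "x \<in> space ?L"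
      hence ext: "x \<in> extensional J" by (simp add: space_PiM PiE_def)
      show "H x * indicator {..1} (radius J x) \<le> indicator (Pi\<^sub>E J (\<lambda>_. {-1..1})) x"
      proof (cases "radius J x \<le> 1")
        case True
        have "x j \<in> {-1..1}" if "j \<in> J" for j
        proof -
          have "(x j)\<^sup>2 \<le> (\<Sum>j\<in>J. (x j)\<^sup>2)" using that J by (intro member_le_sum) auto
          also have "\<dots> = (radius J x)\<^sup>2" by (simp add: radius_def sum_nonneg)
          also have "\<dots> \<le> 1\<^sup>2" using True radius_nonneg by (intro power_mono)
          finally have "\<bar>x j\<bar> \<le> 1" by (simp add: abs_square_le_1)
          thus ?thesis by auto
        qed
        hence "x \<in> Pi\<^sub>E J (\<lambda>_. {-1..1})" using ext by (auto simp: PiE_iff)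
        thus ?thesis using H1[of x] True by simp
      qed simp
    qed
    also have "\<dots> = emeasure ?L (Pi\<^sub>E J (\<lambda>_. {-1..1}))"
      using J by (intro nn_integral_indicator sets_PiM_I_finite) auto
    also have "\<dots> = (\<Prod>j\<in>J. emeasure lborel {-1..1::real})"
      using J by (intro lborel_prod.emeasure_PiM) auto
    also have "\<dots> < \<infinity>" by (simp add: power_less_top_ennreal)
    finally show ?thesis .
  qed
  define C where "C = enn2real (q 1)"
  have C: "C \<ge> 0" "q 1 = ennreal C" using q1 by (auto simp: C_def)
  have qpos: "q r = ennreal (C * r ^ N)" if "r > 0" for r
    using qs[OF that, of 1] C that by (simp add: ennreal_mult' mult.commute)
  \<comment> \<open>Scaling by 2 gives \<open>q 0 = 2^N q 0\<close>; as \<open>N >= 1\<close> and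
    \<open>q 0\<close> is finite, it must be 0.\<close>
  have q0: "q 0 = 0"
  proof -
    have "q 0 \<le> q 1" unfolding q_def by (intro nn_integral_mono mult_left_mono) (auto simp: indicator_def)
    then obtain a where a: "a \<ge> 0" "q 0 = ennreal a" using q1 by (cases "q 0") (auto simp: top_unique)
    have "ennreal a = ennreal (2 ^ N * a)" using qs[of 2 0] a by (simp add: ennreal_mult')
    hence "a = 2 ^ N * a" using a by (subst (asm) ennreal_inj) auto
    moreover have "(2::real) ^ N > 1" using N by (intro one_less_power) auto
    ultimately have "a = 0" by (metis mult_cancel_right1 less_irrefl)
    thus ?thesis using a by simp
  qed
  have qneg: "q r = 0" if "r < 0" for r
    unfolding q_def using radius_nonneg[of J] that
    by (intro nn_integral_zero') (auto simp: indicator_def intro!: AE_I2, metis not_less order.trans radius_nonneg)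
  define M1 where "M1 = distr (density ?L H) borel (radius J)"
  \<comment> \<open>The density is the derivative of \<open>C r^N\<close>, so \<open>M1\<close> and
    \<open>M2\<close> give the same mass to all half-lines, which generate the Borel sets.\<close>
  define M2 where "M2 = density lborel (\<lambda>r. ennreal (C * real N * (indicator {0..} r * r ^ (N - 1))))"
  have e1: "emeasure M1 {..r} = q r" for r
  proof -
    have "emeasure M1 {..r} = emeasure (density ?L H) (radius J -` {..r} \<inter> space ?L)"
      unfolding M1_def by (subst emeasure_distr) auto
    also have "\<dots> = (\<integral>\<^sup>+x. H x * indicator (radius J -` {..r} \<inter> space ?L) x \<partial>?L)"
      by (subst emeasure_density) auto
    also have "\<dots> = q r" unfolding q_def by (intro nn_integral_cong) (auto simp: indicator_def)
    finally show ?thesis .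
  qed
  have e2: "emeasure M2 {..r} = q r" for r
  proof -
    have "emeasure M2 {..r} = (\<integral>\<^sup>+s. ennreal (C * real N * (indicator {0..} s * s ^ (N - 1))) * indicator {..r} s \<partial>lborel)"
      unfolding M2_def by (subst emeasure_density) auto
    also have "\<dots> = (\<integral>\<^sup>+s. ennreal (C * real N * s ^ (N - 1)) * indicator {0..r} s \<partial>lborel)"
      by (intro nn_integral_cong) (auto simp: indicator_def)
    also have "\<dots> = q r"
    proof (cases "r \<ge> 0")
      case True
      have "(\<integral>\<^sup>+s. ennreal (C * real N * s ^ (N - 1)) * indicator {0..r} s \<partial>lborel) = ennreal (C * r ^ N - C * 0 ^ N)"
      proof (rule nn_integral_FTC_Icc[OF _ _ _ True])
        fix s :: real
        have "((\<lambda>s. C * s ^ N) has_real_derivative C * real N * s ^ (N - 1)) (at s)"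
          by (auto intro!: derivative_eq_intros)
        thus "((\<lambda>s. C * s ^ N) has_real_derivative C * real N * s ^ (N - 1)) (at s)" .
      qed (use C in auto)
      moreover have "0 ^ N = (0 :: real)" using N by simp
      ultimately show ?thesis using qpos[of r] q0 True by (cases "r = 0") auto
    next
      case False
      thus ?thesis using qneg[of r] by (simp add: indicator_def)
    qed
    finally show ?thesis .
  qed
  have M12: "M1 = M2"
  proof (rule measure_eqI_generator_eq[where E = "range atMost" and \<Omega> = UNIV and A = "\<lambda>i. {..real i}"])
    show "Int_stable (range (atMost :: real \<Rightarrow> real set))" by (auto simp: Int_stable_def intro: range_eqI)
    show "(\<Union>i. {..real i}) = UNIV" by (auto intro: real_arch_simple)
    show "sets M1 = sigma_sets UNIV (range atMost)" "sets M2 = sigma_sets UNIV (range atMost)"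
      by (simp_all add: M1_def M2_def borel_eq_atMost sets_measure_of)
    show "emeasure M1 {..real i} \<noteq> \<infinity>" for i
      using qpos[of "real i"] q0 by (cases "i = 0") (auto simp: e1)
  qed (auto simp: e1 e2)
  show ?thesis
  proof (intro exI[of _ "C * real N"] conjI ballI)
    fix \<phi> :: "real \<Rightarrow> ennreal" assume [measurable]: "\<phi> \<in> borel_measurable borel"
    have "(\<integral>\<^sup>+x. H x * \<phi> (radius J x) \<partial>?L) = (\<integral>\<^sup>+r. \<phi> r \<partial>M1)"
      unfolding M1_def by (subst nn_integral_distr) (auto simp: nn_integral_density)
    also have "\<dots> = (\<integral>\<^sup>+r. ennreal (C * real N * (indicator {0..} r * r ^ (N - 1))) * \<phi> r \<partial>lborel)"
      unfolding M12 M2_def by (subst nn_integral_density) auto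
    also have "\<dots> = (\<integral>\<^sup>+r. ennreal (C * real N) * (\<phi> r * ennreal (indicator {0..} r * r ^ (N - 1))) \<partial>lborel)"
      using C by (intro nn_integral_cong) (auto simp: ennreal_mult' mult_ac indicator_def)
    also have "\<dots> = ennreal (C * real N) * (\<integral>\<^sup>+r. \<phi> r * ennreal (indicator {0..} r * r ^ (N - 1)) \<partial>lborel)"
      by (intro nn_integral_cmult) auto
    finally show "(\<integral>\<^sup>+x. H x * \<phi> (radius J x) \<partial>?L) = ennreal (C * real N) *
       (\<integral>\<^sup>+r. \<phi> r * ennreal (indicator {0..} r * r ^ (card J - 1)) \<partial>lborel)" by (simp add: N_def)
  qed (use C in simp)
qed

lemma std_gauss_PiM_eq_density:
  assumes J: "finite J"
  shows "std_gauss_PiM J = density (lborel_PiM J) (\<lambda>x. ennreal ((1 / sqrt (2 * pi)) ^ card J * exp (- (radius J x)\<^sup>2 / 2)))"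
proof -
  interpret std: real_distribution std_normal_distribution by (rule real_dist_normal_dist)
  interpret P: finite_product_prob_space "\<lambda>_. std_normal_distribution" J
    by standard (simp_all add: J)
  note [measurable] = measurable_radius(1)[OF J]
  have dens: "ennreal ((1 / sqrt (2 * pi)) ^ card J * exp (- (radius J x)\<^sup>2 / 2)) = (\<Prod>j\<in>J. ennreal (std_normal_density (x j)))" for x
  proof -
    have "(radius J x)\<^sup>2 = (\<Sum>j\<in>J. (x j)\<^sup>2)" by (simp add: radius_def sum_nonneg)
    hence "exp (- (radius J x)\<^sup>2 / 2) = (\<Prod>j\<in>J. exp (- (x j)\<^sup>2 / 2))"
      by (simp add: exp_sum[OF J, symmetric] sum_negf sum_divide_distrib)
    hence "(1 / sqrt (2 * pi)) ^ card J * exp (- (radius J x)\<^sup>2 / 2) = (\<Prod>j\<in>J. std_normal_density (x j))"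
      by (simp only: std_normal_density_def prod.distrib prod_constant)
    thus ?thesis by (simp add: prod_ennreal normal_density_nonneg)
  qed
  have "density (lborel_PiM J) (\<lambda>x. ennreal ((1 / sqrt (2 * pi)) ^ card J * exp (- (radius J x)\<^sup>2 / 2))) = std_gauss_PiM J"
  proof (rule P.PiM_eqI)
    show "sets (density (lborel_PiM J) (\<lambda>x. ennreal ((1 / sqrt (2 * pi)) ^ card J * exp (- (radius J x)\<^sup>2 / 2)))) = sets (std_gauss_PiM J)"
      by (simp cong: sets_PiM_cong)
  next
    fix A :: "'a \<Rightarrow> real set" assume A0: "\<And>j. j \<in> J \<Longrightarrow> A j \<in> sets std_normal_distribution"
    have A: "j \<in> J \<Longrightarrow> A j \<in> sets lborel" for j using A0 by simp
    have box: "Pi\<^sub>E J A \<in> sets (lborel_PiM J)" using A J by (intro sets_PiM_I_finite) auto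
    have "emeasure (density (lborel_PiM J) (\<lambda>x. ennreal ((1 / sqrt (2 * pi)) ^ card J * exp (- (radius J x)\<^sup>2 / 2)))) (Pi\<^sub>E J A)
      = (\<integral>\<^sup>+x. ennreal ((1 / sqrt (2 * pi)) ^ card J * exp (- (radius J x)\<^sup>2 / 2)) * indicator (Pi\<^sub>E J A) x \<partial>lborel_PiM J)"
      using box by (subst emeasure_density) auto
    also have "\<dots> = (\<integral>\<^sup>+x. (\<Prod>j\<in>J. ennreal (std_normal_density (x j)) * indicator (A j) (x j)) \<partial>lborel_PiM J)"
    proof (rule nn_integral_cong)
      fix x assume "x \<in> space (lborel_PiM J)"
      hence "(indicator (Pi\<^sub>E J A) x :: ennreal) = (\<Prod>j\<in>J. indicator (A j) (x j))"
        using J by (auto simp: indicator_def PiE_iff space_PiM prod.If_cases)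
      thus "ennreal ((1 / sqrt (2 * pi)) ^ card J * exp (- (radius J x)\<^sup>2 / 2)) * indicator (Pi\<^sub>E J A) x
         = (\<Prod>j\<in>J. ennreal (std_normal_density (x j)) * indicator (A j) (x j))"
        unfolding dens by (simp add: prod.distrib)
    qed
    also have "\<dots> = (\<Prod>j\<in>J. \<integral>\<^sup>+x. ennreal (std_normal_density x) * indicator (A j) x \<partial>lborel)"
      using A J by (intro lborel_prod.product_nn_integral_prod) auto
    also have "\<dots> = (\<Prod>j\<in>J. emeasure std_normal_distribution (A j))"
      using A by (intro prod.cong refl, subst emeasure_density) auto
    finally show "emeasure (density (lborel_PiM J) (\<lambda>x. ennreal ((1 / sqrt (2 * pi)) ^ card J * exp (- (radius J x)\<^sup>2 / 2)))) (Pi\<^sub>E J A)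
      = (\<Prod>j\<in>J. emeasure std_normal_distribution (A j))" .
  qed (rule J)
  thus ?thesis by simp
qed

text \<open>Unnormalised density of the chi distribution with \<open>N\<close> degrees of freedom.
  Its constant is never computed; comparing total masses eliminates it.\<close>

definition chi_kernel :: "nat \<Rightarrow> real \<Rightarrow> real" where
  "chi_kernel N r = indicator {0..} r * r ^ (N - 1) * exp (- r\<^sup>2 / 2)"

lemma measurable_chi_kernel [measurable]: "chi_kernel N \<in> borel_measurable borel"
  unfolding chi_kernel_def[abs_def] by measurable

lemma chi_kernel_nonneg: "0 \<le> chi_kernel N r"
  by (auto simp: chi_kernel_def indicator_def)

text \<open>\<open>C\<close> depends on the cone function \<open>H\<close> alone and the integral on
  \<open>\<phi>\<close> alone: this factorisation is the independence of direction and
  length.\<close>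

lemma gauss_cone_radial:
  fixes H :: "('j \<Rightarrow> real) \<Rightarrow> ennreal"
  assumes J: "finite J" "J \<noteq> {}" and H: "H \<in> borel_measurable (lborel_PiM J)"
    and H1: "\<And>x. H x \<le> 1"
    and cone: "\<And>c x. c > 0 \<Longrightarrow> H (scale_on J c x) = H x"
  shows "\<exists>C\<ge>0. \<forall>\<phi>\<in>borel_measurable borel. (\<integral>\<^sup>+x. H x * \<phi> (radius J x) \<partial>std_gauss_PiM J)
      = ennreal C * (\<integral>\<^sup>+r. \<phi> r * ennreal (chi_kernel (card J) r) \<partial>lborel)"
proof -
  note [measurable] = measurable_radius(1)[OF J(1)] H
  define K where "K = (1 / sqrt (2 * pi)) ^ card J"
  have K: "K > 0" by (simp add: K_def)
  obtain C where C: "C \<ge> 0" "\<And>\<phi>. \<phi> \<in> borel_measurable borel \<Longrightarrow> (\<integral>\<^sup>+x. H x * \<phi> (radius J x) \<partial>lborel_PiM J)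
      = ennreal C * (\<integral>\<^sup>+r. \<phi> r * ennreal (indicator {0..} r * r ^ (card J - 1)) \<partial>lborel)"
    using cone_radial_law[OF J H H1 cone] by blast
  show ?thesis
  proof (intro exI[of _ "K * C"] conjI ballI)
    fix \<phi> :: "real \<Rightarrow> ennreal" assume \<phi>[measurable]: "\<phi> \<in> borel_measurable borel"
    have "(\<integral>\<^sup>+x. H x * \<phi> (radius J x) \<partial>std_gauss_PiM J)
       = (\<integral>\<^sup>+x. ennreal (K * exp (- (radius J x)\<^sup>2 / 2)) * (H x * \<phi> (radius J x)) \<partial>lborel_PiM J)"
      unfolding std_gauss_PiM_eq_density[OF J(1)] K_def by (subst nn_integral_density) auto
    also have "\<dots> = (\<integral>\<^sup>+x. ennreal K * (H x * (\<lambda>r. \<phi> r * ennreal (exp (- r\<^sup>2 / 2))) (radius J x)) \<partial>lborel_PiM J)"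
      using K by (intro nn_integral_cong) (simp add: ennreal_mult mult_ac)
    also have "\<dots> = ennreal K * (\<integral>\<^sup>+x. H x * (\<lambda>r. \<phi> r * ennreal (exp (- r\<^sup>2 / 2))) (radius J x) \<partial>lborel_PiM J)"
      by (rule nn_integral_cmult) measurable
    also have "(\<integral>\<^sup>+x. H x * (\<lambda>r. \<phi> r * ennreal (exp (- r\<^sup>2 / 2))) (radius J x) \<partial>lborel_PiM J)
       = ennreal C * (\<integral>\<^sup>+r. (\<phi> r * ennreal (exp (- r\<^sup>2 / 2))) * ennreal (indicator {0..} r * r ^ (card J - 1)) \<partial>lborel)"
      by (rule C(2)) measurable
    also have "(\<integral>\<^sup>+r. (\<phi> r * ennreal (exp (- r\<^sup>2 / 2))) * ennreal (indicator {0..} r * r ^ (card J - 1)) \<partial>lborel)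
       = (\<integral>\<^sup>+r. \<phi> r * ennreal (chi_kernel (card J) r) \<partial>lborel)"
      by (intro nn_integral_cong) (auto simp: chi_kernel_def ennreal_mult mult_ac indicator_def)
    finally show "(\<integral>\<^sup>+x. H x * \<phi> (radius J x) \<partial>std_gauss_PiM J) = ennreal (K * C) * (\<integral>\<^sup>+r. \<phi> r * ennreal (chi_kernel (card J) r) \<partial>lborel)"
      using K C by (simp add: ennreal_mult mult.assoc)
  qed (use K C in simp)
qed

lemma radius_distribution:
  assumes J: "finite J" "J \<noteq> {}"
  shows "\<exists>a\<ge>0. distr (std_gauss_PiM J) borel (radius J) = density lborel (\<lambda>r. ennreal (a * chi_kernel (card J) r))"
proof -
  note [measurable] = measurable_radius(3)[OF J(1)]
  have "\<exists>C\<ge>0. \<forall>\<phi>\<in>borel_measurable borel. (\<integral>\<^sup>+x. (\<lambda>_. 1) x * \<phi> (radius J x) \<partial>std_gauss_PiM J)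
      = ennreal C * (\<integral>\<^sup>+r. \<phi> r * ennreal (chi_kernel (card J) r) \<partial>lborel)"
    by (rule gauss_cone_radial[OF J]) auto
  then obtain a where a: "a \<ge> 0" "\<And>\<phi>. \<phi> \<in> borel_measurable borel \<Longrightarrow> (\<integral>\<^sup>+x. \<phi> (radius J x) \<partial>std_gauss_PiM J)
      = ennreal a * (\<integral>\<^sup>+r. \<phi> r * ennreal (chi_kernel (card J) r) \<partial>lborel)"
    by auto
  have "distr (std_gauss_PiM J) borel (radius J) = density lborel (\<lambda>r. ennreal (a * chi_kernel (card J) r))"
  proof (rule measure_eqI)
    fix B :: "real set" assume "B \<in> sets (distr (std_gauss_PiM J) borel (radius J))"
    hence B[measurable]: "B \<in> sets borel" by simp
    have "emeasure (distr (std_gauss_PiM J) borel (radius J)) B = (\<integral>\<^sup>+r. indicator B r \<partial>distr (std_gauss_PiM J) borel (radius J))"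
      by simp
    also have "\<dots> = (\<integral>\<^sup>+x. indicator B (radius J x) \<partial>std_gauss_PiM J)"
      by (subst nn_integral_distr) auto
    also have "\<dots> = ennreal a * (\<integral>\<^sup>+r. indicator B r * ennreal (chi_kernel (card J) r) \<partial>lborel)"
      by (rule a(2)) simp
    also have "\<dots> = (\<integral>\<^sup>+r. ennreal a * (indicator B r * ennreal (chi_kernel (card J) r)) \<partial>lborel)"
      by (rule nn_integral_cmult[symmetric]) auto
    also have "\<dots> = (\<integral>\<^sup>+r. ennreal (a * chi_kernel (card J) r) * indicator B r \<partial>lborel)"
      using a(1) chi_kernel_nonneg by (intro nn_integral_cong) (simp add: ennreal_mult mult_ac)
    also have "\<dots> = emeasure (density lborel (\<lambda>r. ennreal (a * chi_kernel (card J) r))) B"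
      by (subst emeasure_density) auto
    finally show "emeasure (distr (std_gauss_PiM J) borel (radius J)) B = emeasure (density lborel (\<lambda>r. ennreal (a * chi_kernel (card J) r))) B" .
  qed simp
  thus ?thesis using a(1) by blast
qed

text \<open>For a scale invariant \<open>F\<close> the set where \<open>F x\<close> lies in
  \<open>A\<close> is a cone, so \<open>gauss_cone_radial\<close> with its indicator as
  \<open>H\<close> shows that the joint law of \<open>F\<close> and the radius is a product on
  rectangles.\<close>

lemma radius_indep_cone_function:
  fixes F :: "('j \<Rightarrow> real) \<Rightarrow> real"
  assumes J: "finite J" "J \<noteq> {}" and F: "F \<in> borel_measurable (std_gauss_PiM J)"
    and cone: "\<And>c x. c > 0 \<Longrightarrow> F (scale_on J c x) = F x"
  shows "prob_space.indep_var (std_gauss_PiM J) borel F borel (radius J)"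
proof -
  interpret std: real_distribution std_normal_distribution by (rule real_dist_normal_dist)
  interpret P: finite_product_prob_space "\<lambda>_. std_normal_distribution" J
    by standard (simp_all add: J)
  note [measurable] = measurable_radius(3)[OF J(1)] F
  have setsL: "sets (std_gauss_PiM J) = sets (lborel_PiM J)" by (simp cong: sets_PiM_cong)
  have FL: "F \<in> borel_measurable (lborel_PiM J)" using F by (simp cong: measurable_cong_sets add: setsL)
  interpret D1: prob_space "distr (std_gauss_PiM J) borel F" by (rule P.prob_space_distr) simp
  interpret D2: prob_space "distr (std_gauss_PiM J) borel (radius J)" by (rule P.prob_space_distr) simp
  show ?thesis
    unfolding P.indep_var_distribution_eq
  proof (intro conjI)
    show "distr (std_gauss_PiM J) borel F \<Otimes>\<^sub>M distr (std_gauss_PiM J) borel (radius J)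
       = distr (std_gauss_PiM J) (borel \<Otimes>\<^sub>M borel) (\<lambda>x. (F x, radius J x))"
    proof (rule pair_measure_eqI)
      fix A B assume "A \<in> sets (distr (std_gauss_PiM J) borel F)" "B \<in> sets (distr (std_gauss_PiM J) borel (radius J))"
      hence A[measurable]: "A \<in> sets borel" and B[measurable]: "B \<in> sets borel" by auto
      have "\<exists>C\<ge>0. \<forall>\<phi>\<in>borel_measurable borel. (\<integral>\<^sup>+x. indicator A (F x) * \<phi> (radius J x) \<partial>std_gauss_PiM J)
          = ennreal C * (\<integral>\<^sup>+r. \<phi> r * ennreal (chi_kernel (card J) r) \<partial>lborel)"
        using FL by (intro gauss_cone_radial[OF J]) (auto simp: cone indicator_def)
      then obtain C where C: "\<And>\<phi>. \<phi> \<in> borel_measurable borel \<Longrightarrow> (\<integral>\<^sup>+x. indicator A (F x) * \<phi> (radius J x) \<partial>std_gauss_PiM J)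
          = ennreal C * (\<integral>\<^sup>+r. \<phi> r * ennreal (chi_kernel (card J) r) \<partial>lborel)" by auto
      have "\<exists>C\<ge>0. \<forall>\<phi>\<in>borel_measurable borel. (\<integral>\<^sup>+x. (\<lambda>_. 1) x * \<phi> (radius J x) \<partial>std_gauss_PiM J)
          = ennreal C * (\<integral>\<^sup>+r. \<phi> r * ennreal (chi_kernel (card J) r) \<partial>lborel)"
        by (rule gauss_cone_radial[OF J]) auto
      then obtain a where a: "\<And>\<phi>. \<phi> \<in> borel_measurable borel \<Longrightarrow> (\<integral>\<^sup>+x. \<phi> (radius J x) \<partial>std_gauss_PiM J)
          = ennreal a * (\<integral>\<^sup>+r. \<phi> r * ennreal (chi_kernel (card J) r) \<partial>lborel)"
        by auto
      define I where "I \<phi> = (\<integral>\<^sup>+r. \<phi> r * ennreal (chi_kernel (card J) r) \<partial>lborel)" for \<phi>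
      \<comment> \<open>Total mass one. It allows the unknown constants to be exchanged: the joint
        mass \<open>C I(B)\<close> equals \<open>C I(1)\<close> times \<open>a I(B)\<close>.\<close>
      have one: "ennreal a * I (\<lambda>_. 1) = 1"
        using a[of "\<lambda>_. 1"] P.emeasure_space_1 by (simp add: I_def)
      have eA: "emeasure (distr (std_gauss_PiM J) borel F) A = ennreal C * I (\<lambda>_. 1)"
      proof -
        have "emeasure (distr (std_gauss_PiM J) borel F) A = (\<integral>\<^sup>+y. indicator A y \<partial>distr (std_gauss_PiM J) borel F)" by simp
        also have "\<dots> = (\<integral>\<^sup>+x. indicator A (F x) * (\<lambda>_. 1) (radius J x) \<partial>std_gauss_PiM J)"
          by (subst nn_integral_distr) auto
        also have "\<dots> = ennreal C * I (\<lambda>_. 1)" unfolding I_def by (rule C) simp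
        finally show ?thesis .
      qed
      have eB: "emeasure (distr (std_gauss_PiM J) borel (radius J)) B = ennreal a * I (indicator B)"
      proof -
        have "emeasure (distr (std_gauss_PiM J) borel (radius J)) B = (\<integral>\<^sup>+y. indicator B y \<partial>distr (std_gauss_PiM J) borel (radius J))" by simp
        also have "\<dots> = (\<integral>\<^sup>+x. indicator B (radius J x) \<partial>std_gauss_PiM J)"
          by (subst nn_integral_distr) auto
        also have "\<dots> = ennreal a * I (indicator B)" unfolding I_def by (rule a) simp
        finally show ?thesis .
      qed
      have "emeasure (distr (std_gauss_PiM J) (borel \<Otimes>\<^sub>M borel) (\<lambda>x. (F x, radius J x))) (A \<times> B)
         = (\<integral>\<^sup>+z. indicator (A \<times> B) z \<partial>distr (std_gauss_PiM J) (borel \<Otimes>\<^sub>M borel) (\<lambda>x. (F x, radius J x)))"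
        by simp
      also have "\<dots> = (\<integral>\<^sup>+x. indicator (A \<times> B) (F x, radius J x) \<partial>std_gauss_PiM J)"
        by (subst nn_integral_distr) auto
      also have "\<dots> = (\<integral>\<^sup>+x. indicator A (F x) * indicator B (radius J x) \<partial>std_gauss_PiM J)"
        by (intro nn_integral_cong) (auto simp: indicator_def)
      also have "\<dots> = ennreal C * I (indicator B)" unfolding I_def by (rule C) simp
      also have "\<dots> = ennreal C * (ennreal a * I (\<lambda>_. 1)) * I (indicator B)" by (simp add: one)
      finally show "emeasure (distr (std_gauss_PiM J) borel F) A * emeasure (distr (std_gauss_PiM J) borel (radius J)) B
        = emeasure (distr (std_gauss_PiM J) (borel \<Otimes>\<^sub>M borel) (\<lambda>x. (F x, radius J x))) (A \<times> B)"
        by (simp add: eA eB mult_ac)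
    qed (auto intro: D1.sigma_finite_measure_axioms D2.sigma_finite_measure_axioms)
  qed auto
qed

text \<open>The substitution \<open>t = r^2 / 2\<close> in Euler's integral for
  \<open>Gamma z\<close>. The factor \<open>2^(z - 1)\<close> compensates for the \<open>1/2\<close>
  in the substitution.\<close>

lemma chi_kernel_Mellin:
  fixes b :: real
  assumes N: "N \<ge> 1"
  defines "z \<equiv> Complex (real N / 2) b"
  shows "(CLINT r|lborel. chi_kernel N r *\<^sub>R iexp (b * ln (r\<^sup>2))) = exp ((z - 1) * of_real (ln 2)) * Gamma z"
proof -
  define f where "f t = complex_of_real t powr (z - 1) / of_real (exp t)" for t
  have Rez: "Re z > 0" using N by (simp add: z_def)
  have "f absolutely_integrable_on {0<..}" "integral {0<..} f = Gamma z"
    using absolutely_integrable_Gamma_integral'[OF Rez] Gamma_integral_complex'[OF Rez]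
    by (auto simp: f_def[abs_def] integral_unique)
  moreover have img: "(\<lambda>r. r\<^sup>2 / 2) ` {0<..} = {(0::real)<..}"
  proof (intro equalityI subsetI)
    fix t :: real assume "t \<in> {0<..}"
    thus "t \<in> (\<lambda>r. r\<^sup>2 / 2) ` {0<..}" by (intro image_eqI[of _ _ "sqrt (2 * t)"]) auto
  qed auto
  have "(\<lambda>r. \<bar>r\<bar> *\<^sub>R f (r\<^sup>2 / 2)) absolutely_integrable_on {0<..} \<and> integral {0<..} (\<lambda>r. \<bar>r\<bar> *\<^sub>R f (r\<^sup>2 / 2)) = Gamma z
     \<longleftrightarrow> f absolutely_integrable_on ((\<lambda>r. r\<^sup>2 / 2) ` {0<..}) \<and> integral ((\<lambda>r. r\<^sup>2 / 2) ` {0<..}) f = Gamma z"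
  proof (rule has_absolute_integral_change_of_variables_real)
    show "((\<lambda>r. r\<^sup>2 / 2) has_real_derivative r) (at r within {0<..})" for r :: real
      by (auto intro!: derivative_eq_intros)
    show "inj_on (\<lambda>r::real. r\<^sup>2 / 2) {0<..}"
      by (rule inj_onI) (auto simp: power2_eq_iff_nonneg)
  qed auto
  ultimately have I: "(\<lambda>r. \<bar>r\<bar> *\<^sub>R f (r\<^sup>2 / 2)) absolutely_integrable_on {0<..}"
      "integral {0<..} (\<lambda>r. \<bar>r\<bar> *\<^sub>R f (r\<^sup>2 / 2)) = Gamma z" by (simp_all add: img)
  have pt: "indicator {0<..} r *\<^sub>R (\<bar>r\<bar> *\<^sub>R f (r\<^sup>2 / 2)) = exp ((1 - z) * of_real (ln 2)) * ((indicator {0<..} r * r ^ (N - 1) * exp (- r\<^sup>2 / 2)) *\<^sub>R iexp (b * ln (r\<^sup>2)))" for r :: real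
  proof (cases "r > 0")
    case True
    define l where "l = ln r"
    have r: "r = exp l" using True by (simp add: l_def)
    have lr: "ln (r\<^sup>2 / 2) = 2 * l - ln 2" "ln (r\<^sup>2) = 2 * l"
      using True by (simp_all add: l_def ln_div ln_realpow)
    have zz: "z = of_real (real N / 2) + \<i> * of_real b" by (simp add: z_def complex_eq_iff)
    have pw: "complex_of_real t powr w = exp (w * of_real (ln t))" if "t > 0" for t w
      using that by (simp add: powr_def Ln_of_real)
    define E where "E = exp (- complex_of_real (r\<^sup>2 / 2))"
    have fr: "f (r\<^sup>2 / 2) = exp ((z - 1) * of_real (2 * l - ln 2)) * E"
      unfolding f_def pw[of "r\<^sup>2 / 2", OF divide_pos_pos[OF zero_less_power[OF True] zero_less_numeral]] lr
      by (simp only: E_def exp_minus exp_of_real divide_inverse)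
    have "complex_of_real r = exp (of_real l)" by (simp only: r exp_of_real)
    hence L: "\<bar>r\<bar> *\<^sub>R f (r\<^sup>2 / 2) = exp (of_real l + (z - 1) * of_real (2 * l - ln 2)) * E"
      using True by (simp only: scaleR_conv_of_real abs_of_pos fr exp_add mult.assoc)
    have "r ^ (N - 1) = exp (real (N - 1) * l)" by (simp only: r exp_of_nat_mult)
    hence "complex_of_real (r ^ (N - 1)) = exp (of_real (real (N - 1) * l))" by (simp only: exp_of_real)
    moreover have "complex_of_real (exp (- r\<^sup>2 / 2)) = E"
      by (simp only: E_def of_real_minus[symmetric] exp_of_real minus_divide_left)
    ultimately have R: "(r ^ (N - 1) * exp (- r\<^sup>2 / 2)) *\<^sub>R iexp (b * ln (r\<^sup>2))
        = exp (of_real (real (N - 1) * l) + \<i> * of_real (b * (2 * l))) * E"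
      by (simp only: scaleR_conv_of_real of_real_mult lr exp_add mult_ac)
    have key: "complex_of_real l + (z - 1) * of_real (2 * l - ln 2) = (1 - z) * of_real (ln 2) + (of_real (real (N - 1) * l) + \<i> * of_real (b * (2 * l)))"
      using N by (simp add: zz of_nat_diff algebra_simps)
    have i1: "indicator {0<..} r = (1::real)" using True by simp
    show ?thesis
      unfolding i1 scaleR_one mult_1 L R key exp_add by (simp only: mult_ac)
  next
    case False
    thus ?thesis by simp
  qed
  have "Gamma z = (CLINT r:{0<..}|lebesgue. \<bar>r\<bar> *\<^sub>R f (r\<^sup>2 / 2))"
    using set_lebesgue_integral_eq_integral(2)[OF I(1)] I(2) by simp
  also have "\<dots> = (CLINT r|lebesgue. exp ((1 - z) * of_real (ln 2)) * ((indicator {0<..} r * r ^ (N - 1) * exp (- r\<^sup>2 / 2)) *\<^sub>R iexp (b * ln (r\<^sup>2))))"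
    unfolding set_lebesgue_integral_def pt ..
  also have "\<dots> = (CLINT r|lborel. exp ((1 - z) * of_real (ln 2)) * ((indicator {0<..} r * r ^ (N - 1) * exp (- r\<^sup>2 / 2)) *\<^sub>R iexp (b * ln (r\<^sup>2))))"
    by (rule integral_completion) measurable
  also have "\<dots> = exp ((1 - z) * of_real (ln 2)) * (CLINT r|lborel. (indicator {0<..} r * r ^ (N - 1) * exp (- r\<^sup>2 / 2)) *\<^sub>R iexp (b * ln (r\<^sup>2)))"
    by (rule integral_mult_right_zero)
  also have "(CLINT r|lborel. (indicator {0<..} r * r ^ (N - 1) * exp (- r\<^sup>2 / 2)) *\<^sub>R iexp (b * ln (r\<^sup>2)))
      = (CLINT r|lborel. chi_kernel N r *\<^sub>R iexp (b * ln (r\<^sup>2)))"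
  \<comment> \<open>The substitution lives on the open half-line, \<open>chi_kernel\<close> on the
    closed one; they differ in the null set consisting of 0.\<close>
  proof (rule integral_cong_AE)
    show "AE r in lborel. (indicator {0<..} r * r ^ (N - 1) * exp (- r\<^sup>2 / 2)) *\<^sub>R iexp (b * ln (r\<^sup>2)) = chi_kernel N r *\<^sub>R iexp (b * ln (r\<^sup>2))"
      using AE_lborel_singleton[of "0::real"] by eventually_elim (auto simp: chi_kernel_def indicator_def)
  qed measurable
  finally have G: "Gamma z = exp ((1 - z) * of_real (ln 2)) * (CLINT r|lborel. chi_kernel N r *\<^sub>R iexp (b * ln (r\<^sup>2)))" .
  have "exp ((z - 1) * of_real (ln 2)) * exp ((1 - z) * of_real (ln 2)) = 1"
    by (simp add: exp_add[symmetric] algebra_simps)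
  thus ?thesis unfolding G mult.assoc[symmetric] by simp
qed

lemma cf_ln_chi_square:
  fixes b :: real
  assumes J: "finite J" "J \<noteq> {}"
  shows "(CLINT x|std_gauss_PiM J. iexp (b * ln ((radius J x)\<^sup>2)))
     = iexp (b * ln 2) * (Gamma (Complex (real (card J) / 2) b) / Gamma (complex_of_real (real (card J) / 2)))"
proof -
  define N where "N = card J"
  have N: "N \<ge> 1" using J by (simp add: N_def card_gt_0_iff Suc_le_eq)
  interpret std: real_distribution std_normal_distribution by (rule real_dist_normal_dist)
  interpret P: finite_product_prob_space "\<lambda>_. std_normal_distribution" J
    by standard (simp_all add: J)
  note [measurable] = measurable_radius(3)[OF J(1)]
  obtain a where a: "a \<ge> 0" "distr (std_gauss_PiM J) borel (radius J) = density lborel (\<lambda>r. ennreal (a * chi_kernel N r))"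
    using radius_distribution[OF J] by (auto simp: N_def)
  have E: "(CLINT x|std_gauss_PiM J. iexp (b * ln ((radius J x)\<^sup>2)))
     = of_real a * (exp ((Complex (real N / 2) b - 1) * of_real (ln 2)) * Gamma (Complex (real N / 2) b))" for b
  proof -
    have "(CLINT x|std_gauss_PiM J. iexp (b * ln ((radius J x)\<^sup>2))) = (CLINT r|distr (std_gauss_PiM J) borel (radius J). iexp (b * ln (r\<^sup>2)))"
      by (subst integral_distr) auto
    also have "\<dots> = (CLINT r|lborel. (a * chi_kernel N r) *\<^sub>R iexp (b * ln (r\<^sup>2)))"
      unfolding a(2) using a(1) chi_kernel_nonneg by (subst integral_density) auto
    also have "\<dots> = (CLINT r|lborel. of_real a * (chi_kernel N r *\<^sub>R iexp (b * ln (r\<^sup>2))))"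
      by (simp only: scaleR_conv_of_real of_real_mult mult.assoc)
    also have "\<dots> = of_real a * (CLINT r|lborel. chi_kernel N r *\<^sub>R iexp (b * ln (r\<^sup>2)))"
      by (rule integral_mult_right_zero)
    finally show ?thesis by (simp only: chi_kernel_Mellin[OF N])
  qed
  have c0: "Complex (real N / 2) 0 = of_real (real N / 2)" by (simp add: complex_eq_iff)
  \<comment> \<open>The case \<open>b = 0\<close> determines the normaliser \<open>a\<close> and
    also shows that the Gamma value in the denominator is nonzero.\<close>
  have one: "of_real a * (exp ((of_real (real N / 2) - 1) * of_real (ln 2)) * Gamma (complex_of_real (real N / 2))) = 1"
    using E[of 0] prob_space.prob_space[OF prob_space_PiM, of J "\<lambda>_. std_normal_distribution"] std.prob_space_axioms
    by (simp add: c0)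
  have sp: "exp ((Complex (real N / 2) b - 1) * of_real (ln 2)) = iexp (b * ln 2) * exp ((of_real (real N / 2) - 1) * of_real (ln 2))"
  proof -
    have "Complex (real N / 2) b = of_real (real N / 2) + \<i> * of_real b" by (simp add: complex_eq_iff)
    thus ?thesis by (simp add: exp_add[symmetric] algebra_simps)
  qed
  define g where "g = Gamma (complex_of_real (real N / 2))"
  define e where "e = exp ((complex_of_real (real N / 2) - 1) * of_real (ln 2))"
  have one': "of_real a * (e * g) = 1" using one by (simp add: e_def g_def)
  hence "g \<noteq> 0" by auto
  have "(CLINT x|std_gauss_PiM J. iexp (b * ln ((radius J x)\<^sup>2))) = iexp (b * ln 2) * (Gamma (Complex (real N / 2) b) / g) * (of_real a * (e * g))"
    unfolding E sp e_def[symmetric] using \<open>g \<noteq> 0\<close> by (simp add: field_simps)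
  thus ?thesis unfolding one' by (simp add: g_def N_def)
qed

section \<open>Sums of squares within a Gaussian family\<close>

lemma std_gauss_family_subset:
  fixes X :: "'j \<Rightarrow> 'a \<Rightarrow> real"
  assumes G: "std_gauss_family M K X" and K: "finite K" "B \<subseteq> K"
  shows "std_gauss_family M B X"
  unfolding std_gauss_family_def
proof (intro conjI ballI allI)
  show "prob_space M" using G by (simp add: std_gauss_family_def)
  show "X j \<in> borel_measurable M" if "j \<in> B" for j using G K that by (auto simp: std_gauss_family_def)
  fix c :: "'j \<Rightarrow> real"
  have *: "(\<Sum>j\<in>K. (if j \<in> B then c j else 0) * X j \<omega>) = (\<Sum>j\<in>B. c j * X j \<omega>)" for \<omega>
    using K by (intro sum.mono_neutral_cong_right) auto
  have **: "(\<Sum>j\<in>K. (if j \<in> B then c j else 0)\<^sup>2) = (\<Sum>j\<in>B. (c j)\<^sup>2)"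
    using K by (intro sum.mono_neutral_cong_right) auto
  have "\<forall>c. (CLINT \<omega>|M. iexp (\<Sum>j\<in>K. c j * X j \<omega>)) = of_real (exp (- (\<Sum>j\<in>K. (c j)\<^sup>2) / 2))"
    using G unfolding std_gauss_family_def by blast
  from this[rule_format, of "\<lambda>j. if j \<in> B then c j else 0"]
  show "(CLINT \<omega>|M. iexp (\<Sum>j\<in>B. c j * X j \<omega>)) = of_real (exp (- (\<Sum>j\<in>B. (c j)\<^sup>2) / 2))"
    unfolding * ** .
qed

lemma std_gauss_family_component:
  assumes G: "std_gauss_family M K X" and K: "finite K" "i \<in> K"
  shows "distr M borel (X i) = std_normal_distribution"
proof -
  interpret M: prob_space M using G by (simp add: std_gauss_family_def)
  have X: "X i \<in> borel_measurable M" using G K by (simp add: std_gauss_family_def)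
  have "std_gauss_family M {i} X" by (rule std_gauss_family_subset[OF G K(1)]) (use K in auto)
  hence cf: "\<forall>c. (CLINT \<omega>|M. iexp (\<Sum>j\<in>{i}. c j * X j \<omega>)) = of_real (exp (- (\<Sum>j\<in>{i}. (c j)\<^sup>2) / 2))"
    unfolding std_gauss_family_def by blast
  have "char (distr M borel (X i)) s = char std_normal_distribution s" for s
  proof -
    have "char (distr M borel (X i)) s = (CLINT \<omega>|M. iexp (s * X i \<omega>))"
      unfolding char_def using X by (subst integral_distr) auto
    thus ?thesis using cf[rule_format, of "\<lambda>_. s"] by (simp add: char_std_normal_distribution)
  qed
  thus ?thesis by (intro Levy_uniqueness M.real_distribution_distr X real_dist_normal_dist) auto
qed

lemma std_gauss_family_indep:
  assumes G: "std_gauss_family M K X" and K: "finite K" "K \<noteq> {}"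
  shows "prob_space.indep_vars M (\<lambda>_. borel) X K"
proof -
  interpret M: prob_space M using G by (simp add: std_gauss_family_def)
  have X: "X i \<in> borel_measurable M" if "i \<in> K" for i using G that by (simp add: std_gauss_family_def)
  have "(\<Pi>\<^sub>M i\<in>K. distr M borel (X i)) = std_gauss_PiM K"
    by (intro PiM_cong refl std_gauss_family_component[OF G K(1)])
  thus ?thesis
    using std_gauss_family_law[OF K(1) G] X K(2)
    by (subst M.indep_vars_iff_distr_eq_PiM') auto
qed

lemma std_gauss_family_integral:
  fixes f :: "('j \<Rightarrow> real) \<Rightarrow> complex"
  assumes G: "std_gauss_family M K X" and K: "finite K" and f: "f \<in> borel_measurable (PiM K (\<lambda>_. borel))"
  shows "(CLINT x|std_gauss_PiM K. f x) = (CLINT \<omega>|M. f (\<lambda>j\<in>K. X j \<omega>))"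
proof -
  have "(\<lambda>\<omega>. \<lambda>j\<in>K. X j \<omega>) \<in> measurable M (PiM K (\<lambda>_. borel))"
    using G by (intro measurable_restrict) (auto simp: std_gauss_family_def)
  thus ?thesis
    unfolding std_gauss_family_law[OF K G, symmetric] using f by (subst integral_distr) auto
qed

text \<open>A single coordinate is already nonzero almost surely. This keeps the value
  \<open>ln 0 = 0\<close> out of the logarithms of sums of squares.\<close>

lemma std_gauss_family_AE_sum_squares_pos:
  assumes G: "std_gauss_family M K X" and K: "finite K" and B: "B \<subseteq> K" "B \<noteq> {}"
  shows "AE \<omega> in M. (\<Sum>r\<in>B. (X r \<omega>)\<^sup>2) > 0"
proof -
  obtain r where r: "r \<in> B" using B by auto
  have Xr: "X r \<in> borel_measurable M" using G B r by (auto simp: std_gauss_family_def)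
  have "AE x in std_normal_distribution. x \<noteq> 0"
    by (subst AE_density) (use AE_lborel_singleton[of "0::real"] in \<open>auto elim: eventually_mono\<close>)
  hence "AE x in distr M borel (X r). x \<noteq> 0"
    unfolding std_gauss_family_component[OF G K subsetD[OF B(1) r]] .
  hence "AE \<omega> in M. X r \<omega> \<noteq> 0" by (rule AE_distrD[OF Xr])
  thus ?thesis
  proof eventually_elim
    case (elim \<omega>)
    have "0 < (X r \<omega>)\<^sup>2" using elim by simp
    also have "\<dots> \<le> (\<Sum>r\<in>B. (X r \<omega>)\<^sup>2)" using r B K by (intro member_le_sum) (auto intro: finite_subset)
    finally show ?case .
  qed
qed

lemma std_gauss_family_cf_ln:
  assumes G: "std_gauss_family M K X" and K: "finite K" and B: "B \<subseteq> K" "B \<noteq> {}"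
  shows "(CLINT \<omega>|M. iexp (b * ln (\<Sum>r\<in>B. (X r \<omega>)\<^sup>2)))
     = iexp (b * ln 2) * (Gamma (Complex (real (card B) / 2) b) / Gamma (complex_of_real (real (card B) / 2)))"
proof -
  have fB: "finite B" using K B by (auto intro: finite_subset)
  have GB: "std_gauss_family M B X" by (rule std_gauss_family_subset[OF G K B(1)])
  note [measurable] = measurable_radius(2)[OF fB]
  have rs: "(radius B (\<lambda>j\<in>B. X j \<omega>))\<^sup>2 = (\<Sum>r\<in>B. (X r \<omega>)\<^sup>2)" for \<omega>
    by (simp add: radius_def sum_nonneg)
  show ?thesis
    using std_gauss_family_integral[OF GB fB, of "\<lambda>x. iexp (b * ln ((radius B x)\<^sup>2))"] cf_ln_chi_square[OF fB B(2), of b]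
    by (simp add: rs)
qed

text \<open>The statistic \<open>F = \<Sum> b i ln (R i / T)\<close> only depends on the direction of the Gaussian vector, hence is
  independent of \<open>T\<close>, its squared length; so dividing the characteristic function of
  \<open>\<Sum> b i ln (R i)\<close> by that of \<open>(\<Sum> b i) ln T\<close> gives the one of \<open>F\<close>.\<close>
theorem gauss_log_ratio_cf:
  fixes X :: "'r \<Rightarrow> 'a \<Rightarrow> real" and b :: "nat \<Rightarrow> real"
  assumes G: "std_gauss_family M K X" and K: "finite K" and k: "k \<ge> 1"
    and B: "\<And>i. i < k \<Longrightarrow> B i \<subseteq> K" "\<And>i. i < k \<Longrightarrow> B i \<noteq> {}" "disjoint_family_on B {..<k}"
  defines "\<beta> \<equiv> \<Sum>i<k. b i"
  shows "(CLINT \<omega>|M. iexp ((\<Sum>i<k. b i * ln (\<Sum>r\<in>B i. (X r \<omega>)\<^sup>2)) - \<beta> * ln (\<Sum>r\<in>K. (X r \<omega>)\<^sup>2)))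
    = (\<Prod>i<k. Gamma (Complex (real (card (B i)) / 2) (b i)) / Gamma (complex_of_real (real (card (B i)) / 2)))
      * (Gamma (complex_of_real (real (card K) / 2)) / Gamma (Complex (real (card K) / 2) \<beta>))"
proof -
  interpret M: prob_space M using G by (simp add: std_gauss_family_def)
  have Kne: "K \<noteq> {}" using B(1,2)[of 0] k by auto
  have fB: "finite (B i)" if "i < k" for i using B(1)[OF that] K by (rule finite_subset)
  have X: "X j \<in> borel_measurable M" if "j \<in> K" for j using G that by (simp add: std_gauss_family_def)
  define R where "R i x = (\<Sum>r\<in>B i. (x r)\<^sup>2)" for i and x :: "'r \<Rightarrow> real"
  \<comment> \<open>Where some \<open>R i x\<close> vanishes, the value \<open>ln 0 = 0\<close>
    would break the invariance under scaling. The default 0 makes \<open>F\<close> scale invariant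
    at every point, at the price of being equal to the statistic only almost surely.\<close>
  define F where "F x = (if \<forall>i<k. R i x > 0 then (\<Sum>i<k. b i * ln (R i x)) - \<beta> * ln ((radius K x)\<^sup>2) else 0)" for x
  have comp[measurable]: "(\<lambda>x. x r) \<in> borel_measurable (PiM K (\<lambda>_. borel))" if "r \<in> K" for r
    using that by simp
  have Rm[measurable]: "R i \<in> borel_measurable (PiM K (\<lambda>_. borel))" if "i < k" for i
    unfolding R_def[abs_def] using B(1)[OF that] by (intro borel_measurable_sum borel_measurable_power comp) auto
  note [measurable] = measurable_radius(2)[OF K]
  have Fm[measurable]: "F \<in> borel_measurable (PiM K (\<lambda>_. borel))"
  proof -
    have "Measurable.pred (PiM K (\<lambda>_. borel)) (\<lambda>x. \<forall>i\<in>{..<k}. R i x > 0)"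
      by (intro pred_intros_finite) (auto intro!: borel_measurable_less Rm)
    hence [measurable]: "Measurable.pred (PiM K (\<lambda>_. borel)) (\<lambda>x. \<forall>i<k. R i x > 0)" by (simp add: Ball_def)
    have [measurable]: "(\<lambda>x. \<Sum>i<k. b i * ln (R i x)) \<in> borel_measurable (PiM K (\<lambda>_. borel))"
      by (intro borel_measurable_sum borel_measurable_times borel_measurable_ln Rm) auto
    show ?thesis unfolding F_def[abs_def] by measurable
  qed
  have setsG: "sets (std_gauss_PiM K) = sets (PiM K (\<lambda>_. borel))" by (simp cong: sets_PiM_cong)
  have cone: "F (scale_on K c x) = F x" if "c > 0" for c x
  proof -
    have Rc: "R i (scale_on K c x) = c\<^sup>2 * R i x" if "i < k" for i
      unfolding R_def sum_distrib_left using B(1)[OF that] by (intro sum.cong) (auto simp: scale_on_def power_mult_distrib)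
    have pos: "(\<forall>i<k. R i (scale_on K c x) > 0) \<longleftrightarrow> (\<forall>i<k. R i x > 0)"
      using Rc that by (auto simp: zero_less_mult_iff)
    show ?thesis
    proof (cases "\<forall>i<k. R i x > 0")
      case True
      have "R 0 x \<le> (radius K x)\<^sup>2"
        using B(1)[of 0] k K by (auto simp: R_def radius_def sum_nonneg intro!: sum_mono2)
      hence rp: "(radius K x)\<^sup>2 > 0" using True k by (smt (verit) less_le_trans zero_less_one Suc_le_eq One_nat_def)
      have "(\<Sum>i<k. b i * ln (R i (scale_on K c x))) = (\<Sum>i<k. b i * ln (c\<^sup>2) + b i * ln (R i x))"
        using True that by (intro sum.cong refl) (auto simp: Rc ln_mult algebra_simps)
      also have "\<dots> = \<beta> * ln (c\<^sup>2) + (\<Sum>i<k. b i * ln (R i x))"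
        by (simp add: sum.distrib \<beta>_def sum_distrib_right)
      finally have "(\<Sum>i<k. b i * ln (R i (scale_on K c x))) = \<beta> * ln (c\<^sup>2) + (\<Sum>i<k. b i * ln (R i x))" .
      moreover have "ln ((radius K (scale_on K c x))\<^sup>2) = ln (c\<^sup>2) + ln ((radius K x)\<^sup>2)"
        unfolding radius_scale_on[OF that] power_mult_distrib using rp that by (simp add: ln_mult)
      ultimately show ?thesis using True pos by (simp add: F_def algebra_simps)
    next
      case False
      hence "\<not> (\<forall>i<k. R i (scale_on K c x) > 0)" using pos by blast
      thus ?thesis unfolding F_def by (simp only: False if_False)
    qed
  qed
  let ?\<gamma> = "std_gauss_PiM K"
  have ps: "prob_space ?\<gamma>"
    by (intro prob_space_PiM) (use real_dist_normal_dist in \<open>simp add: real_distribution_def\<close>)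
  interpret \<gamma>: prob_space ?\<gamma> by (rule ps)
  have F\<gamma>: "F \<in> borel_measurable ?\<gamma>" using Fm by (simp cong: measurable_cong_sets add: setsG)
  have ind: "\<gamma>.indep_var borel F borel (radius K)"
    by (rule radius_indep_cone_function[OF K Kne F\<gamma> cone])
  have "\<gamma>.indep_var borel ((\<lambda>u. iexp u) \<circ> F) borel ((\<lambda>r. iexp (\<beta> * ln (r\<^sup>2))) \<circ> radius K)"
    by (rule \<gamma>.indep_var_compose[OF ind]) auto
  hence "(CLINT x|?\<gamma>. iexp (F x) * iexp (\<beta> * ln ((radius K x)\<^sup>2))) = (CLINT x|?\<gamma>. iexp (F x)) * (CLINT x|?\<gamma>. iexp (\<beta> * ln ((radius K x)\<^sup>2)))"
    unfolding comp_def using F\<gamma> measurable_radius(3)[OF K]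
    by (intro \<gamma>.indep_var_lebesgue_integral) (auto intro!: \<gamma>.integrable_iexp)
  hence fact: "(CLINT \<omega>|M. iexp (F (\<lambda>j\<in>K. X j \<omega>)) * iexp (\<beta> * ln ((radius K (\<lambda>j\<in>K. X j \<omega>))\<^sup>2)))
     = (CLINT \<omega>|M. iexp (F (\<lambda>j\<in>K. X j \<omega>))) * (CLINT x|?\<gamma>. iexp (\<beta> * ln ((radius K x)\<^sup>2)))"
    using std_gauss_family_integral[OF G K, of "\<lambda>x. iexp (F x) * iexp (\<beta> * ln ((radius K x)\<^sup>2))"]
      std_gauss_family_integral[OF G K, of "\<lambda>x. iexp (F x)"] by simp
  have Rre: "R i (\<lambda>j\<in>K. X j \<omega>) = (\<Sum>r\<in>B i. (X r \<omega>)\<^sup>2)" if "i < k" for i \<omega>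
    unfolding R_def using B(1)[OF that] by (intro sum.cong) auto
  have rre: "(radius K (\<lambda>j\<in>K. X j \<omega>))\<^sup>2 = (\<Sum>r\<in>K. (X r \<omega>)\<^sup>2)" for \<omega>
    by (simp add: radius_def sum_nonneg)
  have AEpos: "AE \<omega> in M. \<forall>i\<in>{..<k}. (\<Sum>r\<in>B i. (X r \<omega>)\<^sup>2) > 0"
    using std_gauss_family_AE_sum_squares_pos[OF G K B(1,2)] by (intro AE_finite_allI) auto
  have Fre: "AE \<omega> in M. F (\<lambda>j\<in>K. X j \<omega>) = (\<Sum>i<k. b i * ln (\<Sum>r\<in>B i. (X r \<omega>)\<^sup>2)) - \<beta> * ln (\<Sum>r\<in>K. (X r \<omega>)\<^sup>2)"
    using AEpos by eventually_elim (simp add: F_def Rre rre)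
  have restr: "(\<lambda>\<omega>. \<lambda>j\<in>K. X j \<omega>) \<in> measurable M (PiM K (\<lambda>_. borel))"
    using X by (intro measurable_restrict) auto
  have FX: "(\<lambda>\<omega>. F (\<lambda>j\<in>K. X j \<omega>)) \<in> borel_measurable M"
    by (rule measurable_compose[OF restr Fm])
  have S1: "(\<lambda>\<omega>. \<Sum>i<k. b i * ln (\<Sum>r\<in>B i. (X r \<omega>)\<^sup>2)) \<in> borel_measurable M"
    using B(1) X by (intro borel_measurable_sum borel_measurable_times borel_measurable_ln borel_measurable_power) auto
  have S2: "(\<lambda>\<omega>. \<beta> * ln (\<Sum>r\<in>K. (X r \<omega>)\<^sup>2)) \<in> borel_measurable M"
    using X by (intro borel_measurable_sum borel_measurable_times borel_measurable_ln borel_measurable_power) auto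
  note [measurable] = FX S1 S2
  have lhs: "(CLINT \<omega>|M. iexp (F (\<lambda>j\<in>K. X j \<omega>))) = (CLINT \<omega>|M. iexp ((\<Sum>i<k. b i * ln (\<Sum>r\<in>B i. (X r \<omega>)\<^sup>2)) - \<beta> * ln (\<Sum>r\<in>K. (X r \<omega>)\<^sup>2)))"
  proof (rule integral_cong_AE)
    show "AE \<omega> in M. iexp (F (\<lambda>j\<in>K. X j \<omega>)) = iexp ((\<Sum>i<k. b i * ln (\<Sum>r\<in>B i. (X r \<omega>)\<^sup>2)) - \<beta> * ln (\<Sum>r\<in>K. (X r \<omega>)\<^sup>2))"
      using Fre by eventually_elim simp
  qed measurable
  have prod: "(CLINT \<omega>|M. iexp (F (\<lambda>j\<in>K. X j \<omega>)) * iexp (\<beta> * ln ((radius K (\<lambda>j\<in>K. X j \<omega>))\<^sup>2)))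
     = (CLINT \<omega>|M. (\<Prod>i<k. iexp (b i * ln (\<Sum>r\<in>B i. (X r \<omega>)\<^sup>2))))"
  proof (rule integral_cong_AE)
    show "AE \<omega> in M. iexp (F (\<lambda>j\<in>K. X j \<omega>)) * iexp (\<beta> * ln ((radius K (\<lambda>j\<in>K. X j \<omega>))\<^sup>2)) = (\<Prod>i<k. iexp (b i * ln (\<Sum>r\<in>B i. (X r \<omega>)\<^sup>2)))"
      using Fre
    proof eventually_elim
      case (elim \<omega>)
      have "F (\<lambda>j\<in>K. X j \<omega>) + \<beta> * ln ((radius K (\<lambda>j\<in>K. X j \<omega>))\<^sup>2) = (\<Sum>i<k. b i * ln (\<Sum>r\<in>B i. (X r \<omega>)\<^sup>2))"
        unfolding elim rre by simp
      hence "iexp (F (\<lambda>j\<in>K. X j \<omega>)) * iexp (\<beta> * ln ((radius K (\<lambda>j\<in>K. X j \<omega>))\<^sup>2)) = iexp (\<Sum>i<k. b i * ln (\<Sum>r\<in>B i. (X r \<omega>)\<^sup>2))"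
        by (simp only: exp_add[symmetric] distrib_left[symmetric] of_real_add[symmetric])
      thus ?case by (simp only: of_real_sum sum_distrib_left exp_sum finite_lessThan)
    qed
    show "(\<lambda>\<omega>. \<Prod>i<k. iexp (b i * ln (\<Sum>r\<in>B i. (X r \<omega>)\<^sup>2))) \<in> borel_measurable M"
    proof (intro borel_measurable_prod)
      fix i assume "i \<in> {..<k}"
      hence [measurable]: "(\<lambda>\<omega>. \<Sum>r\<in>B i. (X r \<omega>)\<^sup>2) \<in> borel_measurable M"
        using B(1)[of i] X by (intro borel_measurable_sum borel_measurable_power) auto
      show "(\<lambda>\<omega>. iexp (b i * ln (\<Sum>r\<in>B i. (X r \<omega>)\<^sup>2))) \<in> borel_measurable M" by measurable
    qed
    show "(\<lambda>\<omega>. iexp (F (\<lambda>j\<in>K. X j \<omega>)) * iexp (\<beta> * ln ((radius K (\<lambda>j\<in>K. X j \<omega>))\<^sup>2))) \<in> borel_measurable M"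
      unfolding rre by measurable
  qed
  have indB: "M.indep_vars (\<lambda>i. PiM (B i) (\<lambda>_. borel)) (\<lambda>i \<omega>. \<lambda>j\<in>B i. X j \<omega>) {..<k}"
    using B by (intro M.indep_vars_restrict[OF std_gauss_family_indep[OF G K Kne]]) auto
  have "M.indep_vars (\<lambda>i. borel) (\<lambda>i \<omega>. iexp (b i * ln ((radius (B i) (\<lambda>j\<in>B i. X j \<omega>))\<^sup>2))) {..<k}"
  proof (rule M.indep_vars_compose2[OF indB])
    fix i assume "i \<in> {..<k}"
    hence [measurable]: "radius (B i) \<in> borel_measurable (PiM (B i) (\<lambda>_. borel))" using fB by (intro measurable_radius) auto
    show "(\<lambda>x. iexp (b i * ln ((radius (B i) x)\<^sup>2))) \<in> borel_measurable (PiM (B i) (\<lambda>_. borel))" by measurable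
  qed
  moreover have "(radius (B i) (\<lambda>j\<in>B i. X j \<omega>))\<^sup>2 = (\<Sum>r\<in>B i. (X r \<omega>)\<^sup>2)" for i \<omega>
    by (simp add: radius_def sum_nonneg)
  ultimately have "M.indep_vars (\<lambda>i. borel) (\<lambda>i \<omega>. iexp (b i * ln (\<Sum>r\<in>B i. (X r \<omega>)\<^sup>2))) {..<k}" by simp
  hence "(CLINT \<omega>|M. (\<Prod>i<k. iexp (b i * ln (\<Sum>r\<in>B i. (X r \<omega>)\<^sup>2)))) = (\<Prod>i<k. CLINT \<omega>|M. iexp (b i * ln (\<Sum>r\<in>B i. (X r \<omega>)\<^sup>2)))"
  proof (intro M.indep_vars_lebesgue_integral)
    fix i assume "i \<in> {..<k}"
    hence [measurable]: "(\<lambda>\<omega>. \<Sum>r\<in>B i. (X r \<omega>)\<^sup>2) \<in> borel_measurable M"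
      using B(1)[of i] X by (intro borel_measurable_sum borel_measurable_power) auto
    show "integrable M (\<lambda>\<omega>. iexp (b i * ln (\<Sum>r\<in>B i. (X r \<omega>)\<^sup>2)))" by (intro M.integrable_iexp) auto
  qed auto
  also have "\<dots> = (\<Prod>i<k. iexp (b i * ln 2) * (Gamma (Complex (real (card (B i)) / 2) (b i)) / Gamma (complex_of_real (real (card (B i)) / 2))))"
    using B by (intro prod.cong std_gauss_family_cf_ln[OF G K] refl) auto
  also have "\<dots> = iexp (\<beta> * ln 2) * (\<Prod>i<k. Gamma (Complex (real (card (B i)) / 2) (b i)) / Gamma (complex_of_real (real (card (B i)) / 2)))"
    unfolding prod.distrib by (simp add: \<beta>_def exp_sum[symmetric] sum_distrib_left sum_distrib_right)
  finally have P: "(CLINT \<omega>|M. (\<Prod>i<k. iexp (b i * ln (\<Sum>r\<in>B i. (X r \<omega>)\<^sup>2))))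
     = iexp (\<beta> * ln 2) * (\<Prod>i<k. Gamma (Complex (real (card (B i)) / 2) (b i)) / Gamma (complex_of_real (real (card (B i)) / 2)))" .
  have cK: "real (card K) / 2 > 0" using K Kne by (simp add: card_gt_0_iff)
  \<comment> \<open>\<open>Gamma\<close> has no zeros, and the real parts are positive, so the
    characteristic function of the squared length may be divided out.\<close>
  have g: "Gamma (complex_of_real (real (card K) / 2)) \<noteq> 0" "Gamma (Complex (real (card K) / 2) \<beta>) \<noteq> 0"
  proof -
    have "complex_of_real (real (card K) / 2) \<notin> \<int>\<^sub>\<le>\<^sub>0" "Complex (real (card K) / 2) \<beta> \<notin> \<int>\<^sub>\<le>\<^sub>0"
      using cK by (auto simp: complex_eq_iff elim!: nonpos_Ints_cases)
    thus "Gamma (complex_of_real (real (card K) / 2)) \<noteq> 0" "Gamma (Complex (real (card K) / 2) \<beta>) \<noteq> 0"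
      by (simp_all only: Gamma_eq_zero_iff not_False_eq_True)
  qed
  \<comment> \<open>The factors \<open>iexp (b i * ln 2)\<close> of the blocks multiply to the
    factor that the squared length contributes, so it cancels.\<close>
  define e where "e = iexp (\<beta> * ln 2)"
  have e: "e \<noteq> 0" by (simp add: e_def)
  from fact[unfolded prod P lhs cf_ln_chi_square[OF K Kne]] show ?thesis
    unfolding e_def[symmetric] using e g by (simp add: field_simps)
qed

section \<open>Orthonormal systems and Gram determinants\<close>

definition ip :: "'j set \<Rightarrow> ('j \<Rightarrow> real) \<Rightarrow> ('j \<Rightarrow> real) \<Rightarrow> real" where
  "ip J u v = (\<Sum>j\<in>J. u j * v j)"

text \<open>Products are taken over \<open>J\<close> only, yet distinct members of \<open>E\<close>
  differ on \<open>J\<close>, since otherwise their product would be 1 instead of 0. Hence a plain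
  set of functions can serve as index set of a Gaussian family.\<close>

definition orthonormal_on :: "'j set \<Rightarrow> ('j \<Rightarrow> real) set \<Rightarrow> bool" where
  "orthonormal_on J E \<longleftrightarrow> finite E \<and> (\<forall>e\<in>E. \<forall>f\<in>E. ip J e f = (if e = f then 1 else 0))"

lemma ip_commute: "ip J u v = ip J v u"
  by (simp add: ip_def mult.commute)

lemma ip_nonneg: "0 \<le> ip J u u"
  by (simp add: ip_def sum_nonneg)

lemma ip_cong: "(\<And>j. j \<in> J \<Longrightarrow> u j = u' j) \<Longrightarrow> (\<And>j. j \<in> J \<Longrightarrow> v j = v' j) \<Longrightarrow> ip J u v = ip J u' v'"
  by (simp add: ip_def cong: sum.cong)

lemma ip_diff_left: "ip J (\<lambda>j. u j - v j) w = ip J u w - ip J v w"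
  by (simp add: ip_def left_diff_distrib sum_subtractf)

lemma ip_sum_left: "ip J (\<lambda>j. \<Sum>a\<in>A. c a * v a j) w = (\<Sum>a\<in>A. c a * ip J (v a) w)"
  unfolding ip_def sum_distrib_left sum_distrib_right by (subst sum.swap) (simp add: mult.assoc)

lemma ip_scale_left: "ip J (\<lambda>j. c * u j) w = c * ip J u w"
  by (simp add: ip_def sum_distrib_left mult.assoc)

definition residual :: "'j set \<Rightarrow> ('j \<Rightarrow> real) set \<Rightarrow> ('j \<Rightarrow> real) \<Rightarrow> 'j \<Rightarrow> real" where
  "residual J E y = (\<lambda>j. y j - (\<Sum>e\<in>E. ip J e y * e j))"

lemma residual_orthogonal:
  assumes E: "orthonormal_on J E" and f: "f \<in> E"
  shows "ip J f (residual J E y) = 0"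
proof -
  have "ip J (residual J E y) f = ip J y f - (\<Sum>e\<in>E. ip J e y * ip J e f)"
    unfolding residual_def ip_diff_left ip_sum_left ..
  also have "(\<Sum>e\<in>E. ip J e y * ip J e f) = (\<Sum>e\<in>E. if e = f then ip J e y else 0)"
    using E f by (intro sum.cong) (auto simp: orthonormal_on_def)
  also have "\<dots> = ip J f y" using E f by (simp add: orthonormal_on_def)
  finally show ?thesis by (simp add: ip_commute)
qed

lemma residual_norm:
  assumes E: "orthonormal_on J E"
  shows "ip J (residual J E y) y = ip J y y - (\<Sum>e\<in>E. (ip J e y)\<^sup>2)"
    and "ip J (residual J E y) (residual J E y) = ip J y y - (\<Sum>e\<in>E. (ip J e y)\<^sup>2)"
proof -
  show A: "ip J (residual J E y) y = ip J y y - (\<Sum>e\<in>E. (ip J e y)\<^sup>2)"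
    unfolding residual_def ip_diff_left ip_sum_left by (simp add: power2_eq_square)
  have "ip J (residual J E y) (residual J E y) = ip J y (residual J E y) - (\<Sum>e\<in>E. ip J e y * ip J e (residual J E y))"
    by (subst (1) residual_def) (simp only: ip_diff_left ip_sum_left)
  also have "\<dots> = ip J y (residual J E y)" using residual_orthogonal[OF E] by simp
  finally show "ip J (residual J E y) (residual J E y) = ip J y y - (\<Sum>e\<in>E. (ip J e y)\<^sup>2)"
    using A by (simp add: ip_commute)
qed

lemma orthonormal_on_insert:
  assumes E: "orthonormal_on J E" and w: "ip J w w = 1" "\<And>e. e \<in> E \<Longrightarrow> ip J e w = 0"
  shows "orthonormal_on J (insert w E)" "w \<notin> E"
proof -
  show "w \<notin> E" using w by force
  have "ip J w e = 0" if "e \<in> E" for e using w(2)[OF that] ip_commute[of J w e] by simp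
  thus "orthonormal_on J (insert w E)" using E w \<open>w \<notin> E\<close> by (auto simp: orthonormal_on_def)
qed

lemma orthonormal_on_normalized_residual:
  assumes E: "orthonormal_on J E" and pos: "ip J y y - (\<Sum>e\<in>E. (ip J e y)\<^sup>2) > 0"
  defines "w \<equiv> (\<lambda>j. (1 / sqrt (ip J y y - (\<Sum>e\<in>E. (ip J e y)\<^sup>2))) * residual J E y j)"
  shows "ip J w w = 1" "\<And>e. e \<in> E \<Longrightarrow> ip J e w = 0"
proof -
  show "ip J w w = 1" unfolding w_def ip_scale_left
    by (subst ip_commute, unfold ip_scale_left residual_norm(2)[OF E]) (use pos in simp)
  show "ip J e w = 0" if "e \<in> E" for e
    unfolding w_def by (subst ip_commute, unfold ip_scale_left, subst ip_commute) (simp add: residual_orthogonal[OF E that])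
qed

definition unit_vec_at :: "'j \<Rightarrow> 'j \<Rightarrow> real" where
  "unit_vec_at j i = (if i = j then 1 else 0)"

lemma ip_unit_vec_at: "finite J \<Longrightarrow> j \<in> J \<Longrightarrow> ip J u (unit_vec_at j) = u j"
  by (simp add: ip_def unit_vec_at_def if_distrib[of "\<lambda>x. _ * x"] cong: if_cong)

text \<open>Summing Bessel's inequality over the unit vectors gives \<open>card E \<le> card J\<close>, with equality
  precisely when all the residuals vanish.\<close>
lemma sum_residuals_unit_vecs:
  assumes J: "finite J" and E: "orthonormal_on J E"
  shows "(\<Sum>j\<in>J. ip J (unit_vec_at j) (unit_vec_at j) - (\<Sum>e\<in>E. (ip J e (unit_vec_at j))\<^sup>2)) = real (card J) - real (card E)"
proof -
  have "(\<Sum>j\<in>J. ip J (unit_vec_at j) (unit_vec_at j) - (\<Sum>e\<in>E. (ip J e (unit_vec_at j))\<^sup>2)) = (\<Sum>j\<in>J. 1 - (\<Sum>e\<in>E. (e j)\<^sup>2))"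
    using J by (intro sum.cong refl) (simp add: ip_unit_vec_at, simp add: unit_vec_at_def)
  also have "\<dots> = real (card J) - (\<Sum>e\<in>E. \<Sum>j\<in>J. (e j)\<^sup>2)"
    by (simp add: sum_subtractf, subst sum.swap, rule refl)
  also have "(\<Sum>e\<in>E. \<Sum>j\<in>J. (e j)\<^sup>2) = (\<Sum>e\<in>E. ip J e e)" by (simp add: ip_def power2_eq_square)
  also have "\<dots> = real (card E)" using E by (simp add: orthonormal_on_def)
  finally show ?thesis .
qed

lemma orthonormal_on_card_le:
  assumes J: "finite J" and E: "orthonormal_on J E"
  shows "card E \<le> card J"
proof -
  have "0 \<le> (\<Sum>j\<in>J. ip J (unit_vec_at j) (unit_vec_at j) - (\<Sum>e\<in>E. (ip J e (unit_vec_at j))\<^sup>2))"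
    by (intro sum_nonneg) (simp only: residual_norm(2)[OF E, symmetric] ip_nonneg)
  thus ?thesis using sum_residuals_unit_vecs[OF J E] by simp
qed

text \<open>With equal cardinalities the residuals of all unit vectors vanish on \<open>J\<close>;
  by expanding \<open>y\<close> in unit vectors, so does the residual of \<open>y\<close>.\<close>

lemma parseval:
  assumes J: "finite J" and E: "orthonormal_on J E" and card: "card E = card J"
  shows "ip J y y = (\<Sum>e\<in>E. (ip J e y)\<^sup>2)"
proof -
  have fE: "finite E" using E by (simp add: orthonormal_on_def)
  have "(\<Sum>j\<in>J. ip J (unit_vec_at j) (unit_vec_at j) - (\<Sum>e\<in>E. (ip J e (unit_vec_at j))\<^sup>2)) = 0"
    using sum_residuals_unit_vecs[OF J E] card by simp
  hence "\<forall>j\<in>J. ip J (unit_vec_at j) (unit_vec_at j) - (\<Sum>e\<in>E. (ip J e (unit_vec_at j))\<^sup>2) = 0"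
    using J by (subst (asm) sum_nonneg_eq_0_iff) (simp_all only: residual_norm(2)[OF E, symmetric] ip_nonneg)
  hence "\<forall>j\<in>J. ip J (residual J E (unit_vec_at j)) (residual J E (unit_vec_at j)) = 0"
    by (simp only: residual_norm(2)[OF E])
  hence z: "residual J E (unit_vec_at j) i = 0" if "j \<in> J" "i \<in> J" for i j
    using that J by (auto simp: ip_def sum_nonneg_eq_0_iff)
  have "residual J E y i = 0" if i: "i \<in> J" for i
  proof -
    have "(\<Sum>e\<in>E. ip J e y * e i) = (\<Sum>j\<in>J. y j * (\<Sum>e\<in>E. e j * e i))"
      unfolding ip_def sum_distrib_left sum_distrib_right by (subst sum.swap) (simp add: mult_ac)
    also have "\<dots> = (\<Sum>j\<in>J. y j * unit_vec_at j i)"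
    proof (intro sum.cong refl)
      fix j assume j: "j \<in> J"
      have "unit_vec_at j i - (\<Sum>e\<in>E. ip J e (unit_vec_at j) * e i) = 0" using z[OF j i] by (simp add: residual_def)
      thus "y j * (\<Sum>e\<in>E. e j * e i) = y j * unit_vec_at j i" using j J by (simp add: ip_unit_vec_at)
    qed
    also have "\<dots> = y i" using i J by (simp add: unit_vec_at_def if_distrib[of "\<lambda>x. _ * x"] cong: if_cong)
    finally show ?thesis by (simp add: residual_def)
  qed
  hence "ip J (residual J E y) (residual J E y) = 0" by (simp add: ip_def)
  thus ?thesis by (simp add: residual_norm(2)[OF E])
qed

text \<open>As long as \<open>E\<close> is too small, some unit vector has a nonzero residual, which
  is normalised and adjoined. The new vectors vanish off \<open>J\<close>, so that products with
  them over a larger index set reduce to products over \<open>J\<close>.\<close>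

lemma orthonormal_completion:
  assumes J: "finite J" and E: "orthonormal_on J E"
  shows "\<exists>U. U \<inter> E = {} \<and> orthonormal_on J (E \<union> U) \<and> card (E \<union> U) = card J \<and> (\<forall>u\<in>U. \<forall>j. j \<notin> J \<longrightarrow> u j = 0)"
  using E
proof (induction "card J - card E" arbitrary: E)
  case 0
  hence "card E = card J" using orthonormal_on_card_le[OF J 0(2)] by simp
  thus ?case using 0 by (intro exI[of _ "{}"]) auto
next
  case (Suc d)
  have "0 < (\<Sum>j\<in>J. ip J (unit_vec_at j) (unit_vec_at j) - (\<Sum>e\<in>E. (ip J e (unit_vec_at j))\<^sup>2))"
    using sum_residuals_unit_vecs[OF J Suc(3)] Suc(2) by simp
  then obtain j where j: "0 < ip J (unit_vec_at j) (unit_vec_at j) - (\<Sum>e\<in>E. (ip J e (unit_vec_at j))\<^sup>2)"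
    by (meson not_less sum_nonpos)
  define w0 where "w0 = (\<lambda>i. (1 / sqrt (ip J (unit_vec_at j) (unit_vec_at j) - (\<Sum>e\<in>E. (ip J e (unit_vec_at j))\<^sup>2))) * residual J E (unit_vec_at j) i)"
  \<comment> \<open>Cutting off outside \<open>J\<close> changes no product over
    \<open>J\<close>.\<close>
  define w where "w i = (if i \<in> J then w0 i else 0)" for i
  have "ip J w w = ip J w0 w0" "ip J e w = ip J e w0" for e by (auto intro!: ip_cong simp: w_def)
  hence w: "ip J w w = 1" "\<And>e. e \<in> E \<Longrightarrow> ip J e w = 0"
    using orthonormal_on_normalized_residual[OF Suc(3) j] by (auto simp: w0_def)
  note ins = orthonormal_on_insert[OF Suc(3) w]
  have "d = card J - card (insert w E)" using Suc(2) ins Suc(3) by (simp add: orthonormal_on_def)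
  from Suc(1)[OF this ins(1)] obtain U where U: "U \<inter> insert w E = {}" "orthonormal_on J (insert w E \<union> U)"
    "card (insert w E \<union> U) = card J" "\<forall>u\<in>U. \<forall>j. j \<notin> J \<longrightarrow> u j = 0" by blast
  have "insert w E \<union> U = E \<union> insert w U" by auto
  thus ?case using U ins(2) by (intro exI[of _ "insert w U"]) (auto simp: w_def)
qed

definition gram :: "'j set \<Rightarrow> (nat \<Rightarrow> 'j \<Rightarrow> real) \<Rightarrow> nat \<Rightarrow> real" where
  "gram J v m = det (mat m m (\<lambda>(a, b). ip J (v a) (v b)))"

lemma gram_cong: "(\<And>a j. a < m \<Longrightarrow> j \<in> J \<Longrightarrow> v a j = w a j) \<Longrightarrow> gram J v m = gram J w m"
  unfolding gram_def by (rule arg_cong[where f = det], rule cong_mat) (auto intro!: ip_cong)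

text \<open>Multiplication by the unit triangular \<open>L\<close> subtracts a combination of the
  earlier rows from the last one. By orthogonality the new last row is zero except in the corner,
  and expanding along it leaves the smaller Gram determinant.\<close>

lemma gram_Suc:
  assumes r: "\<And>j. j \<in> J \<Longrightarrow> r j = v m j - (\<Sum>a<m. c a * v a j)" and orth: "\<And>a. a < m \<Longrightarrow> ip J (v a) r = 0"
  shows "gram J v (Suc m) = gram J v m * ip J r (v m)"
proof -
  define A where "A = mat (Suc m) (Suc m) (\<lambda>(a, b). ip J (v a) (v b))"
  define L where "L = mat (Suc m) (Suc m) (\<lambda>(a, b). if a = b then 1 else if a = m then - c b else 0)"
  define A' where "A' = mat (Suc m) (Suc m) (\<lambda>(a, b). if a = m then ip J r (v b) else ip J (v a) (v b))"
  have LA: "L * A = A'"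
  proof (rule eq_matI)
    fix a b assume "a < dim_row A'" "b < dim_col A'"
    hence a: "a < Suc m" and b: "b < Suc m" by (auto simp: A'_def)
    have "(L * A) $$ (a, b) = (\<Sum>i<Suc m. (if a = i then 1 else if a = m then - c i else 0) * ip J (v i) (v b))"
      using a b by (simp add: L_def A_def scalar_prod_def lessThan_atLeast0)
    also have "\<dots> = A' $$ (a, b)"
    proof (cases "a = m")
      case False
      hence "(\<Sum>i<Suc m. (if a = i then 1 else if a = m then - c i else 0) * ip J (v i) (v b)) = (\<Sum>i<Suc m. if i = a then ip J (v i) (v b) else 0)"
        by (intro sum.cong) auto
      thus ?thesis using a b False by (simp add: A'_def)
    next
      case True
      have "ip J r (v b) = ip J (\<lambda>j. v m j - (\<Sum>a<m. c a * v a j)) (v b)" by (intro ip_cong r) auto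
      also have "\<dots> = ip J (v m) (v b) - (\<Sum>i<m. c i * ip J (v i) (v b))"
        unfolding ip_diff_left ip_sum_left ..
      finally show ?thesis using a b True by (simp add: A'_def sum_negf)
    qed
    finally show "(L * A) $$ (a, b) = A' $$ (a, b)" .
  qed (auto simp: L_def A_def A'_def)
  have "det L = prod_list (diag_mat L)" by (rule det_lower_triangular[of "Suc m"]) (auto simp: L_def)
  also have "diag_mat L = map (\<lambda>_. 1) [0..<Suc m]" unfolding diag_mat_def by (intro map_cong) (auto simp: L_def)
  also have "prod_list \<dots> = (1::real)" by (induction m) auto
  finally have "det A' = det A"
    using det_mult[of L "Suc m" A] LA by (simp add: L_def A_def)
  moreover have "det A' = (\<Sum>j<Suc m. A' $$ (m, j) * cofactor A' m j)"
    by (rule laplace_expansion_row) (auto simp: A'_def)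
  moreover have "(\<Sum>j<Suc m. A' $$ (m, j) * cofactor A' m j) = ip J r (v m) * cofactor A' m m"
    using orth by (simp add: A'_def ip_commute[of J r])
  moreover have "cofactor A' m m = gram J v m"
  proof -
    have "mat_delete A' m m = mat m m (\<lambda>(a, b). ip J (v a) (v b))"
      by (rule eq_matI) (auto simp: mat_delete_def A'_def)
    thus ?thesis by (simp add: cofactor_def gram_def)
  qed
  ultimately show ?thesis by (simp add: gram_def A_def)
qed

text \<open>The basis \<open>E\<close> is fixed before \<open>y\<close> is chosen, which later
  allows a random vector in the new column. Nonzero leading Gram determinants ensure that every
  residual met on the way can be normalised.\<close>

lemma gram_schmidt:
  assumes "\<And>l. l \<le> m \<Longrightarrow> gram J v l \<noteq> 0"
  shows "\<exists>E. orthonormal_on J E \<and> card E = m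
    \<and> (\<forall>e\<in>E. \<exists>c. \<forall>j\<in>J. e j = (\<Sum>a<m. c a * v a j))
    \<and> (\<forall>a<m. \<exists>c. \<forall>j\<in>J. v a j = (\<Sum>e\<in>E. c e * e j))
    \<and> (\<forall>y. gram J (v(m := y)) (Suc m) = gram J v m * (ip J y y - (\<Sum>e\<in>E. (ip J e y)\<^sup>2)))"
proof -
  have det_id: "gram J (v(m := y)) (Suc m) = gram J v m * (ip J y y - (\<Sum>e\<in>E. (ip J e y)\<^sup>2))"
    if E: "orthonormal_on J E" and span1: "\<forall>e\<in>E. \<exists>c. \<forall>j\<in>J. e j = (\<Sum>a<m. c a * v a j)"
      and span2: "\<forall>a<m. \<exists>c. \<forall>j\<in>J. v a j = (\<Sum>e\<in>E. c e * e j)" for E m y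
  proof -
    obtain c where c: "\<And>e j. e \<in> E \<Longrightarrow> j \<in> J \<Longrightarrow> e j = (\<Sum>a<m. c e a * v a j)" using span1 by metis
    have "gram J (v(m := y)) (Suc m) = gram J (v(m := y)) m * ip J (residual J E y) ((v(m := y)) m)"
    proof (rule gram_Suc[where c = "\<lambda>a. \<Sum>e\<in>E. ip J e y * c e a"])
      fix j assume j: "j \<in> J"
      have "(\<Sum>e\<in>E. ip J e y * e j) = (\<Sum>e\<in>E. ip J e y * (\<Sum>a<m. c e a * v a j))"
        using c j by (intro sum.cong) auto
      also have "\<dots> = (\<Sum>a<m. (\<Sum>e\<in>E. ip J e y * c e a) * v a j)"
        unfolding sum_distrib_left sum_distrib_right by (subst sum.swap) (simp add: mult.assoc)
      finally show "residual J E y j = (v(m := y)) m j - (\<Sum>a<m. (\<Sum>e\<in>E. ip J e y * c e a) * (v(m := y)) a j)"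
        by (simp add: residual_def)
    next
      fix a assume a: "a < m"
      then obtain d where d: "\<And>j. j \<in> J \<Longrightarrow> v a j = (\<Sum>e\<in>E. d e * e j)" using span2 by blast
      have "ip J (v a) (residual J E y) = ip J (\<lambda>j. \<Sum>e\<in>E. d e * (\<lambda>e. e) e j) (residual J E y)"
        using d by (intro ip_cong) auto
      also have "\<dots> = 0" unfolding ip_sum_left using residual_orthogonal[OF E] by simp
      finally show "ip J ((v(m := y)) a) (residual J E y) = 0" using a by simp
    qed
    moreover have "gram J (v(m := y)) m = gram J v m" by (rule gram_cong) auto
    ultimately show ?thesis using residual_norm(1)[OF E] by simp
  qed
  show ?thesis
    using assms
  proof (induction m)
    case 0
    show ?case
    proof (intro exI[of _ "{}"] conjI)
      show "\<forall>y. gram J (v(0 := y)) (Suc 0) = gram J v 0 * (ip J y y - (\<Sum>e\<in>{}. (ip J e y)\<^sup>2))"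
        by (intro allI det_id) (simp_all add: orthonormal_on_def)
    qed (simp_all add: orthonormal_on_def)
  next
    case (Suc m)
    obtain E where E: "orthonormal_on J E" "card E = m"
      and s1: "\<forall>e\<in>E. \<exists>c. \<forall>j\<in>J. e j = (\<Sum>a<m. c a * v a j)"
      and s2: "\<forall>a<m. \<exists>c. \<forall>j\<in>J. v a j = (\<Sum>e\<in>E. c e * e j)"
      and g: "\<And>y. gram J (v(m := y)) (Suc m) = gram J v m * (ip J y y - (\<Sum>e\<in>E. (ip J e y)\<^sup>2))"
    proof -
      have "gram J v l \<noteq> 0" if "l \<le> m" for l using Suc.prems[of l] that by simp
      from Suc.IH[OF this] show thesis using that by blast
    qed
    have fE: "finite E" using E by (simp add: orthonormal_on_def)
    define \<rho> where "\<rho> = ip J (v m) (v m) - (\<Sum>e\<in>E. (ip J e (v m))\<^sup>2)"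
    have "gram J v (Suc m) = gram J v m * \<rho>" using g[of "v m"] by (simp add: \<rho>_def)
    hence "\<rho> \<noteq> 0" using Suc.prems[of "Suc m"] by auto
    moreover have "\<rho> \<ge> 0" using ip_nonneg[of J "residual J E (v m)"] by (simp add: residual_norm(2)[OF E(1)] \<rho>_def)
    ultimately have \<rho>: "\<rho> > 0" by simp
    define w where "w = (\<lambda>j. (1 / sqrt \<rho>) * residual J E (v m) j)"
    have w: "ip J w w = 1" "\<And>e. e \<in> E \<Longrightarrow> ip J e w = 0"
      using orthonormal_on_normalized_residual[OF E(1), of "v m"] \<rho> by (auto simp: w_def \<rho>_def)
    have ins: "orthonormal_on J (insert w E)" "w \<notin> E" using orthonormal_on_insert[OF E(1)] w by blast+
    have S1: "\<exists>c. \<forall>j\<in>J. e j = (\<Sum>a<Suc m. c a * v a j)" if e: "e \<in> insert w E" for e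
    proof (cases "e = w")
      case False
      then obtain c where "\<forall>j\<in>J. e j = (\<Sum>a<m. c a * v a j)" using s1 e by blast
      thus ?thesis by (intro exI[of _ "c(m := 0)"]) (auto intro!: sum.cong)
    next
      case True
      obtain c where c: "\<And>e j. e \<in> E \<Longrightarrow> j \<in> J \<Longrightarrow> e j = (\<Sum>a<m. c e a * v a j)" using s1 by metis
      define S where "S a = (\<Sum>e\<in>E. ip J e (v m) * c e a)" for a
      define d where "d a = (if a = m then 1 / sqrt \<rho> else - (1 / sqrt \<rho>) * S a)" for a
      have "w j = (\<Sum>a<Suc m. d a * v a j)" if j: "j \<in> J" for j
      proof -
        have "(\<Sum>e\<in>E. ip J e (v m) * e j) = (\<Sum>e\<in>E. ip J e (v m) * (\<Sum>a<m. c e a * v a j))"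
          using c j by (intro sum.cong) auto
        also have "\<dots> = (\<Sum>a<m. S a * v a j)"
          unfolding S_def sum_distrib_left sum_distrib_right by (subst sum.swap) (simp add: mult.assoc)
        finally have "w j = (1 / sqrt \<rho>) * v m j - (1 / sqrt \<rho>) * (\<Sum>a<m. S a * v a j)"
          by (simp add: w_def residual_def right_diff_distrib)
        also have "\<dots> = (\<Sum>a<Suc m. d a * v a j)"
          by (simp add: d_def sum_distrib_left sum_negf)
        finally show ?thesis .
      qed
      thus ?thesis using True by blast
    qed
    have S2: "\<exists>c. \<forall>j\<in>J. v a j = (\<Sum>e\<in>insert w E. c e * e j)" if a: "a < Suc m" for a
    proof (cases "a = m")
      case False
      then obtain c where "\<forall>j\<in>J. v a j = (\<Sum>e\<in>E. c e * e j)" using s2 a less_SucE by blast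
      moreover have "(\<Sum>e\<in>insert w E. (c(w := 0)) e * e j) = (\<Sum>e\<in>E. c e * e j)" for j
        using ins(2) fE by (simp, intro sum.cong) auto
      ultimately show ?thesis by (intro exI[of _ "c(w := 0)"]) simp
    next
      case True
      have "v m j = (\<Sum>e\<in>insert w E. (if e = w then sqrt \<rho> else ip J e (v m)) * e j)" for j
      proof -
        have "(\<Sum>e\<in>insert w E. (if e = w then sqrt \<rho> else ip J e (v m)) * e j) = sqrt \<rho> * w j + (\<Sum>e\<in>E. ip J e (v m) * e j)"
          using ins(2) fE by (simp, intro sum.cong) auto
        also have "sqrt \<rho> * w j = residual J E (v m) j" using \<rho> by (simp add: w_def)
        finally show ?thesis by (simp add: residual_def)
      qed
      thus ?thesis unfolding True
        by (intro exI[of _ "\<lambda>e. if e = w then sqrt \<rho> else ip J e (v m)"] ballI)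
    qed
    show ?case
    proof (intro exI[of _ "insert w E"] conjI)
      show "card (insert w E) = Suc m" using ins(2) fE E(2) by simp
      show "\<forall>y. gram J (v(Suc m := y)) (Suc (Suc m)) = gram J v (Suc m) * (ip J y y - (\<Sum>e\<in>insert w E. (ip J e y)\<^sup>2))"
      proof
        fix y
        show "gram J (v(Suc m := y)) (Suc (Suc m)) = gram J v (Suc m) * (ip J y y - (\<Sum>e\<in>insert w E. (ip J e y)\<^sup>2))"
          by (rule det_id[OF ins(1)]) (rule ballI, erule S1, intro allI impI, erule S2)
      qed
      show "orthonormal_on J (insert w E)" by (rule ins)
      show "\<forall>e\<in>insert w E. \<exists>c. \<forall>j\<in>J. e j = (\<Sum>a<Suc m. c a * v a j)" using S1 by (rule ballI)
      show "\<forall>a<Suc m. \<exists>c. \<forall>j\<in>J. v a j = (\<Sum>e\<in>insert w E. c e * e j)" using S2 by (intro allI impI)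
    qed
  qed
qed

lemma orthonormal_on_subset: "orthonormal_on J E \<Longrightarrow> F \<subseteq> E \<Longrightarrow> orthonormal_on J F"
  unfolding orthonormal_on_def by (meson finite_subset subsetD)

lemma ip_restrict_support:
  assumes "finite I" "J \<subseteq> I" "\<And>j. j \<notin> J \<Longrightarrow> u j = 0"
  shows "ip I u y = ip J u y"
  unfolding ip_def using assms by (intro sum.mono_neutral_right) auto

text \<open>The group complements \<open>U i\<close> are orthogonal to the columns within group \<open>i\<close>, hence, extended by
  zero, also to the pooled columns; so one orthonormal basis serves all the Gram determinants at once.\<close>
lemma gram_column_decomposition:
  fixes Ig :: "nat \<Rightarrow> 'j set"
  assumes fin: "\<And>i. i < k \<Longrightarrow> finite (Ig i)" and disj: "disjoint_family_on Ig {..<k}"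
  defines "I \<equiv> (\<Union>i<k. Ig i)"
  assumes gi: "\<And>i l. i < k \<Longrightarrow> l \<le> m \<Longrightarrow> gram (Ig i) v l \<noteq> 0" and g: "\<And>l. l \<le> m \<Longrightarrow> gram I v l \<noteq> 0"
  shows "\<exists>U K. orthonormal_on I K \<and> (\<forall>i<k. U i \<subseteq> K) \<and> disjoint_family_on U {..<k}
    \<and> (\<forall>i<k. card (U i) = card (Ig i) - m) \<and> card K = card I - m
    \<and> (\<forall>y. gram I (v(m := y)) (Suc m) = gram I v m * (\<Sum>u\<in>K. (ip I u y)\<^sup>2))
    \<and> (\<forall>i<k. \<forall>y. gram (Ig i) (v(m := y)) (Suc m) = gram (Ig i) v m * (\<Sum>u\<in>U i. (ip I u y)\<^sup>2))"
proof -
  have finI: "finite I" using fin by (auto simp: I_def)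
  have sub: "Ig i \<subseteq> I" if "i < k" for i using that by (auto simp: I_def)
  \<comment> \<open>\<open>U\<close> is an orthonormal basis of the complement, within group
    \<open>i\<close>, of the first \<open>m\<close> columns.\<close>
  have "\<exists>U. orthonormal_on (Ig i) U \<and> card U = card (Ig i) - m \<and> (\<forall>u\<in>U. \<forall>j. j \<notin> Ig i \<longrightarrow> u j = 0)
     \<and> (\<forall>u\<in>U. \<forall>a<m. ip (Ig i) (v a) u = 0)
     \<and> (\<forall>y. gram (Ig i) (v(m := y)) (Suc m) = gram (Ig i) v m * (\<Sum>u\<in>U. (ip (Ig i) u y)\<^sup>2))" if i: "i < k" for i
  proof -
    obtain E where E: "orthonormal_on (Ig i) E" "card E = m"
      and s2: "\<forall>a<m. \<exists>c. \<forall>j\<in>Ig i. v a j = (\<Sum>e\<in>E. c e * e j)"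
      and gE: "\<And>y. gram (Ig i) (v(m := y)) (Suc m) = gram (Ig i) v m * (ip (Ig i) y y - (\<Sum>e\<in>E. (ip (Ig i) e y)\<^sup>2))"
      using gram_schmidt[of m "Ig i" v] gi[OF i] by blast
    obtain U where U: "U \<inter> E = {}" "orthonormal_on (Ig i) (E \<union> U)" "card (E \<union> U) = card (Ig i)"
      "\<forall>u\<in>U. \<forall>j. j \<notin> Ig i \<longrightarrow> u j = 0"
      using orthonormal_completion[OF fin[OF i] E(1)] by blast
    have fEU: "finite E" "finite U" using U(2) by (auto simp: orthonormal_on_def)
    have disjEU: "E \<inter> U = {}" using U(1) by blast
    show ?thesis
    proof (intro exI[of _ U] conjI)
      show "orthonormal_on (Ig i) U" by (rule orthonormal_on_subset[OF U(2)]) simp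
      show "card U = card (Ig i) - m" using U(3) E(2) card_Un_disjoint[OF fEU disjEU] by simp
      show "\<forall>u\<in>U. \<forall>a<m. ip (Ig i) (v a) u = 0"
      proof (intro ballI allI impI)
        fix u a assume u: "u \<in> U" and a: "a < m"
        obtain c where "\<forall>j\<in>Ig i. v a j = (\<Sum>e\<in>E. c e * e j)" using s2 a by blast
        hence "ip (Ig i) (v a) u = ip (Ig i) (\<lambda>j. \<Sum>e\<in>E. c e * (\<lambda>e. e) e j) u" by (intro ip_cong) auto
        also have "\<dots> = (\<Sum>e\<in>E. c e * ip (Ig i) e u)" unfolding ip_sum_left ..
        also have "\<dots> = 0"
        proof (rule sum.neutral, rule ballI)
          fix e assume "e \<in> E"
          moreover have "e \<noteq> u" using \<open>e \<in> E\<close> u U(1) by auto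
          ultimately have "ip (Ig i) e u = 0" using U(2) u by (simp add: orthonormal_on_def)
          thus "c e * ip (Ig i) e u = 0" by simp
        qed
        finally show "ip (Ig i) (v a) u = 0" .
      qed
      show "\<forall>y. gram (Ig i) (v(m := y)) (Suc m) = gram (Ig i) v m * (\<Sum>u\<in>U. (ip (Ig i) u y)\<^sup>2)"
      proof
        fix y
        have "ip (Ig i) y y = (\<Sum>e\<in>E. (ip (Ig i) e y)\<^sup>2) + (\<Sum>u\<in>U. (ip (Ig i) u y)\<^sup>2)"
          using parseval[OF fin[OF i] U(2,3), of y] sum.union_disjoint[OF fEU disjEU] by simp
        thus "gram (Ig i) (v(m := y)) (Suc m) = gram (Ig i) v m * (\<Sum>u\<in>U. (ip (Ig i) u y)\<^sup>2)"
          unfolding gE by simp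
      qed
    qed (use U in blast)
  qed
  hence "\<forall>i. \<exists>U. i < k \<longrightarrow> (orthonormal_on (Ig i) U \<and> card U = card (Ig i) - m \<and> (\<forall>u\<in>U. \<forall>j. j \<notin> Ig i \<longrightarrow> u j = 0)
     \<and> (\<forall>u\<in>U. \<forall>a<m. ip (Ig i) (v a) u = 0)
     \<and> (\<forall>y. gram (Ig i) (v(m := y)) (Suc m) = gram (Ig i) v m * (\<Sum>u\<in>U. (ip (Ig i) u y)\<^sup>2)))" by blast
  from choice[OF this] obtain U where U: "\<And>i. i < k \<Longrightarrow> orthonormal_on (Ig i) (U i)"
    "\<And>i. i < k \<Longrightarrow> card (U i) = card (Ig i) - m"
    and supp: "\<And>i u j. i < k \<Longrightarrow> u \<in> U i \<Longrightarrow> j \<notin> Ig i \<Longrightarrow> u j = 0"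
    and Uv: "\<And>i u a. i < k \<Longrightarrow> u \<in> U i \<Longrightarrow> a < m \<Longrightarrow> ip (Ig i) (v a) u = 0"
    and Ug: "\<And>i y. i < k \<Longrightarrow> gram (Ig i) (v(m := y)) (Suc m) = gram (Ig i) v m * (\<Sum>u\<in>U i. (ip (Ig i) u y)\<^sup>2)"
    by blast
  have ipU: "ip I u y = ip (Ig i) u y" if "i < k" "u \<in> U i" for i u y
    using finI sub[OF that(1)] supp[OF that] by (intro ip_restrict_support) auto
  obtain E where E: "orthonormal_on I E" "card E = m"
      and s1: "\<forall>e\<in>E. \<exists>c. \<forall>j\<in>I. e j = (\<Sum>a<m. c a * v a j)"
      and gE: "\<And>y. gram I (v(m := y)) (Suc m) = gram I v m * (ip I y y - (\<Sum>e\<in>E. (ip I e y)\<^sup>2))"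
    using gram_schmidt[of m I v] g by blast
  have cross: "ip I u u' = 0" if "i < k" "i' < k" "i \<noteq> i'" "u \<in> U i" "u' \<in> U i'" for i i' u u'
    unfolding ip_def
  proof (rule sum.neutral, rule ballI)
    fix j
    have "Ig i \<inter> Ig i' = {}" using disj that by (auto simp: disjoint_family_on_def)
    hence "j \<notin> Ig i \<or> j \<notin> Ig i'" by auto
    thus "u j * u' j = 0" using supp[OF that(1,4)] supp[OF that(2,5)] by auto
  qed
  have unit: "ip I u u = 1" if "i < k" "u \<in> U i" for i u
    using U(1)[OF that(1)] that(2) by (simp add: ipU[OF that] orthonormal_on_def)
  have disjU: "disjoint_family_on U {..<k}"
    unfolding disjoint_family_on_def
  proof (intro ballI impI)
    fix i i' assume i: "i \<in> {..<k}" "i' \<in> {..<k}" "i \<noteq> i'"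
    have False if "u \<in> U i" "u \<in> U i'" for u
      using cross[of i i' u u] unit[of i u] i that by simp
    thus "U i \<inter> U i' = {}" by blast
  qed
  define W where "W = (\<Union>i<k. U i)"
  have fW: "finite W" unfolding W_def using U(1) by (auto simp: orthonormal_on_def)
  have Won: "ip I u u' = (if u = u' then 1 else 0)" if uu: "u \<in> W" "u' \<in> W" for u u'
  proof -
    obtain i i' where i: "i < k" "u \<in> U i" "i' < k" "u' \<in> U i'" using uu unfolding W_def by blast
    show ?thesis
    proof (cases "i = i'")
      case True
      thus ?thesis using U(1)[OF i(1)] i ipU[OF i(1,2), of u'] by (simp add: orthonormal_on_def)
    next
      case False
      hence "ip I u u' = 0" using cross i by blast
      moreover have "u \<noteq> u'" using calculation unit[OF i(1,2)] by auto
      ultimately show ?thesis by simp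
    qed
  qed
  have EW: "ip I e u = 0" if e: "e \<in> E" and u: "u \<in> W" for e u
  proof -
    obtain i where i: "i < k" "u \<in> U i" using u by (auto simp: W_def)
    obtain c where "\<forall>j\<in>I. e j = (\<Sum>a<m. c a * v a j)" using s1 e by blast
    hence "ip I e u = ip I (\<lambda>j. \<Sum>a<m. c a * v a j) u" by (intro ip_cong) auto
    also have "\<dots> = (\<Sum>a<m. c a * ip I (v a) u)" by (rule ip_sum_left)
    also have "\<dots> = 0"
    proof (rule sum.neutral, rule ballI)
      fix a assume "a \<in> {..<m}"
      hence "ip (Ig i) (v a) u = 0" using Uv[OF i] by simp
      hence "ip I u (v a) = 0" using ipU[OF i] ip_commute[of "Ig i" "v a" u] by simp
      thus "c a * ip I (v a) u = 0" using ip_commute[of I "v a" u] by simp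
    qed
    finally show ?thesis .
  qed
  have on: "orthonormal_on I (E \<union> W)"
    unfolding orthonormal_on_def
  proof (intro conjI ballI)
    show "finite (E \<union> W)" using fW E(1) by (simp add: orthonormal_on_def)
    fix e f assume "e \<in> E \<union> W" "f \<in> E \<union> W"
    moreover have "e \<noteq> u" if "e \<in> E" "u \<in> W" for e u
      using EW[OF that] Won[OF that(2,2)] by auto
    ultimately show "ip I e f = (if e = f then 1 else 0)"
      using E(1) Won EW EW[of f e] ip_commute[of I e f] by (auto simp: orthonormal_on_def)
  qed
  \<comment> \<open>With \<open>N = card I\<close>, the group complements provide
    \<open>N - k m\<close> directions, whereas the complement of the pooled columns has
    \<open>N - m\<close>. The missing \<open>(k - 1) m\<close> directions, those between the groups,
    are supplied by \<open>U0\<close>.\<close>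
  obtain U0 where U0: "U0 \<inter> (E \<union> W) = {}" "orthonormal_on I ((E \<union> W) \<union> U0)" "card ((E \<union> W) \<union> U0) = card I"
    using orthonormal_completion[OF finI on] by blast
  define K where "K = W \<union> U0"
  have fK: "finite E" "finite K" using U0(2) by (auto simp: orthonormal_on_def K_def)
  have EK: "E \<inter> K = {}" using U0(1) EW Won by (force simp: K_def)
  have EKeq: "E \<union> W \<union> U0 = E \<union> K" by (auto simp: K_def)
  show ?thesis
  proof (intro exI[of _ U] exI[of _ K] conjI allI impI)
    show "orthonormal_on I K" by (rule orthonormal_on_subset[OF U0(2)]) (auto simp: K_def)
    show "U i \<subseteq> K" if "i < k" for i using that by (auto simp: K_def W_def)
    show "disjoint_family_on U {..<k}" by (rule disjU)
    show "card (U i) = card (Ig i) - m" if "i < k" for i by (rule U(2)[OF that])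
    show "card K = card I - m" using U0(3) E(2) card_Un_disjoint[OF fK EK] EKeq by simp
    show "gram I (v(m := y)) (Suc m) = gram I v m * (\<Sum>u\<in>K. (ip I u y)\<^sup>2)" for y
    proof -
      have "ip I y y = (\<Sum>e\<in>E. (ip I e y)\<^sup>2) + (\<Sum>u\<in>K. (ip I u y)\<^sup>2)"
        using parseval[OF finI U0(2,3), of y] sum.union_disjoint[OF fK EK] EKeq by simp
      thus ?thesis unfolding gE by simp
    qed
    show "gram (Ig i) (v(m := y)) (Suc m) = gram (Ig i) v m * (\<Sum>u\<in>U i. (ip I u y)\<^sup>2)" if "i < k" for i y
      using Ug[OF that, of y] ipU[OF that] by simp
  qed
qed

lemma measurable_det_mat:
  assumes "\<And>a b. a < n \<Longrightarrow> b < n \<Longrightarrow> (\<lambda>\<omega>. f \<omega> (a, b)) \<in> borel_measurable M"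
  shows "(\<lambda>\<omega>. det (mat n n (f \<omega>)) :: real) \<in> borel_measurable M"
proof -
  have "det (mat n n (f \<omega>)) = (\<Sum>p\<in>{p. p permutes {0..<n}}. signof p * (\<Prod>i = 0..<n. f \<omega> (i, p i)))" for \<omega>
  proof -
    have "det (mat n n (f \<omega>)) = (\<Sum>p\<in>{p. p permutes {0..<n}}. signof p * (\<Prod>i = 0..<n. mat n n (f \<omega>) $$ (i, p i)))"
      by (rule det_def') simp
    also have "\<dots> = (\<Sum>p\<in>{p. p permutes {0..<n}}. signof p * (\<Prod>i = 0..<n. f \<omega> (i, p i)))"
    proof (intro sum.cong refl arg_cong[where f = "\<lambda>x. _ * x"] prod.cong)
      fix p i assume "p \<in> {p. p permutes {0..<n}}" "i \<in> {0..<n}"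
      hence "p i < n" "i < n" using permutes_in_image[of p "{0..<n}" i] by auto
      thus "mat n n (f \<omega>) $$ (i, p i) = f \<omega> (i, p i)" by simp
    qed
    finally show ?thesis .
  qed
  moreover have "(\<lambda>\<omega>. \<Sum>p\<in>{p. p permutes {0..<n}}. signof p * (\<Prod>i = 0..<n. f \<omega> (i, p i))) \<in> borel_measurable M"
  proof (intro borel_measurable_sum borel_measurable_times borel_measurable_const borel_measurable_prod)
    fix p i assume "p \<in> {p. p permutes {0..<n}}" "i \<in> {0..<n}"
    hence "p i < n" "i < n" using permutes_in_image[of p "{0..<n}" i] by auto
    thus "(\<lambda>\<omega>. f \<omega> (i, p i)) \<in> borel_measurable M" by (intro assms)
  qed
  ultimately show ?thesis by simp
qed

lemma measurable_gram:
  assumes "\<And>a j. a < n \<Longrightarrow> j \<in> J \<Longrightarrow> (\<lambda>\<omega>. v \<omega> a j) \<in> borel_measurable M"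
  shows "(\<lambda>\<omega>. gram J (v \<omega>) n) \<in> borel_measurable M"
  unfolding gram_def by (rule measurable_det_mat) (auto simp: ip_def intro!: borel_measurable_sum borel_measurable_times assms)

text \<open>\<open>v\<close> holds the columns already fixed, and its entry \<open>m\<close> is
  overwritten by a Gaussian vector. The logarithms of the new Gram determinants split into those of
  \<open>v\<close> and a log ratio of sums of squares in rotated coordinates, to which
  \<open>gauss_log_ratio_cf\<close> applies.\<close>

lemma column_cf_integral:
  fixes Ig :: "nat \<Rightarrow> 'j set" and Y :: "'j \<Rightarrow> 'a \<Rightarrow> real" and t :: real
  assumes fin: "\<And>i. i < k \<Longrightarrow> finite (Ig i)" and disj: "disjoint_family_on Ig {..<k}" and k: "k \<ge> 1"
    and ns: "\<And>i. i < k \<Longrightarrow> card (Ig i) = ns i" "\<And>i. i < k \<Longrightarrow> m < ns i"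
  defines "I \<equiv> (\<Union>i<k. Ig i)"
  assumes G: "std_gauss_family M I Y"
    and gi: "\<And>i l. i < k \<Longrightarrow> l \<le> m \<Longrightarrow> gram (Ig i) v l > 0" and g: "\<And>l. l \<le> m \<Longrightarrow> gram I v l > 0"
  defines "vY \<equiv> \<lambda>\<omega>. v(m := (\<lambda>j. Y j \<omega>))"
  defines "S \<equiv> \<lambda>w l. (\<Sum>i<k. t * real (ns i) / 2 * ln (gram (Ig i) w l)) - t * real (ntot k ns) / 2 * ln (gram I w l)"
  shows "AE \<omega> in M. (\<forall>i<k. gram (Ig i) (vY \<omega>) (Suc m) > 0) \<and> gram I (vY \<omega>) (Suc m) > 0"
    and "(CLINT \<omega>|M. iexp (S (vY \<omega>) (Suc m))) = iexp (S v m) * column_cf k ns m t"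
proof -
  interpret M: prob_space M using G by (simp add: std_gauss_family_def)
  have finI: "finite I" using fin by (auto simp: I_def)
  have YM: "Y j \<in> borel_measurable M" if "j \<in> I" for j using G that by (simp add: std_gauss_family_def)
  have cardI: "card I = ntot k ns"
    unfolding I_def ntot_def using fin disj ns(1)
    by (subst card_UN_disjoint) (auto simp: disjoint_family_on_def)
  have gi0: "\<And>i l. i < k \<Longrightarrow> l \<le> m \<Longrightarrow> gram (Ig i) v l \<noteq> 0" and g0: "\<And>l. l \<le> m \<Longrightarrow> gram I v l \<noteq> 0"
    using gi g by (metis less_irrefl)+
  obtain U K where K: "orthonormal_on I K" and UK': "\<forall>i<k. U i \<subseteq> K" and disjU: "disjoint_family_on U {..<k}"
    and cU': "\<forall>i<k. card (U i) = card (Ig i) - m" and cK': "card K = card I - m"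
    and gK': "\<forall>y. gram I (v(m := y)) (Suc m) = gram I v m * (\<Sum>u\<in>K. (ip I u y)\<^sup>2)"
    and gU': "\<forall>i<k. \<forall>y. gram (Ig i) (v(m := y)) (Suc m) = gram (Ig i) v m * (\<Sum>u\<in>U i. (ip I u y)\<^sup>2)"
  proof -
    have "\<exists>U K. orthonormal_on I K \<and> (\<forall>i<k. U i \<subseteq> K) \<and> disjoint_family_on U {..<k}
      \<and> (\<forall>i<k. card (U i) = card (Ig i) - m) \<and> card K = card I - m
      \<and> (\<forall>y. gram I (v(m := y)) (Suc m) = gram I v m * (\<Sum>u\<in>K. (ip I u y)\<^sup>2))
      \<and> (\<forall>i<k. \<forall>y. gram (Ig i) (v(m := y)) (Suc m) = gram (Ig i) v m * (\<Sum>u\<in>U i. (ip I u y)\<^sup>2))"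
      unfolding I_def by (rule gram_column_decomposition) (use fin disj gi0 g0[unfolded I_def] in simp_all)
    thus thesis using that by (elim exE conjE)
  qed
  have UK: "U i \<subseteq> K" if "i < k" for i using UK' that by blast
  have cU: "card (U i) = ns i - m" if "i < k" for i using cU' ns(1) that by simp
  have cK: "card K = ntot k ns - m" using cK' cardI by simp
  have gK: "gram I (v(m := y)) (Suc m) = gram I v m * (\<Sum>u\<in>K. (ip I u y)\<^sup>2)" for y using gK' by blast
  have gU: "gram (Ig i) (v(m := y)) (Suc m) = gram (Ig i) v m * (\<Sum>u\<in>U i. (ip I u y)\<^sup>2)" if "i < k" for i y
    using gU' that by blast
  have fK: "finite K" using K by (simp add: orthonormal_on_def)
  define X where "X u \<omega> = (\<Sum>j\<in>I. u j * Y j \<omega>)" for u \<omega>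
  have GX: "std_gauss_family M K X"
    unfolding X_def[abs_def] using K by (intro std_gauss_family_orthonormal[OF finI fK G]) (auto simp: orthonormal_on_def ip_def)
  have XK: "X u \<in> borel_measurable M" if "u \<in> K" for u using GX that by (simp add: std_gauss_family_def)
  have ipX: "ip I u (\<lambda>j. Y j \<omega>) = X u \<omega>" for u \<omega> by (simp add: ip_def X_def)
  have Une: "U i \<noteq> {}" if "i < k" for i using cU[OF that] ns(2)[OF that] by auto
  have Kne: "K \<noteq> {}" using Une[of 0] UK[of 0] k by auto
  have "AE \<omega> in M. \<forall>i\<in>{..<k}. (\<Sum>u\<in>U i. (X u \<omega>)\<^sup>2) > 0"
    using std_gauss_family_AE_sum_squares_pos[OF GX fK UK Une] by (intro AE_finite_allI) auto
  moreover have "AE \<omega> in M. (\<Sum>u\<in>K. (X u \<omega>)\<^sup>2) > 0"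
    by (rule std_gauss_family_AE_sum_squares_pos[OF GX fK _ Kne]) simp
  ultimately have AEp: "AE \<omega> in M. (\<forall>i<k. (\<Sum>u\<in>U i. (X u \<omega>)\<^sup>2) > 0) \<and> (\<Sum>u\<in>K. (X u \<omega>)\<^sup>2) > 0"
    by eventually_elim auto
  have gvY: "gram I (vY \<omega>) (Suc m) = gram I v m * (\<Sum>u\<in>K. (X u \<omega>)\<^sup>2)" for \<omega>
    unfolding vY_def gK ipX ..
  have givY: "gram (Ig i) (vY \<omega>) (Suc m) = gram (Ig i) v m * (\<Sum>u\<in>U i. (X u \<omega>)\<^sup>2)" if "i < k" for i \<omega>
    unfolding vY_def gU[OF that] ipX ..
  show "AE \<omega> in M. (\<forall>i<k. gram (Ig i) (vY \<omega>) (Suc m) > 0) \<and> gram I (vY \<omega>) (Suc m) > 0"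
    using AEp by eventually_elim (use gi g in \<open>auto simp: gvY givY\<close>)
  define b where "b i = t * real (ns i) / 2" for i
  define \<beta> where "\<beta> = (\<Sum>i<k. b i)"
  have \<beta>: "\<beta> = t * real (ntot k ns) / 2"
    by (simp add: \<beta>_def b_def ntot_def sum_distrib_left sum_divide_distrib)
  define T where "T \<omega> = (\<Sum>i<k. b i * ln (\<Sum>u\<in>U i. (X u \<omega>)\<^sup>2)) - \<beta> * ln (\<Sum>u\<in>K. (X u \<omega>)\<^sup>2)" for \<omega>
  have Tm: "T \<in> borel_measurable M"
    unfolding T_def[abs_def]
    using UK XK by (intro borel_measurable_diff borel_measurable_sum borel_measurable_times borel_measurable_ln borel_measurable_power borel_measurable_const) auto
  have meas1: "(\<lambda>\<omega>. gram J (vY \<omega>) (Suc m)) \<in> borel_measurable M" if "J \<subseteq> I" for J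
  proof (rule measurable_gram)
    fix a j assume "j \<in> J"
    thus "(\<lambda>\<omega>. vY \<omega> a j) \<in> borel_measurable M"
      using that YM[of j] by (cases "a = m") (auto simp: vY_def)
  qed
  have Sm: "(\<lambda>\<omega>. S (vY \<omega>) (Suc m)) \<in> borel_measurable M"
    unfolding S_def by (intro borel_measurable_diff borel_measurable_sum borel_measurable_times borel_measurable_ln meas1 borel_measurable_const) (auto simp: I_def)
  note [measurable] = Tm Sm
  have "(CLINT \<omega>|M. iexp (S (vY \<omega>) (Suc m))) = (CLINT \<omega>|M. iexp (S v m) * iexp (T \<omega>))"
  proof (rule integral_cong_AE)
    show "AE \<omega> in M. iexp (S (vY \<omega>) (Suc m)) = iexp (S v m) * iexp (T \<omega>)"
      using AEp
    proof eventually_elim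
      case (elim \<omega>)
      have "(\<Sum>i<k. b i * ln (gram (Ig i) (vY \<omega>) (Suc m))) = (\<Sum>i<k. b i * ln (gram (Ig i) v m) + b i * ln (\<Sum>u\<in>U i. (X u \<omega>)\<^sup>2))"
        using elim gi0 by (intro sum.cong) (force simp: givY ln_mult distrib_left)+
      moreover have "ln (gram I (vY \<omega>) (Suc m)) = ln (gram I v m) + ln (\<Sum>u\<in>K. (X u \<omega>)\<^sup>2)"
        unfolding gvY using elim g[of m] by (intro ln_mult_pos) auto
      ultimately have "S (vY \<omega>) (Suc m) = S v m + T \<omega>"
        unfolding S_def T_def \<beta> b_def[symmetric] by (simp add: sum.distrib distrib_left)
      thus ?case by (simp add: exp_add[symmetric] distrib_left)
    qed
  qed measurable
  also have "\<dots> = iexp (S v m) * (CLINT \<omega>|M. iexp (T \<omega>))" by (rule integral_mult_right_zero)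
  also have "(CLINT \<omega>|M. iexp (T \<omega>)) = (\<Prod>i<k. Gamma (Complex (real (card (U i)) / 2) (b i)) / Gamma (complex_of_real (real (card (U i)) / 2)))
      * (Gamma (complex_of_real (real (card K) / 2)) / Gamma (Complex (real (card K) / 2) \<beta>))"
    unfolding T_def \<beta>_def by (rule gauss_log_ratio_cf[OF GX fK k UK Une disjU])
  also have "\<dots> = column_cf k ns m t"
    unfolding column_cf_def cK \<beta> b_def using cU by (intro arg_cong2[where f = "(*)"] prod.cong refl) auto
  finally show "(CLINT \<omega>|M. iexp (S (vY \<omega>) (Suc m))) = iexp (S v m) * column_cf k ns m t" .
qed

section \<open>The likelihood ratio statistic\<close>

definition data_columns :: "('j \<times> nat \<Rightarrow> real) \<Rightarrow> nat \<Rightarrow> 'j \<Rightarrow> real" where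
  "data_columns z a j = (case a of 0 \<Rightarrow> 1 | Suc a' \<Rightarrow> z (j, a'))"

lemma data_columns_simps [simp]: "data_columns z 0 j = 1" "data_columns z (Suc a) j = z (j, a)"
  by (simp_all add: data_columns_def)

lemma std_gauss_family_reindex:
  assumes G: "std_gauss_family M J X" and f: "bij_betw f I J"
  shows "std_gauss_family M I (\<lambda>i. X (f i))"
  unfolding std_gauss_family_def
proof (intro conjI ballI allI)
  show "prob_space M" using G by (simp add: std_gauss_family_def)
  show "X (f i) \<in> borel_measurable M" if "i \<in> I" for i
    using G f that by (auto simp: std_gauss_family_def bij_betw_def)
  fix c :: "'c \<Rightarrow> real"
  let ?g = "the_inv_into I f"
  have inj: "inj_on f I" using f by (simp add: bij_betw_def)
  have s1: "(\<Sum>j\<in>J. c (?g j) * X j \<omega>) = (\<Sum>i\<in>I. c i * X (f i) \<omega>)" for \<omega>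
    by (subst sum.reindex_bij_betw[OF f, symmetric]) (simp add: the_inv_into_f_f[OF inj])
  have s2: "(\<Sum>j\<in>J. (c (?g j))\<^sup>2) = (\<Sum>i\<in>I. (c i)\<^sup>2)"
    by (subst sum.reindex_bij_betw[OF f, symmetric]) (simp add: the_inv_into_f_f[OF inj])
  have "\<forall>c. (CLINT \<omega>|M. iexp (\<Sum>j\<in>J. c j * X j \<omega>)) = of_real (exp (- (\<Sum>j\<in>J. (c j)\<^sup>2) / 2))"
    using G unfolding std_gauss_family_def by blast
  from this[rule_format, of "\<lambda>j. c (?g j)"]
  show "(CLINT \<omega>|M. iexp (\<Sum>i\<in>I. c i * X (f i) \<omega>)) = of_real (exp (- (\<Sum>i\<in>I. (c i)\<^sup>2) / 2))"
    unfolding s1 s2 .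
qed

lemma pred_pos_borel: "f \<in> borel_measurable M \<Longrightarrow> Measurable.pred M (\<lambda>x. 0 < (f x :: real))"
  by measurable

text \<open>Induction over the columns, where the newest column is integrated out first with the
  earlier ones held fixed. The integrand is set to 0 off the \<open>good\<close> set, so the formula
  is exact before that set is known to have full measure; this follows afterwards from the formula
  at \<open>t = 0\<close>.\<close>

theorem gram_cf:
  fixes Ig :: "nat \<Rightarrow> 'j set" and t :: real
  assumes fin: "\<And>i. i < k \<Longrightarrow> finite (Ig i)" and disj: "disjoint_family_on Ig {..<k}" and k: "k \<ge> 1"
    and ns: "\<And>i. i < k \<Longrightarrow> card (Ig i) = ns i" "\<And>i. i < k \<Longrightarrow> p < ns i"
  defines "I \<equiv> (\<Union>i<k. Ig i)"
  defines "S \<equiv> \<lambda>w l. (\<Sum>i<k. t * real (ns i) / 2 * ln (gram (Ig i) w l)) - t * real (ntot k ns) / 2 * ln (gram I w l)"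
  defines "good \<equiv> \<lambda>w l. \<forall>m\<le>l. (\<forall>i<k. gram (Ig i) w m > 0) \<and> gram I w m > 0"
  assumes l: "l \<le> p"
  shows "(\<lambda>z. if good (data_columns z) (Suc l) then iexp (S (data_columns z) (Suc l)) else 0) \<in> borel_measurable (std_gauss_PiM (I \<times> {..<l}))"
    and "(CLINT z|std_gauss_PiM (I \<times> {..<l}). (if good (data_columns z) (Suc l) then iexp (S (data_columns z) (Suc l)) else 0))
     = iexp ((\<Sum>i<k. t * real (ns i) / 2 * ln (real (ns i))) - t * real (ntot k ns) / 2 * ln (real (ntot k ns)))
       * (\<Prod>a<l. column_cf k ns (Suc a) t)"
proof -
  interpret std: real_distribution std_normal_distribution by (rule real_dist_normal_dist)
  interpret P: product_sigma_finite "\<lambda>_ :: 'j \<times> nat. std_normal_distribution" by standard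
  have psP: "prob_space (std_gauss_PiM A)" for A :: "('j \<times> nat) set"
    by (intro prob_space_PiM std.prob_space_axioms)
  have finI: "finite I" using fin by (auto simp: I_def)
  have sub: "Ig i \<subseteq> I" if "i < k" for i using that by (auto simp: I_def)
  have cardI: "card I = ntot k ns"
    unfolding I_def ntot_def using fin disj ns(1)
    by (subst card_UN_disjoint) (auto simp: disjoint_family_on_def)
  have nspos: "ns i > 0" if "i < k" for i using ns(2)[OF that] by simp
  have Npos: "ntot k ns > 0"
    using nspos[of 0] k member_le_sum[of 0 "{..<k}" ns] by (simp add: ntot_def)
  have S_cong: "S w l = S w' l" and good_cong: "good w l = good w' l"
    if "\<And>a j. a < l \<Longrightarrow> j \<in> I \<Longrightarrow> w a j = w' a j" for w w' l
  proof -
    have "gram J w m = gram J w' m" if "J \<subseteq> I" "m \<le> l" for J m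
      using that \<open>\<And>a j. a < l \<Longrightarrow> j \<in> I \<Longrightarrow> w a j = w' a j\<close> by (intro gram_cong) auto
    thus "S w l = S w' l" "good w l = good w' l" using sub by (auto simp: S_def good_def intro!: sum.cong)
  qed
  have meas: "(\<lambda>z. if good (data_columns z) (Suc l) then iexp (S (data_columns z) (Suc l)) else 0) \<in> borel_measurable (std_gauss_PiM (I \<times> {..<l}))" for l
  proof -
    have gm: "(\<lambda>z. gram J (data_columns z) m) \<in> borel_measurable (std_gauss_PiM (I \<times> {..<l}))" if "J \<subseteq> I" "m \<le> Suc l" for J m
    proof (rule measurable_gram)
      fix a j assume a: "a < m" "j \<in> J"
      show "(\<lambda>z. data_columns z a j) \<in> borel_measurable (std_gauss_PiM (I \<times> {..<l}))"
      proof (cases a)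
        case (Suc a')
        hence "(j, a') \<in> I \<times> {..<l}" using a that by auto
        from measurable_component_singleton[OF this, of "\<lambda>_. std_normal_distribution"]
        show ?thesis by (simp add: Suc measurable_def)
      qed simp
    qed
    have "Measurable.pred (std_gauss_PiM (I \<times> {..<l})) (\<lambda>z. \<forall>m\<in>{..Suc l}. (\<forall>i\<in>{..<k}. gram (Ig i) (data_columns z) m > 0) \<and> gram I (data_columns z) m > 0)"
      using sub by (intro pred_intros_finite pred_intros_logic pred_pos_borel gm) auto
    hence [measurable]: "Measurable.pred (std_gauss_PiM (I \<times> {..<l})) (\<lambda>z. good (data_columns z) (Suc l))"
      unfolding good_def by (simp only: Ball_def atMost_iff lessThan_iff)
    have [measurable]: "(\<lambda>z. S (data_columns z) (Suc l)) \<in> borel_measurable (std_gauss_PiM (I \<times> {..<l}))"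
      unfolding S_def using sub
      by (intro borel_measurable_diff borel_measurable_sum borel_measurable_times borel_measurable_ln borel_measurable_const gm) auto
    show ?thesis by measurable
  qed
  show "(\<lambda>z. if good (data_columns z) (Suc l) then iexp (S (data_columns z) (Suc l)) else 0) \<in> borel_measurable (std_gauss_PiM (I \<times> {..<l}))"
    by (rule meas)
  show "(CLINT z|std_gauss_PiM (I \<times> {..<l}). (if good (data_columns z) (Suc l) then iexp (S (data_columns z) (Suc l)) else 0))
     = iexp ((\<Sum>i<k. t * real (ns i) / 2 * ln (real (ns i))) - t * real (ntot k ns) / 2 * ln (real (ntot k ns)))
       * (\<Prod>a<l. column_cf k ns (Suc a) t)"
    using l
  proof (induction l)
    \<comment> \<open>With the intercept as the only column, each Gram determinant is the
      cardinality of its row set; this produces the constant factor with \<open>n_i ln n_i\<close>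
      and \<open>n ln n\<close>.\<close>
    case 0
    have g0: "gram J w 0 = 1" for J :: "'j set" and w by (simp add: gram_def)
    have g1: "gram J (data_columns z) (Suc 0) = real (card J)" for J :: "'j set" and z
      by (simp add: gram_def det_single ip_def)
    have "good (data_columns z) (Suc 0)" for z
      using nspos Npos ns(1) by (auto simp: good_def le_Suc_eq g0 g1 cardI)
    moreover have "S (data_columns z) (Suc 0) = (\<Sum>i<k. t * real (ns i) / 2 * ln (real (ns i))) - t * real (ntot k ns) / 2 * ln (real (ntot k ns))" for z
      by (simp add: S_def g1 cardI ns(1))
    ultimately show ?case
      using prob_space.prob_space[OF psP[of "I \<times> {..<0}"]] by simp
  next
    case (Suc l)
    let ?J1 = "I \<times> {..<l}" and ?J2 = "I \<times> {l}"
    define f where "f z = (if good (data_columns z) (Suc (Suc l)) then iexp (S (data_columns z) (Suc (Suc l))) else 0)" for z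
    define h where "h z = (if good (data_columns z) (Suc l) then iexp (S (data_columns z) (Suc l)) else 0)" for z
    have un: "I \<times> {..<Suc l} = ?J1 \<union> ?J2" by auto
    have fin12: "finite ?J1" "finite ?J2" "?J1 \<inter> ?J2 = {}" using finI by auto
    interpret J: prob_space "std_gauss_PiM (I \<times> {..<Suc l})" by (rule psP)
    have fint: "integrable (std_gauss_PiM (I \<times> {..<Suc l})) f"
      using meas[of "Suc l"] unfolding f_def
      by (intro J.integrable_const_bound[where B = 1]) (auto intro!: AE_I2)
    have bij: "bij_betw (\<lambda>j. (j, l)) I ?J2" by (auto simp: bij_betw_def inj_on_def)
    have GY: "std_gauss_family (std_gauss_PiM ?J2) I (\<lambda>j y. y (j, l))"
      using std_gauss_family_reindex[OF std_gauss_family_PiM[OF fin12(2)] bij] .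
    have inner: "(CLINT y|std_gauss_PiM ?J2. f (merge ?J1 ?J2 (x, y))) = h x * column_cf k ns (Suc l) t" for x
    proof -
      define v where "v = data_columns x"
      define vY where "vY y = v(Suc l := (\<lambda>j. y (j, l)))" for y :: "'j \<times> nat \<Rightarrow> real"
      have agree: "data_columns (merge ?J1 ?J2 (x, y)) a j = vY y a j" if "a < Suc (Suc l)" "j \<in> I" for y a j
        using that by (cases a) (auto simp: merge_def vY_def v_def less_Suc_eq)
      have agree': "vY y a j = v a j" if "a < Suc l" for y a j using that by (simp add: vY_def)
      have Sm: "S (data_columns (merge ?J1 ?J2 (x, y))) (Suc (Suc l)) = S (vY y) (Suc (Suc l))" for y
        by (rule S_cong[OF agree])
      have gm: "good (data_columns (merge ?J1 ?J2 (x, y))) (Suc (Suc l)) \<longleftrightarrow>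
        good v (Suc l) \<and> (\<forall>i<k. gram (Ig i) (vY y) (Suc (Suc l)) > 0) \<and> gram I (vY y) (Suc (Suc l)) > 0" for y
      proof -
        have "good (data_columns (merge ?J1 ?J2 (x, y))) (Suc (Suc l)) \<longleftrightarrow> good (vY y) (Suc (Suc l))"
          by (rule good_cong[OF agree])
        also have "\<dots> \<longleftrightarrow> good (vY y) (Suc l) \<and> (\<forall>i<k. gram (Ig i) (vY y) (Suc (Suc l)) > 0) \<and> gram I (vY y) (Suc (Suc l)) > 0"
          unfolding good_def by (auto simp: le_Suc_eq)
        also have "good (vY y) (Suc l) \<longleftrightarrow> good v (Suc l)" by (rule good_cong[OF agree'])
        finally show ?thesis .
      qed
      show ?thesis
      proof (cases "good v (Suc l)")
        case False
        hence "f (merge ?J1 ?J2 (x, y)) = 0" for y using gm[of y] by (simp add: f_def)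
        moreover have "h x = 0" using False by (simp add: h_def v_def)
        ultimately show ?thesis by simp
      next
        case True
        have m: "Suc l < ns i" if "i < k" for i using ns(2)[OF that] Suc.prems by simp
        have gi: "\<And>i m. i < k \<Longrightarrow> m \<le> Suc l \<Longrightarrow> gram (Ig i) v m > 0" and g: "\<And>m. m \<le> Suc l \<Longrightarrow> gram (\<Union>i<k. Ig i) v m > 0"
          using True by (auto simp: good_def I_def)
        note col1 = column_cf_integral(1)[where m = "Suc l" and v = v, OF fin disj k ns(1) m GY[unfolded I_def] gi g, folded I_def]
        note col2 = column_cf_integral(2)[where m = "Suc l" and v = v and t = t, OF fin disj k ns(1) m GY[unfolded I_def] gi g, folded I_def]
        have AE: "AE y in std_gauss_PiM ?J2. (\<forall>i<k. gram (Ig i) (vY y) (Suc (Suc l)) > 0) \<and> gram I (vY y) (Suc (Suc l)) > 0"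
          unfolding vY_def by (rule col1)
        have cf: "(CLINT y|std_gauss_PiM ?J2. iexp (S (vY y) (Suc (Suc l)))) = iexp (S v (Suc l)) * column_cf k ns (Suc l) t"
          unfolding vY_def S_def by (rule col2)
        have "(CLINT y|std_gauss_PiM ?J2. f (merge ?J1 ?J2 (x, y))) = (CLINT y|std_gauss_PiM ?J2. iexp (S (vY y) (Suc (Suc l))))"
        proof (rule integral_cong_AE)
          show "AE y in std_gauss_PiM ?J2. f (merge ?J1 ?J2 (x, y)) = iexp (S (vY y) (Suc (Suc l)))"
            using AE by eventually_elim (simp add: f_def gm Sm True)
          have gmeas: "(\<lambda>y. gram J (vY y) m) \<in> borel_measurable (std_gauss_PiM ?J2)" if "J \<subseteq> I" for J m
          proof (rule measurable_gram)
            fix a j assume "j \<in> J"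
            hence "(j, l) \<in> ?J2" using that by auto
            from measurable_component_singleton[OF this, of "\<lambda>_. std_normal_distribution"]
            show "(\<lambda>y. vY y a j) \<in> borel_measurable (std_gauss_PiM ?J2)"
              by (cases "a = Suc l") (simp_all add: vY_def measurable_def)
          qed
          have Smeas[measurable]: "(\<lambda>y. S (vY y) (Suc (Suc l))) \<in> borel_measurable (std_gauss_PiM ?J2)"
            unfolding S_def using sub
            by (intro borel_measurable_diff borel_measurable_sum borel_measurable_times borel_measurable_ln borel_measurable_const gmeas) auto
          show "(\<lambda>y. iexp (S (vY y) (Suc (Suc l)))) \<in> borel_measurable (std_gauss_PiM ?J2)" by measurable
          define gp where "gp y \<longleftrightarrow> (\<forall>i<k. gram (Ig i) (vY y) (Suc (Suc l)) > 0) \<and> gram I (vY y) (Suc (Suc l)) > 0" for y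
          have "Measurable.pred (std_gauss_PiM ?J2) (\<lambda>y. (\<forall>i\<in>{..<k}. gram (Ig i) (vY y) (Suc (Suc l)) > 0) \<and> gram I (vY y) (Suc (Suc l)) > 0)"
            using sub by (intro pred_intros_finite pred_intros_logic pred_pos_borel gmeas) auto
          hence [measurable]: "Measurable.pred (std_gauss_PiM ?J2) gp"
            by (simp only: gp_def[abs_def] Ball_def lessThan_iff)
          have feq: "f (merge ?J1 ?J2 (x, y)) = (if gp y then iexp (S (vY y) (Suc (Suc l))) else 0)" for y
            by (simp only: f_def gm Sm True simp_thms gp_def)
          show "(\<lambda>y. f (merge ?J1 ?J2 (x, y))) \<in> borel_measurable (std_gauss_PiM ?J2)"
            unfolding feq by measurable
        qed
        also have "\<dots> = h x * column_cf k ns (Suc l) t" unfolding cf using True by (simp only: h_def v_def if_True)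
        finally show ?thesis .
      qed
    qed
    have "(CLINT z|std_gauss_PiM (I \<times> {..<Suc l}). f z) = (CLINT x|std_gauss_PiM ?J1. CLINT y|std_gauss_PiM ?J2. f (merge ?J1 ?J2 (x, y)))"
      unfolding un using fint[unfolded un] fin12 by (intro P.product_integral_fold)
    also have "\<dots> = (CLINT x|std_gauss_PiM ?J1. h x) * column_cf k ns (Suc l) t"
      unfolding inner by (rule integral_mult_left_zero)
    also have "(CLINT x|std_gauss_PiM ?J1. h x) = iexp ((\<Sum>i<k. t * real (ns i) / 2 * ln (real (ns i))) - t * real (ntot k ns) / 2 * ln (real (ntot k ns)))
       * (\<Prod>a<l. column_cf k ns (Suc a) t)"
      unfolding h_def using Suc by simp
    finally show ?case by (simp add: f_def mult.assoc)
  qed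
qed

text \<open>The Gram matrices are congruent via the coefficient matrix. The factor does not depend
  on \<open>J\<close>, so one change of columns acts alike on the groups and on the pooled sample;
  both centring and whitening are of this kind.\<close>

lemma gram_transform:
  assumes w: "\<And>a j. a < n \<Longrightarrow> j \<in> J \<Longrightarrow> w a j = (\<Sum>b<n. L a b * v b j)"
  shows "gram J w n = (det (mat n n (\<lambda>(a, b). L a b)))\<^sup>2 * gram J v n"
proof -
  define A where "A = mat n n (\<lambda>(a, b). L a b)"
  define G where "G = mat n n (\<lambda>(a, b). ip J (v a) (v b))"
  have A: "A \<in> carrier_mat n n" and G: "G \<in> carrier_mat n n" by (auto simp: A_def G_def)
  have "mat n n (\<lambda>(a, b). ip J (w a) (w b)) = A * (G * transpose_mat A)"
  proof (rule eq_matI)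
    fix a b assume "a < dim_row (A * (G * transpose_mat A))" "b < dim_col (A * (G * transpose_mat A))"
    hence a: "a < n" and b: "b < n" by (auto simp: A_def)
    have "(A * (G * transpose_mat A)) $$ (a, b) = (\<Sum>c<n. L a c * (\<Sum>d<n. ip J (v c) (v d) * L b d))"
      using a b by (simp add: A_def G_def scalar_prod_def lessThan_atLeast0)
    also have "\<dots> = (\<Sum>c<n. L a c * ip J (v c) (w b))"
    proof (intro sum.cong refl arg_cong[where f = "\<lambda>x. _ * x"])
      fix c
      have "ip J (w b) (v c) = ip J (\<lambda>j. \<Sum>d<n. L b d * v d j) (v c)" by (intro ip_cong w b) auto
      also have "\<dots> = (\<Sum>d<n. L b d * ip J (v d) (v c))" by (rule ip_sum_left)
      finally show "(\<Sum>d<n. ip J (v c) (v d) * L b d) = ip J (v c) (w b)"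
        by (simp add: ip_commute[of J "v c"] mult.commute)
    qed
    also have "\<dots> = ip J (\<lambda>j. \<Sum>c<n. L a c * v c j) (w b)" by (rule ip_sum_left[symmetric])
    also have "\<dots> = ip J (w a) (w b)" using w[OF a] by (intro ip_cong) auto
    finally show "mat n n (\<lambda>(a, b). ip J (w a) (w b)) $$ (a, b) = (A * (G * transpose_mat A)) $$ (a, b)"
      using a b by simp
  qed (auto simp: A_def)
  hence "gram J w n = det (A * (G * transpose_mat A))" by (simp add: gram_def)
  also have "\<dots> = det A * (det G * det (transpose_mat A))"
    using A G by (simp add: det_mult[of _ n])
  also have "det (transpose_mat A) = det A" by (rule det_transpose[OF A])
  finally show ?thesis by (simp add: gram_def A_def G_def power2_eq_square mult_ac)
qed

lemma det_first_row_unit: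
  fixes A :: "real mat"
  assumes A: "A \<in> carrier_mat (Suc n) (Suc n)" and z: "\<And>b. b < n \<Longrightarrow> A $$ (0, Suc b) = 0"
  shows "det A = A $$ (0, 0) * det (mat n n (\<lambda>(a, b). A $$ (Suc a, Suc b)))"
proof -
  have "det A = (\<Sum>j<Suc n. A $$ (0, j) * cofactor A 0 j)" by (rule laplace_expansion_row[OF A]) simp
  also have "\<dots> = A $$ (0, 0) * cofactor A 0 0 + (\<Sum>j<n. A $$ (0, Suc j) * cofactor A 0 (Suc j))"
    by (rule sum.lessThan_Suc_shift)
  also have "(\<Sum>j<n. A $$ (0, Suc j) * cofactor A 0 (Suc j)) = 0" using z by simp
  also have "cofactor A 0 0 = det (mat n n (\<lambda>(a, b). A $$ (Suc a, Suc b)))"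
  proof -
    have "mat_delete A 0 0 = mat n n (\<lambda>(a, b). A $$ (Suc a, Suc b))"
      using A by (intro eq_matI) (auto simp: mat_delete_def)
    thus ?thesis by (simp add: cofactor_def)
  qed
  finally show ?thesis by simp
qed

section \<open>Scatter matrices as Gram determinants\<close>

definition mean_on :: "'j set \<Rightarrow> ('j \<Rightarrow> real) \<Rightarrow> real" where
  "mean_on J u = (\<Sum>j\<in>J. u j) / real (card J)"

text \<open>Centring subtracts multiples of the intercept, a unit triangular change of columns that
  preserves the Gram determinant. The centred columns are orthogonal to the intercept, whose squared
  length \<open>card J\<close> therefore splits off.\<close>

lemma gram_eq_card_mult_det_scatter:
  assumes J: "finite J" "J \<noteq> {}"
  shows "gram J (data_columns z) (Suc p) = real (card J) *
    det (mat p p (\<lambda>(a, b). \<Sum>j\<in>J. (z (j, a) - mean_on J (\<lambda>j. z (j, a))) * (z (j, b) - mean_on J (\<lambda>j. z (j, b)))))"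
proof -
  define m where "m a = mean_on J (\<lambda>j. z (j, a))" for a
  define w where "w a j = (case a of 0 \<Rightarrow> 1 | Suc a' \<Rightarrow> z (j, a') - m a')" for a j
  define L where "L a b = (if a = b then 1 else if b = 0 then - m (a - 1) else 0)" for a b :: nat
  have c: "real (card J) > 0" using J by (simp add: card_gt_0_iff)
  have "w a j = (\<Sum>b<Suc p. L a b * data_columns z b j)" if "a < Suc p" for a j
  proof -
    have "(\<Sum>b<Suc p. L a b * data_columns z b j) = L a 0 + (\<Sum>b<p. L a (Suc b) * z (j, b))"
      by (subst sum.lessThan_Suc_shift) simp
    also have "\<dots> = w a j"
    proof (cases a)
      case (Suc a')
      have "(\<Sum>b<p. L a (Suc b) * z (j, b)) = (\<Sum>b<p. if b = a' then z (j, b) else 0)"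
        by (intro sum.cong) (auto simp: L_def Suc)
      thus ?thesis using that Suc by (simp add: L_def w_def)
    qed (simp add: L_def w_def)
    finally show ?thesis by simp
  qed
  hence "gram J w (Suc p) = (det (mat (Suc p) (Suc p) (\<lambda>(a, b). L a b)))\<^sup>2 * gram J (data_columns z) (Suc p)"
    by (intro gram_transform)
  moreover have "det (mat (Suc p) (Suc p) (\<lambda>(a, b). L a b)) = 1"
  proof -
    have "det (mat (Suc p) (Suc p) (\<lambda>(a, b). L a b)) = prod_list (diag_mat (mat (Suc p) (Suc p) (\<lambda>(a, b). L a b)))"
      by (rule det_lower_triangular[of "Suc p"]) (auto simp: L_def)
    also have "diag_mat (mat (Suc p) (Suc p) (\<lambda>(a, b). L a b)) = map (\<lambda>_. 1) [0..<Suc p]"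
      unfolding diag_mat_def by (intro map_cong) (auto simp: L_def)
    also have "prod_list \<dots> = (1::real)" by (induction p) auto
    finally show ?thesis .
  qed
  ultimately have "gram J (data_columns z) (Suc p) = gram J w (Suc p)" by simp
  also have "\<dots> = real (card J) * det (mat p p (\<lambda>(a, b). ip J (w (Suc a)) (w (Suc b))))"
  proof -
    have "ip J (w 0) (w (Suc b)) = 0" for b
    proof -
      have "ip J (w 0) (w (Suc b)) = (\<Sum>j\<in>J. z (j, b)) - real (card J) * m b"
        by (simp add: ip_def w_def sum_subtractf)
      also have "\<dots> = 0" using c by (simp add: m_def mean_on_def)
      finally show ?thesis .
    qed
    moreover have "ip J (w 0) (w 0) = real (card J)" by (simp add: ip_def w_def)
    ultimately have "gram J w (Suc p) = real (card J) *
       det (mat p p (\<lambda>(a, b). mat (Suc p) (Suc p) (\<lambda>(a, b). ip J (w a) (w b)) $$ (Suc a, Suc b)))"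
      unfolding gram_def by (subst det_first_row_unit[of _ p]) auto
    also have "mat p p (\<lambda>(a, b). mat (Suc p) (Suc p) (\<lambda>(a, b). ip J (w a) (w b)) $$ (Suc a, Suc b)) = mat p p (\<lambda>(a, b). ip J (w (Suc a)) (w (Suc b)))"
      by (rule cong_mat) auto
    finally show ?thesis .
  qed
  finally show ?thesis by (simp add: ip_def w_def m_def)
qed

definition group_rows :: "(nat \<Rightarrow> nat) \<Rightarrow> nat \<Rightarrow> (nat \<times> nat) set" where
  "group_rows ns i = {i} \<times> {..<ns i}"

lemma sum_group_rows: "(\<Sum>x\<in>group_rows ns i. f x) = (\<Sum>j<ns i. f (i, j))"
  unfolding group_rows_def by (subst sum.reindex_bij_betw[of "\<lambda>j. (i, j)" "{..<ns i}", symmetric]) (auto simp: bij_betw_def inj_on_def)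

lemma card_group_rows [simp]: "card (group_rows ns i) = ns i"
  by (simp add: group_rows_def)

lemma finite_group_rows [simp]: "finite (group_rows ns i)"
  by (simp add: group_rows_def)

lemma disjoint_group_rows: "disjoint_family_on (group_rows ns) A"
  by (auto simp: disjoint_family_on_def group_rows_def)

definition all_rows :: "nat \<Rightarrow> (nat \<Rightarrow> nat) \<Rightarrow> (nat \<times> nat) set" where
  "all_rows k ns = (\<Union>i<k. group_rows ns i)"

lemma finite_all_rows [simp]: "finite (all_rows k ns)"
  by (simp add: all_rows_def)

lemma sum_all_rows: "(\<Sum>x\<in>all_rows k ns. f x) = (\<Sum>i<k. \<Sum>j<ns i. f (i, j))"
  unfolding all_rows_def sum_group_rows[symmetric] using disjoint_group_rows[of ns "{..<k}"]
  by (intro sum.UNION_disjoint) (auto simp: disjoint_family_on_def)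

lemma card_all_rows [simp]: "card (all_rows k ns) = ntot k ns"
  using sum_all_rows[of "\<lambda>_. 1 :: nat" k ns] by (simp add: ntot_def)

text \<open>The sample as one function of row and coordinate, the shape of a point in the Gaussian
  product space.\<close>

definition data_vec :: "(nat \<Rightarrow> nat \<Rightarrow> nat \<Rightarrow> real) \<Rightarrow> (nat \<times> nat) \<times> nat \<Rightarrow> real" where
  "data_vec y x = y (fst (fst x)) (snd (fst x)) (snd x)"

lemma det_Bmat_i:
  assumes "ns i > 0"
  shows "gram (group_rows ns i) (data_columns (data_vec y)) (Suc p) = real (ns i) * det (Bmat_i p y ns i)"
proof -
  have m: "mean_on (group_rows ns i) (\<lambda>j. data_vec y (j, a)) = ybar_i y ns i a" for a
    by (simp add: mean_on_def sum_group_rows data_vec_def ybar_i_def)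
  have ne: "group_rows ns i \<noteq> {}" using assms by (auto simp: group_rows_def)
  show ?thesis
    unfolding gram_eq_card_mult_det_scatter[OF finite_group_rows ne] m
    by (simp add: Bmat_i_def sum_group_rows data_vec_def)
qed

text \<open>The cross terms vanish because deviations from the mean sum to 0.\<close>

lemma sum_centered_product:
  fixes u w :: "nat \<Rightarrow> real"
  assumes "n > 0" and "U = (\<Sum>j<n. u j) / real n" and "W = (\<Sum>j<n. w j) / real n"
  shows "(\<Sum>j<n. (u j - c) * (w j - d)) = (\<Sum>j<n. (u j - U) * (w j - W)) + real n * (U - c) * (W - d)"
proof -
  have U: "(\<Sum>j<n. u j - U) = 0" and W: "(\<Sum>j<n. w j - W) = 0" using assms by (auto simp: sum_subtractf)
  have "(\<Sum>j<n. (u j - c) * (w j - d)) = (\<Sum>j<n. (u j - U) * (w j - W) + (u j - U) * (W - d) + (U - c) * (w j - W) + (U - c) * (W - d))"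
    by (intro sum.cong) (auto simp: algebra_simps)
  also have "\<dots> = (\<Sum>j<n. (u j - U) * (w j - W)) + (\<Sum>j<n. u j - U) * (W - d) + (U - c) * (\<Sum>j<n. w j - W) + real n * ((U - c) * (W - d))"
    by (simp only: sum.distrib sum_distrib_left sum_distrib_right) simp
  finally show ?thesis using U W by simp
qed

text \<open>Between plus within scatter is the total scatter about the grand mean, so that
  \<open>gram_eq_card_mult_det_scatter\<close> covers the denominator of \<open>Lambda\<close> as
  well.\<close>

lemma Amat_plus_Bmat:
  assumes ns: "\<And>i. i < k \<Longrightarrow> ns i > 0"
  shows "Amat p k y ns + Bmat p k y ns = mat p p (\<lambda>(a, b). \<Sum>x\<in>all_rows k ns. (data_vec y (x, a) - ybar k y ns a) * (data_vec y (x, b) - ybar k y ns b))"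
proof (rule eq_matI)
  fix a b assume "a < dim_row (mat p p (\<lambda>(a, b). \<Sum>x\<in>all_rows k ns. (data_vec y (x, a) - ybar k y ns a) * (data_vec y (x, b) - ybar k y ns b)))"
    "b < dim_col (mat p p (\<lambda>(a, b). \<Sum>x\<in>all_rows k ns. (data_vec y (x, a) - ybar k y ns a) * (data_vec y (x, b) - ybar k y ns b)))"
  hence ab: "a < p" "b < p" by auto
  have "(\<Sum>i<k. \<Sum>j<ns i. (y i j a - ybar k y ns a) * (y i j b - ybar k y ns b))
    = (\<Sum>i<k. (\<Sum>j<ns i. (y i j a - ybar_i y ns i a) * (y i j b - ybar_i y ns i b))
         + real (ns i) * (ybar_i y ns i a - ybar k y ns a) * (ybar_i y ns i b - ybar k y ns b))"
    using ns by (intro sum.cong sum_centered_product) (auto simp: ybar_i_def)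
  thus "(Amat p k y ns + Bmat p k y ns) $$ (a, b) = mat p p (\<lambda>(a, b). \<Sum>x\<in>all_rows k ns. (data_vec y (x, a) - ybar k y ns a) * (data_vec y (x, b) - ybar k y ns b)) $$ (a, b)"
    using ab by (simp add: Amat_def Bmat_def Bmat_i_def sum_all_rows data_vec_def sum.distrib)
qed (auto simp: Amat_def Bmat_def)

lemma det_Amat_plus_Bmat:
  assumes k: "k \<ge> 1" and ns: "\<And>i. i < k \<Longrightarrow> ns i > 0"
  shows "gram (all_rows k ns) (data_columns (data_vec y)) (Suc p) = real (ntot k ns) * det (Amat p k y ns + Bmat p k y ns)"
proof -
  have "(\<Sum>i<k. real (ns i) * ybar_i y ns i a) = (\<Sum>i<k. \<Sum>j<ns i. y i j a)" for a
    using ns by (intro sum.cong) (auto simp: ybar_i_def)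
  hence m: "mean_on (all_rows k ns) (\<lambda>j. data_vec y (j, a)) = ybar k y ns a" for a
    by (simp add: mean_on_def sum_all_rows data_vec_def ybar_def)
  have ne: "all_rows k ns \<noteq> {}"
    using ns[of 0] k by (auto simp: all_rows_def group_rows_def intro!: bexI[of _ 0])
  have AB: "Amat p k y ns + Bmat p k y ns = mat p p (\<lambda>(a, b). \<Sum>x\<in>all_rows k ns. (data_vec y (x, a) - ybar k y ns a) * (data_vec y (x, b) - ybar k y ns b))"
    by (rule Amat_plus_Bmat) (rule ns)
  show ?thesis
    unfolding gram_eq_card_mult_det_scatter[OF finite_all_rows ne] m AB by simp
qed

section \<open>Whitening the sample\<close>

lemma pos_def_whitening:
  assumes "pos_def_mat p S"
  shows "\<exists>L. \<forall>l<p. \<forall>m<p. (\<Sum>a<p. \<Sum>b<p. L l a * S a b * L m b) = (if l = m then 1 else (0::real))"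
proof -
  define B where "B u w = (\<Sum>a<p. \<Sum>b<p. u a * S a b * w b)" for u w :: "nat \<Rightarrow> real"
  have sym: "B u w = B w u" for u w
    unfolding B_def using assms by (subst sum.swap) (auto simp: pos_def_mat_def mult_ac intro!: sum.cong)
  have pos: "B u u > 0" if "\<exists>l<p. u l \<noteq> 0" for u using assms that by (simp add: B_def pos_def_mat_def)
  have diff: "B (\<lambda>a. u a - v a) w = B u w - B v w" for u v w
    by (simp add: B_def left_diff_distrib sum_subtractf)
  have scale: "B (\<lambda>a. c * u a) w = c * B u w" for c u w
    by (simp add: B_def sum_distrib_left mult.assoc)
  have lin: "B (\<lambda>a. \<Sum>i<r. c i * v i a) w = (\<Sum>i<r. c i * B (v i) w)" for c :: "nat \<Rightarrow> real" and v w and r :: nat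
  proof (induction r)
    case (Suc r)
    have "B (\<lambda>a. \<Sum>i<Suc r. c i * v i a) w = B (\<lambda>a. \<Sum>i<r. c i * v i a) w + B (\<lambda>a. c r * v r a) w"
      by (simp add: B_def distrib_right sum.distrib)
    thus ?case using Suc by (simp add: scale)
  qed (simp add: B_def)
  \<comment> \<open>Gram-Schmidt for the scalar product given by \<open>S\<close>, started from the
    unit vectors. Triangularity makes the coordinate \<open>r\<close> of the new vector equal to 1,
    so the vector is nonzero and can be normalised.\<close>
  have "r \<le> p \<Longrightarrow> \<exists>L. (\<forall>l<r. \<forall>m<r. B (L l) (L m) = (if l = m then 1 else 0)) \<and> (\<forall>l<r. \<forall>a. l < a \<longrightarrow> L l a = 0)" for r
  proof (induction r)
    case (Suc r)
    then obtain L where L': "\<forall>l<r. \<forall>m<r. B (L l) (L m) = (if l = m then 1 else 0)"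
      and tri': "\<forall>l<r. \<forall>a. l < a \<longrightarrow> L l a = 0" by auto
    have L: "B (L l) (L m) = (if l = m then 1 else 0)" if "l < r" "m < r" for l m using L' that by blast
    have tri: "L l a = 0" if "l < r" "l < a" for l a using tri' that by blast
    define e where "e = (\<lambda>a. if a = r then 1 else (0::real))"
    define w where "w = (\<lambda>a. e a - (\<Sum>l<r. B e (L l) * L l a))"
    have "w r = 1" using tri by (simp add: w_def e_def)
    hence wpos: "B w w > 0" using Suc.prems by (intro pos exI[of _ r]) auto
    have orth: "B w (L m) = 0" if "m < r" for m
    proof -
      have "B w (L m) = B e (L m) - (\<Sum>l<r. B e (L l) * B (L l) (L m))" unfolding w_def diff lin ..
      also have "(\<Sum>l<r. B e (L l) * B (L l) (L m)) = (\<Sum>l<r. if l = m then B e (L l) else 0)"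
        using L that by (intro sum.cong) auto
      finally show ?thesis using that by simp
    qed
    define u where "u = (\<lambda>a. (1 / sqrt (B w w)) * w a)"
    have uu: "B u u = 1"
      unfolding u_def scale by (subst sym, unfold scale) (use wpos in simp)
    have uL: "B u (L m) = 0" if "m < r" for m unfolding u_def scale using orth[OF that] by simp
    have Lu: "B (L m) u = 0" if "m < r" for m using uL[OF that] sym[of u "L m"] by simp
    have ut: "u a = 0" if "r < a" for a
      using that tri by (simp add: u_def w_def e_def)
    show ?case
    proof (intro exI[of _ "L(r := u)"] conjI allI impI)
      fix l m assume "l < Suc r" "m < Suc r"
      thus "B ((L(r := u)) l) ((L(r := u)) m) = (if l = m then 1 else 0)"
        using L uu uL Lu by (auto simp: less_Suc_eq)
    next
      fix l a assume "l < Suc r" "l < a"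
      thus "(L(r := u)) l a = 0" using tri ut by (auto simp: less_Suc_eq)
    qed
  qed simp
  from this[OF order.refl] show ?thesis unfolding B_def by blast
qed

lemma cf_of_normal_distributed:
  assumes "prob_space M" and \<sigma>: "\<sigma> > 0" and X: "distributed M lborel X (normal_density \<mu> \<sigma>)"
  shows "(CLINT \<omega>|M. iexp (X \<omega> - \<mu>)) = of_real (exp (- \<sigma>\<^sup>2 / 2))"
proof -
  interpret prob_space M by fact
  have D: "distributed M lborel (\<lambda>\<omega>. (X \<omega> - \<mu>) / \<sigma>) std_normal_density"
    using X by (rule normal_standard_normal_convert[OF \<sigma>, THEN iffD1])
  have "distr M borel (\<lambda>\<omega>. (X \<omega> - \<mu>) / \<sigma>) = distr M lborel (\<lambda>\<omega>. (X \<omega> - \<mu>) / \<sigma>)" by (intro distr_cong) auto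
  also have "\<dots> = std_normal_distribution" using distributed_distr_eq_density[OF D] by simp
  finally have E: "distr M borel (\<lambda>\<omega>. (X \<omega> - \<mu>) / \<sigma>) = std_normal_distribution" .
  have m: "(\<lambda>\<omega>. (X \<omega> - \<mu>) / \<sigma>) \<in> borel_measurable M" using distributed_measurable[OF D] by simp
  have "(CLINT \<omega>|M. iexp (X \<omega> - \<mu>)) = (CLINT \<omega>|M. iexp (\<sigma> * ((X \<omega> - \<mu>) / \<sigma>)))" using \<sigma> by simp
  also have "\<dots> = char (distr M borel (\<lambda>\<omega>. (X \<omega> - \<mu>) / \<sigma>)) \<sigma>"
    unfolding char_def using m by (subst integral_distr) auto
  also have "\<dots> = of_real (exp (- \<sigma>\<^sup>2 / 2))" unfolding E by (simp add: char_std_normal_distribution)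
  finally show ?thesis .
qed

lemma mvn_component_measurable:
  assumes "mvn M p X mu S" "l < p"
  shows "(\<lambda>\<omega>. X \<omega> l) \<in> borel_measurable M"
proof -
  have "X \<in> measurable M (PiM {..<p} (\<lambda>_. borel))" using assms(1) by (simp add: mvn_def)
  moreover have "l \<in> {..<p}" using assms(2) by simp
  ultimately show ?thesis by (rule measurable_compose[OF _ measurable_component_singleton])
qed

text \<open>A combination of whitened coordinates is a linear combination of the centred
  \<open>X m\<close> with coefficients \<open>a\<close>; by the choice of \<open>L\<close> its
  variance is the sum of the squares of \<open>c\<close>.\<close>

lemma mvn_whitened_cf:
  fixes c :: "nat \<Rightarrow> real"
  assumes "prob_space M" and X: "mvn M p X mu S"
    and L: "\<And>l m. l < p \<Longrightarrow> m < p \<Longrightarrow> (\<Sum>a<p. \<Sum>b<p. L l a * S a b * L m b) = (if l = m then 1 else (0::real))"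
  shows "(CLINT \<omega>|M. iexp (\<Sum>l<p. c l * (\<Sum>m<p. L l m * (X \<omega> m - mu m)))) = of_real (exp (- (\<Sum>l<p. (c l)\<^sup>2) / 2))"
proof -
  interpret prob_space M by fact
  define a where "a m = (\<Sum>l<p. c l * L l m)" for m
  have lin: "(\<Sum>l<p. c l * (\<Sum>m<p. L l m * (X \<omega> m - mu m))) = (\<Sum>m<p. a m * X \<omega> m) - (\<Sum>m<p. a m * mu m)" for \<omega>
  proof -
    have "(\<Sum>l<p. c l * (\<Sum>m<p. L l m * (X \<omega> m - mu m))) = (\<Sum>m<p. a m * (X \<omega> m - mu m))"
      unfolding a_def sum_distrib_left sum_distrib_right by (subst sum.swap) (simp add: mult.assoc)
    thus ?thesis by (simp add: right_diff_distrib sum_subtractf)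
  qed
  have quad: "(\<Sum>i<p. \<Sum>j<p. a i * S i j * a j) = (\<Sum>l<p. (c l)\<^sup>2)"
  proof -
    have "(\<Sum>i<p. \<Sum>j<p. a i * S i j * a j) = (\<Sum>i<p. \<Sum>j<p. \<Sum>l<p. \<Sum>m<p. c l * c m * (L l i * S i j * L m j))"
    proof (intro sum.cong refl)
      fix i j
      have "a i * S i j * a j = S i j * (a i * a j)" by simp
      also have "a i * a j = (\<Sum>l<p. \<Sum>m<p. (c l * L l i) * (c m * L m j))" unfolding a_def by (rule sum_product)
      finally show "a i * S i j * a j = (\<Sum>l<p. \<Sum>m<p. c l * c m * (L l i * S i j * L m j))"
        by (simp add: sum_distrib_left mult_ac)
    qed
    also have "\<dots> = (\<Sum>l<p. \<Sum>m<p. c l * c m * (\<Sum>i<p. \<Sum>j<p. L l i * S i j * L m j))"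
    proof -
      define F where "F i j l m = c l * c m * (L l i * S i j * L m j)" for i j l m
      have "(\<Sum>i<p. \<Sum>j<p. \<Sum>l<p. \<Sum>m<p. F i j l m) = (\<Sum>i<p. \<Sum>l<p. \<Sum>j<p. \<Sum>m<p. F i j l m)"
        by (rule sum.cong[OF refl], rule sum.swap)
      also have "\<dots> = (\<Sum>l<p. \<Sum>i<p. \<Sum>j<p. \<Sum>m<p. F i j l m)" by (rule sum.swap)
      also have "\<dots> = (\<Sum>l<p. \<Sum>i<p. \<Sum>m<p. \<Sum>j<p. F i j l m)"
        by (rule sum.cong[OF refl], rule sum.cong[OF refl], rule sum.swap)
      also have "\<dots> = (\<Sum>l<p. \<Sum>m<p. \<Sum>i<p. \<Sum>j<p. F i j l m)"
        by (rule sum.cong[OF refl], rule sum.swap)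
      finally show ?thesis unfolding F_def by (simp only: sum_distrib_left)
    qed
    also have "\<dots> = (\<Sum>l<p. \<Sum>m<p. if m = l then c l * c m else 0)"
      using L by (intro sum.cong refl) auto
    also have "\<dots> = (\<Sum>l<p. (c l)\<^sup>2)" by (simp add: power2_eq_square)
    finally show ?thesis .
  qed
  show ?thesis
  \<comment> \<open>\<open>mvn\<close> speaks of nonzero coefficient vectors only. For
    \<open>a = 0\<close> the quadratic form makes the sum of squares 0, and both sides equal
    1.\<close>
  proof (cases "\<exists>m<p. a m \<noteq> 0")
    case True
    have sq: "(\<Sum>l<p. (c l)\<^sup>2) > 0"
    proof (rule ccontr)
      assume "\<not> ?thesis"
      hence "(\<Sum>l<p. (c l)\<^sup>2) = 0" by (smt (verit) sum_nonneg zero_le_power2)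
      hence "\<forall>l<p. c l = 0" by (auto simp: sum_nonneg_eq_0_iff)
      thus False using True by (auto simp: a_def)
    qed
    have "distributed M lborel (\<lambda>\<omega>. \<Sum>l<p. a l * X \<omega> l) (normal_density (\<Sum>l<p. a l * mu l) (sqrt (\<Sum>l<p. (c l)\<^sup>2)))"
      using X True unfolding mvn_def quad[symmetric] by blast
    from cf_of_normal_distributed[OF assms(1) _ this] show ?thesis unfolding lin using sq by simp
  next
    case False
    hence "(\<Sum>l<p. (c l)\<^sup>2) = 0" unfolding quad[symmetric] by simp
    moreover have "(\<Sum>m<p. a m * X \<omega> m) - (\<Sum>m<p. a m * mu m) = 0" for \<omega> using False by simp
    ultimately show ?thesis unfolding lin by (simp add: prob_space)
  qed
qed

text \<open>Independence of the rows factorises the characteristic function, and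
  \<open>mvn_whitened_cf\<close> evaluates each factor.\<close>

lemma whitened_sample_std_gauss:
  fixes Y :: "nat \<Rightarrow> nat \<Rightarrow> 'a \<Rightarrow> nat \<Rightarrow> real"
  assumes "prob_space M"
    and ind: "prob_space.indep_vars M (\<lambda>_. PiM {..<p} (\<lambda>_. borel)) (\<lambda>(i, j). Y i j) (all_rows k ns)"
    and ne: "all_rows k ns \<noteq> {}"
    and mvn: "\<And>i j. (i, j) \<in> all_rows k ns \<Longrightarrow> mvn M p (Y i j) (mu i) (S i)"
    and L: "\<And>i l m. i < k \<Longrightarrow> l < p \<Longrightarrow> m < p \<Longrightarrow> (\<Sum>a<p. \<Sum>b<p. L l a * S i a b * L m b) = (if l = m then 1 else (0::real))"
  shows "std_gauss_family M (all_rows k ns \<times> {..<p}) (\<lambda>(x, l) \<omega>. \<Sum>m<p. L l m * (Y (fst x) (snd x) \<omega> m - mu (fst x) m))"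
proof -
  interpret prob_space M by fact
  let ?I = "all_rows k ns"
  define Z where "Z x l \<omega> = (\<Sum>m<p. L l m * (Y (fst x) (snd x) \<omega> m - mu (fst x) m))" for x l \<omega>
  have ik: "fst x < k" if "x \<in> ?I" for x using that by (auto simp: all_rows_def group_rows_def)
  have mvnx: "mvn M p (Y (fst x) (snd x)) (mu (fst x)) (S (fst x))" if "x \<in> ?I" for x using mvn[of "fst x" "snd x"] that by simp
  have Zm: "Z x l \<in> borel_measurable M" if "x \<in> ?I" for x l
    unfolding Z_def[abs_def]
    using mvn_component_measurable[OF mvnx[OF that]] by (intro borel_measurable_sum borel_measurable_times borel_measurable_diff) auto
  have cf: "(CLINT \<omega>|M. iexp (\<Sum>y\<in>?I \<times> {..<p}. c y * Z (fst y) (snd y) \<omega>)) = of_real (exp (- (\<Sum>y\<in>?I \<times> {..<p}. (c y)\<^sup>2) / 2))" for c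
  proof -
    have sp: "(\<Sum>y\<in>?I \<times> {..<p}. f y) = (\<Sum>x\<in>?I. \<Sum>l<p. f (x, l))" for f :: "(nat \<times> nat) \<times> nat \<Rightarrow> real"
      by (simp add: sum.cartesian_product)
    have "(CLINT \<omega>|M. iexp (\<Sum>y\<in>?I \<times> {..<p}. c y * Z (fst y) (snd y) \<omega>)) = (CLINT \<omega>|M. \<Prod>x\<in>?I. iexp (\<Sum>l<p. c (x, l) * Z x l \<omega>))"
      unfolding sp by (simp only: of_real_sum[of _ ?I] sum_distrib_left exp_sum finite_all_rows fst_conv snd_conv)
    also have "\<dots> = (\<Prod>x\<in>?I. CLINT \<omega>|M. iexp (\<Sum>l<p. c (x, l) * Z x l \<omega>))"
    proof (rule indep_vars_lebesgue_integral)
      have "indep_vars (\<lambda>_. borel) (\<lambda>x \<omega>. (\<lambda>u. iexp (\<Sum>l<p. c (x, l) * (\<Sum>m<p. L l m * (u m - mu (fst x) m)))) ((\<lambda>(i, j). Y i j) x \<omega>)) ?I"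
      proof (rule indep_vars_compose2[OF ind])
        fix x assume "x \<in> ?I"
        have [measurable]: "(\<lambda>u. u m) \<in> borel_measurable (PiM {..<p} (\<lambda>_. borel))" if "m < p" for m :: nat
          using that by simp
        have [measurable]: "(\<lambda>u. \<Sum>l<p. c (x, l) * (\<Sum>m<p. L l m * (u m - mu (fst x) m))) \<in> borel_measurable (PiM {..<p} (\<lambda>_. borel))"
          by (intro borel_measurable_sum borel_measurable_times borel_measurable_diff) auto
        show "(\<lambda>u. iexp (\<Sum>l<p. c (x, l) * (\<Sum>m<p. L l m * (u m - mu (fst x) m)))) \<in> borel_measurable (PiM {..<p} (\<lambda>_. borel))"
          by measurable
      qed
      thus "indep_vars (\<lambda>_. borel) (\<lambda>x \<omega>. iexp (\<Sum>l<p. c (x, l) * Z x l \<omega>)) ?I"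
        by (simp only: Z_def case_prod_beta)
      show "integrable M (\<lambda>\<omega>. iexp (\<Sum>l<p. c (x, l) * Z x l \<omega>))" if "x \<in> ?I" for x
      proof -
        define g where "g \<omega> = (\<Sum>l<p. c (x, l) * Z x l \<omega>)" for \<omega>
        have [measurable]: "g \<in> borel_measurable M"
          unfolding g_def[abs_def] using Zm[OF that] by (intro borel_measurable_sum borel_measurable_times) auto
        have "integrable M (\<lambda>\<omega>. iexp (g \<omega>))" by (intro integrable_iexp) auto
        thus ?thesis by (simp only: g_def)
      qed
    qed simp
    also have "\<dots> = (\<Prod>x\<in>?I. of_real (exp (- (\<Sum>l<p. (c (x, l))\<^sup>2) / 2)))"
    proof (rule prod.cong[OF refl])
      fix x assume x: "x \<in> ?I"
      show "(CLINT \<omega>|M. iexp (\<Sum>l<p. c (x, l) * Z x l \<omega>)) = of_real (exp (- (\<Sum>l<p. (c (x, l))\<^sup>2) / 2))"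
        unfolding Z_def by (rule mvn_whitened_cf[OF assms(1) mvnx[OF x] L[OF ik[OF x]]])
    qed
    also have "\<dots> = of_real (exp (\<Sum>x\<in>?I. - (\<Sum>l<p. (c (x, l))\<^sup>2) / 2))"
      by (simp only: exp_sum finite_all_rows of_real_prod)
    also have "(\<Sum>x\<in>?I. - (\<Sum>l<p. (c (x, l))\<^sup>2) / 2) = - (\<Sum>y\<in>?I \<times> {..<p}. (c y)\<^sup>2) / 2"
      unfolding sp by (simp add: sum_negf sum_divide_distrib)
    finally show ?thesis .
  qed
  have "std_gauss_family M (?I \<times> {..<p}) (\<lambda>y. Z (fst y) (snd y))"
    unfolding std_gauss_family_def
  proof (intro conjI ballI allI)
    show "Z (fst y) (snd y) \<in> borel_measurable M" if "y \<in> ?I \<times> {..<p}" for y using Zm that by auto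
  qed (fact assms(1) cf)+
  thus ?thesis by (simp add: Z_def[abs_def] case_prod_beta')
qed

section \<open>Measurability of the statistic\<close>

lemma ybar_i_measurable:
  assumes "\<And>j. j < ns i \<Longrightarrow> (\<lambda>\<omega>. Y i j \<omega> a) \<in> borel_measurable M"
  shows "(\<lambda>\<omega>. ybar_i (\<lambda>i j. Y i j \<omega>) ns i a) \<in> borel_measurable M"
  unfolding ybar_i_def by (intro borel_measurable_times borel_measurable_sum borel_measurable_const assms) auto

lemma ybar_measurable:
  assumes "\<And>i j. i < k \<Longrightarrow> j < ns i \<Longrightarrow> (\<lambda>\<omega>. Y i j \<omega> a) \<in> borel_measurable M"
  shows "(\<lambda>\<omega>. ybar k (\<lambda>i j. Y i j \<omega>) ns a) \<in> borel_measurable M"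
  unfolding ybar_def by (intro borel_measurable_times borel_measurable_sum borel_measurable_const ybar_i_measurable assms) auto

lemma Lambda_measurable:
  assumes Y: "\<And>i j a. i < k \<Longrightarrow> j < ns i \<Longrightarrow> a < p \<Longrightarrow> (\<lambda>\<omega>. Y i j \<omega> a) \<in> borel_measurable M"
    and ns: "\<And>i. i < k \<Longrightarrow> ns i > 0"
  shows "(\<lambda>\<omega>. Lambda p k (\<lambda>i j. Y i j \<omega>) ns) \<in> borel_measurable M"
proof -
  have B: "(\<lambda>\<omega>. det (Bmat_i p (\<lambda>i j. Y i j \<omega>) ns i)) \<in> borel_measurable M" if i: "i < k" for i
    unfolding Bmat_i_def
  proof (rule measurable_det_mat)
    fix a b assume "a < p" "b < p"
    thus "(\<lambda>\<omega>. (\<lambda>(a, b). \<Sum>j<ns i. (Y i j \<omega> a - ybar_i (\<lambda>i j. Y i j \<omega>) ns i a) * (Y i j \<omega> b - ybar_i (\<lambda>i j. Y i j \<omega>) ns i b)) (a, b)) \<in> borel_measurable M"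
      unfolding prod.case using Y[OF i]
      by (intro borel_measurable_sum borel_measurable_times borel_measurable_diff ybar_i_measurable) auto
  qed
  have AB: "Amat p k y ns + Bmat p k y ns = mat p p (\<lambda>(a, b). \<Sum>x\<in>all_rows k ns. (data_vec y (x, a) - ybar k y ns a) * (data_vec y (x, b) - ybar k y ns b))" for y
    by (rule Amat_plus_Bmat) (rule ns)
  have A: "(\<lambda>\<omega>. det (Amat p k (\<lambda>i j. Y i j \<omega>) ns + Bmat p k (\<lambda>i j. Y i j \<omega>) ns)) \<in> borel_measurable M"
    unfolding AB
  proof (rule measurable_det_mat)
    fix a b assume ab: "a < p" "b < p"
    have "(\<lambda>\<omega>. data_vec (\<lambda>i j. Y i j \<omega>) (x, c)) \<in> borel_measurable M" if "x \<in> all_rows k ns" "c < p" for x c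
      using that Y by (auto simp: data_vec_def all_rows_def group_rows_def)
    thus "(\<lambda>\<omega>. (\<lambda>(a, b). \<Sum>x\<in>all_rows k ns. (data_vec (\<lambda>i j. Y i j \<omega>) (x, a) - ybar k (\<lambda>i j. Y i j \<omega>) ns a)
         * (data_vec (\<lambda>i j. Y i j \<omega>) (x, b) - ybar k (\<lambda>i j. Y i j \<omega>) ns b)) (a, b)) \<in> borel_measurable M"
      unfolding prod.case using ab Y
      by (intro borel_measurable_sum borel_measurable_times borel_measurable_diff ybar_measurable) auto
  qed
  have "(\<lambda>\<omega>. \<Prod>i<k. det (Bmat_i p (\<lambda>i j. Y i j \<omega>) ns i) powr (real (ns i) / 2)) \<in> borel_measurable M"
  proof (rule borel_measurable_prod)
    fix i assume "i \<in> {..<k}"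
    hence [measurable]: "(\<lambda>\<omega>. det (Bmat_i p (\<lambda>i j. Y i j \<omega>) ns i)) \<in> borel_measurable M" using B by simp
    show "(\<lambda>\<omega>. det (Bmat_i p (\<lambda>i j. Y i j \<omega>) ns i) powr (real (ns i) / 2)) \<in> borel_measurable M" by measurable
  qed
  note [measurable] = this A
  show ?thesis unfolding Lambda_def by measurable
qed

text \<open>Serves to show, via the formula at \<open>t = 0\<close>, that the Gram determinants are
  positive almost surely.\<close>

lemma column_cf_0:
  assumes "\<And>i. i < k \<Longrightarrow> m < ns i" and k: "k \<ge> 1"
  shows "column_cf k ns m 0 = 1"
proof -
  have G: "Gamma (complex_of_real x) \<noteq> 0" if "x > 0" for x
  proof -
    have "complex_of_real x \<notin> \<int>\<^sub>\<le>\<^sub>0" using that by (auto simp: complex_eq_iff elim!: nonpos_Ints_cases)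
    thus ?thesis by (simp only: Gamma_eq_zero_iff not_False_eq_True)
  qed
  have C: "Complex x 0 = of_real x" for x by (simp add: complex_eq_iff)
  have "ns 0 \<le> ntot k ns" unfolding ntot_def using k by (intro member_le_sum) auto
  hence "m < ntot k ns" using assms(1)[of 0] k by simp
  hence "Gamma (complex_of_real (real (ntot k ns - m) / 2)) \<noteq> 0" by (intro G) simp
  moreover have "Gamma (complex_of_real (real (ns i - m) / 2)) \<noteq> 0" if "i < k" for i
    using assms(1)[OF that] by (intro G) simp
  hence "(\<Prod>i<k. Gamma (complex_of_real (real (ns i - m) / 2)) / Gamma (complex_of_real (real (ns i - m) / 2))) = 1"
    by (intro prod.neutral) simp
  ultimately show ?thesis unfolding column_cf_def mult_zero_left div_0 C by (simp only: mult_1 divide_self not_False_eq_True)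
qed

lemma ln_prod_powr:
  fixes b e :: "'i \<Rightarrow> real"
  assumes "finite A" and b: "\<And>i. i \<in> A \<Longrightarrow> b i > 0"
  shows "ln (\<Prod>i\<in>A. b i powr e i) = (\<Sum>i\<in>A. e i * ln (b i))" and "(\<Prod>i\<in>A. b i powr e i) > 0"
proof -
  have pos: "b i powr e i > 0" if "i \<in> A" for i using b[OF that] by simp
  thus "(\<Prod>i\<in>A. b i powr e i) > 0" by (rule prod_pos)
  have "ln (\<Prod>i\<in>A. b i powr e i) = (\<Sum>i\<in>A. ln (b i powr e i))"
    by (rule ln_prod[OF assms(1)]) (use pos in fastforce)
  also have "\<dots> = (\<Sum>i\<in>A. e i * ln (b i))"
    by (rule sum.cong[OF refl]) (use b in \<open>simp add: ln_powr\<close>)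
  finally show "ln (\<Prod>i\<in>A. b i powr e i) = (\<Sum>i\<in>A. e i * ln (b i))" .
qed

text \<open>As the covariances agree, one \<open>L\<close> whitens all rows, and every Gram
  determinant changes by the same factor \<open>D\<close>. This factor drops out of
  \<open>ln Lambda\<close>, since the \<open>n_i\<close> add up to \<open>n\<close>.\<close>

theorem ln_Lambda_cf:
  fixes Y :: "nat \<Rightarrow> nat \<Rightarrow> 'a \<Rightarrow> nat \<Rightarrow> real" and t :: real
  assumes "prob_space M" and k: "k \<ge> 1" and ns: "\<And>i. i < k \<Longrightarrow> p < ns i"
    and ind: "prob_space.indep_vars M (\<lambda>_. PiM {..<p} (\<lambda>_. borel)) (\<lambda>(i, j). Y i j) (all_rows k ns)"
    and mvn: "\<And>i j. i < k \<Longrightarrow> j < ns i \<Longrightarrow> mvn M p (Y i j) (mu i) (S i)"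
    and pd: "pos_def_mat p (S 0)"
    and H0: "\<And>i l. i < k \<Longrightarrow> l < p \<Longrightarrow> mu i l = mu 0 l"
      "\<And>i l m. i < k \<Longrightarrow> l < p \<Longrightarrow> m < p \<Longrightarrow> S i l m = S 0 l m"
  shows "(CLINT \<omega>|M. iexp (t * ln (Lambda p k (\<lambda>i j. Y i j \<omega>) ns)))
     = iexp (t * ln_norm_const p k ns) * (\<Prod>l<p. column_cf k ns (Suc l) t)"
proof -
  interpret prob_space M by fact
  let ?I = "all_rows k ns" and ?Ig = "group_rows ns"
  have nspos: "ns i > 0" if "i < k" for i using ns[OF that] by simp
  have Npos: "ntot k ns > 0"
    using nspos[of 0] k member_le_sum[of 0 "{..<k}" ns] by (simp add: ntot_def)
  have ne: "?I \<noteq> {}" using Npos card_all_rows[of k ns] by force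
  have mvn': "mvn M p (Y i j) (mu i) (S i)" if "(i, j) \<in> ?I" for i j
    using mvn that by (auto simp: all_rows_def group_rows_def)
  obtain L where L0: "\<forall>l<p. \<forall>m<p. (\<Sum>a<p. \<Sum>b<p. L l a * S 0 a b * L m b) = (if l = m then 1 else (0::real))"
    using pos_def_whitening[OF pd] by blast
  have L: "(\<Sum>a<p. \<Sum>b<p. L l a * S i a b * L m b) = (if l = m then 1 else (0::real))" if "i < k" "l < p" "m < p" for i l m
  proof -
    have "(\<Sum>a<p. \<Sum>b<p. L l a * S i a b * L m b) = (\<Sum>a<p. \<Sum>b<p. L l a * S 0 a b * L m b)"
      using H0(2)[OF that(1)] by (intro sum.cong) auto
    thus ?thesis using L0 that by simp
  qed
  define X where "X = (\<lambda>(x, l) \<omega>. \<Sum>m<p. L l m * (Y (fst x) (snd x) \<omega> m - mu (fst x) m))"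
  have GX: "std_gauss_family M (?I \<times> {..<p}) X"
    unfolding X_def by (rule whitened_sample_std_gauss[OF assms(1) ind ne mvn' L])
  have finK: "finite (?I \<times> {..<p})" by simp
  define zr where "zr \<omega> = (\<lambda>y\<in>?I \<times> {..<p}. X y \<omega>)" for \<omega>
  define yv where "yv \<omega> = data_columns (data_vec (\<lambda>i j. Y i j \<omega>))" for \<omega>
  \<comment> \<open>The affine map \<open>x\<close> to \<open>L (x - mu)\<close> as a linear map on
    columns: the translation is a multiple of the intercept. The same multiple works for all rows
    because the means agree.\<close>
  define L' where "L' a b = (case a of 0 \<Rightarrow> if b = 0 then 1 else 0
     | Suc l \<Rightarrow> case b of 0 \<Rightarrow> - (\<Sum>m<p. L l m * mu 0 m) | Suc m \<Rightarrow> L l m)" for a b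
  define D where "D = (det (mat (Suc p) (Suc p) (\<lambda>(a, b). L' a b)))\<^sup>2"
  have gramD: "gram J (data_columns (zr \<omega>)) (Suc p) = D * gram J (yv \<omega>) (Suc p)" if J: "J \<subseteq> ?I" for J \<omega>
    unfolding D_def
  proof (rule gram_transform)
    fix a x assume a: "a < Suc p" and x: "x \<in> J"
    have xk: "fst x < k" "x \<in> ?I" using x J by (auto simp: all_rows_def group_rows_def)
    show "data_columns (zr \<omega>) a x = (\<Sum>b<Suc p. L' a b * yv \<omega> b x)"
    proof (cases a)
      case 0
      have "(\<Sum>b<Suc p. L' 0 b * yv \<omega> b x) = L' 0 0 * yv \<omega> 0 x + (\<Sum>m<p. L' 0 (Suc m) * yv \<omega> (Suc m) x)"
        by (rule sum.lessThan_Suc_shift)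
      thus ?thesis by (simp add: 0 L'_def yv_def)
    next
      case (Suc l)
      have "(\<Sum>b<Suc p. L' a b * yv \<omega> b x) = L' a 0 * yv \<omega> 0 x + (\<Sum>m<p. L' a (Suc m) * yv \<omega> (Suc m) x)"
        by (rule sum.lessThan_Suc_shift)
      also have "\<dots> = (\<Sum>m<p. L l m * (Y (fst x) (snd x) \<omega> m - mu 0 m))"
        by (simp add: Suc L'_def yv_def data_vec_def right_diff_distrib sum_subtractf)
      also have "\<dots> = (\<Sum>m<p. L l m * (Y (fst x) (snd x) \<omega> m - mu (fst x) m))"
        using H0(1)[OF xk(1)] by (intro sum.cong) auto
      also have "\<dots> = data_columns (zr \<omega>) a x"
        using a Suc xk(2) by (simp add: zr_def X_def)
      finally show ?thesis by simp
    qed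
  qed
  define good where "good w \<longleftrightarrow> (\<forall>m\<le>Suc p. (\<forall>i<k. gram (?Ig i) w m > 0) \<and> gram ?I w m > 0)" for w
  define St where "St t w = (\<Sum>i<k. t * real (ns i) / 2 * ln (gram (?Ig i) w (Suc p))) - t * real (ntot k ns) / 2 * ln (gram ?I w (Suc p))" for t w
  define c0 where "c0 t = (\<Sum>i<k. t * real (ns i) / 2 * ln (real (ns i))) - t * real (ntot k ns) / 2 * ln (real (ntot k ns))" for t
  define g where "g t z = (if good (data_columns z) then iexp (St t (data_columns z)) else 0)" for t z
  have fin: "finite (?Ig i)" and cardIg: "card (?Ig i) = ns i" for i by simp_all
  have gm: "g t \<in> borel_measurable (std_gauss_PiM (?I \<times> {..<p}))" for t
    unfolding g_def[abs_def] good_def St_def all_rows_def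
    by (rule gram_cf(1)[where p = p, OF fin disjoint_group_rows k cardIg ns order.refl])
  have gi: "(CLINT z|std_gauss_PiM (?I \<times> {..<p}). g t z) = iexp (c0 t) * (\<Prod>a<p. column_cf k ns (Suc a) t)" for t
    unfolding g_def good_def St_def all_rows_def c0_def
    by (rule gram_cf(2)[where p = p, OF fin disjoint_group_rows k cardIg ns order.refl])
  have setsG: "sets (std_gauss_PiM (?I \<times> {..<p})) = sets (PiM (?I \<times> {..<p}) (\<lambda>_. borel))" by (simp cong: sets_PiM_cong)
  have gm': "g t \<in> borel_measurable (PiM (?I \<times> {..<p}) (\<lambda>_. borel))" for t
    using gm[of t] by (simp cong: measurable_cong_sets add: setsG)
  have gM: "(CLINT \<omega>|M. g t (zr \<omega>)) = iexp (c0 t) * (\<Prod>a<p. column_cf k ns (Suc a) t)" for t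
    using std_gauss_family_integral[OF GX finK gm'] gi by (simp only: zr_def)
  have zrm: "zr \<in> measurable M (PiM (?I \<times> {..<p}) (\<lambda>_. borel))"
    unfolding zr_def[abs_def] using GX by (intro measurable_restrict) (auto simp: std_gauss_family_def)
  have gzm: "(\<lambda>\<omega>. g t (zr \<omega>)) \<in> borel_measurable M" for t by (rule measurable_compose[OF zrm gm'])
  have AEgood: "AE \<omega> in M. good (data_columns (zr \<omega>))"
  proof -
    \<comment> \<open>At \<open>t = 0\<close> the integrand is the indicator of the good event and
      its integral is 1, so the event has probability 1.\<close>
    have g0: "g 0 (zr \<omega>) = of_real (indicator {\<omega>. good (data_columns (zr \<omega>))} \<omega>)" for \<omega>
      by (simp add: g_def St_def)
    define A where "A = {\<omega>\<in>space M. g 0 (zr \<omega>) = 1}"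
    have Am: "A \<in> events" unfolding A_def using gzm[of 0] by measurable
    have Ag: "\<omega> \<in> A \<longleftrightarrow> \<omega> \<in> space M \<and> good (data_columns (zr \<omega>))" for \<omega>
      by (auto simp: A_def g0 indicator_def)
    have "complex_of_real (prob A) = (CLINT \<omega>|M. of_real (indicator A \<omega>))"
      using Am by simp
    also have "\<dots> = (CLINT \<omega>|M. g 0 (zr \<omega>))"
      using Ag by (intro Bochner_Integration.integral_cong) (auto simp: g0 indicator_def)
    also have "\<dots> = 1"
    proof -
      have "(\<Prod>a<p. column_cf k ns (Suc a) 0) = 1"
      proof (rule prod.neutral, rule ballI)
        fix a assume "a \<in> {..<p}"
        hence "\<And>i. i < k \<Longrightarrow> Suc a < ns i" using ns by (meson Suc_leI le_less_trans lessThan_iff)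
        thus "column_cf k ns (Suc a) 0 = 1" using k by (rule column_cf_0)
      qed
      thus ?thesis unfolding gM by (simp add: c0_def)
    qed
    finally have "prob A = 1" by (simp only: of_real_eq_1_iff)
    hence "AE \<omega> in M. \<omega> \<in> A" using prob_eq_1[OF Am] by simp
    thus ?thesis by eventually_elim (simp add: Ag)
  qed
  have key: "t * ln (Lambda p k (\<lambda>i j. Y i j \<omega>) ns) = (t * ln_norm_const p k ns - c0 t) + St t (data_columns (zr \<omega>))"
    if good: "good (data_columns (zr \<omega>))" for \<omega>
  proof -
    define bi where "bi i = det (Bmat_i p (\<lambda>i j. Y i j \<omega>) ns i)" for i
    define ab where "ab = det (Amat p k (\<lambda>i j. Y i j \<omega>) ns + Bmat p k (\<lambda>i j. Y i j \<omega>) ns)"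
    have Jsub: "?Ig i \<subseteq> ?I" if "i < k" for i using that by (auto simp: all_rows_def)
    have gI: "gram ?I (data_columns (zr \<omega>)) (Suc p) > 0" "\<And>i. i < k \<Longrightarrow> gram (?Ig i) (data_columns (zr \<omega>)) (Suc p) > 0"
      using good by (auto simp: good_def)
    have eI: "gram ?I (data_columns (zr \<omega>)) (Suc p) = D * (real (ntot k ns) * ab)"
    proof -
      have "gram ?I (data_columns (data_vec (\<lambda>i j. Y i j \<omega>))) (Suc p) = real (ntot k ns) * ab"
        unfolding ab_def by (rule det_Amat_plus_Bmat[OF k]) (rule nspos)
      thus ?thesis using gramD[of ?I \<omega>] by (simp add: yv_def)
    qed
    have eIg: "gram (?Ig i) (data_columns (zr \<omega>)) (Suc p) = D * (real (ns i) * bi i)" if "i < k" for i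
      using gramD[OF Jsub[OF that]] det_Bmat_i[where ns = ns and i = i and y = "\<lambda>i j. Y i j \<omega>" and p = p] nspos[OF that] by (simp add: yv_def bi_def)
    \<comment> \<open>Positivity of \<open>D\<close> is read off from the positive Gram
      determinants; invertibility of \<open>L\<close> is not shown separately.\<close>
    have "D \<ge> 0" by (simp add: D_def)
    moreover have "D \<noteq> 0" using gI(1) eI by auto
    ultimately have D: "D > 0" by simp
    have ab: "ab > 0" using gI(1) D Npos by (simp add: eI zero_less_mult_iff)
    have bi: "bi i > 0" if "i < k" for i using gI(2)[OF that] D nspos[OF that] by (simp add: eIg[OF that] zero_less_mult_iff)
    have lI: "ln (gram ?I (data_columns (zr \<omega>)) (Suc p)) = ln D + (ln (real (ntot k ns)) + ln ab)"
      unfolding eI using D Npos ab by (simp add: ln_mult_pos)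
    have lIg: "ln (gram (?Ig i) (data_columns (zr \<omega>)) (Suc p)) = ln D + (ln (real (ns i)) + ln (bi i))" if "i < k" for i
      unfolding eIg[OF that] using D nspos[OF that] bi[OF that] by (simp add: ln_mult_pos)
    have NN: "real (ntot k ns) = (\<Sum>i<k. real (ns i))" by (simp add: ntot_def)
    have "St t (data_columns (zr \<omega>)) = (\<Sum>i<k. t * real (ns i) / 2 * ln D + t * real (ns i) / 2 * ln (real (ns i)) + t * real (ns i) / 2 * ln (bi i))
       - t * real (ntot k ns) / 2 * (ln D + (ln (real (ntot k ns)) + ln ab))"
      unfolding St_def lI by (intro arg_cong2[where f = "(-)"] sum.cong refl) (simp add: lIg algebra_simps)
    also have "\<dots> = c0 t + ((\<Sum>i<k. t * real (ns i) / 2 * ln (bi i)) - t * real (ntot k ns) / 2 * ln ab)"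
    proof -
      have "(\<Sum>i<k. t * real (ns i) / 2 * ln D) = t * real (ntot k ns) / 2 * ln D"
        unfolding NN by (simp add: sum_distrib_left sum_distrib_right sum_divide_distrib)
      thus ?thesis by (simp only: sum.distrib c0_def distrib_left)
    qed
    finally have S: "St t (data_columns (zr \<omega>)) = c0 t + ((\<Sum>i<k. t * real (ns i) / 2 * ln (bi i)) - t * real (ntot k ns) / 2 * ln ab)" .
    have "ln (Lambda p k (\<lambda>i j. Y i j \<omega>) ns) = (\<Sum>i<k. real (ns i) / 2 * ln (bi i)) - real (ntot k ns) / 2 * ln ab + ln_norm_const p k ns"
    proof -
      have p1: "ln (\<Prod>i<k. bi i powr (real (ns i) / 2)) = (\<Sum>i<k. real (ns i) / 2 * ln (bi i))" "(\<Prod>i<k. bi i powr (real (ns i) / 2)) > 0"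
        by (rule ln_prod_powr; use bi in simp)+
      have p2: "ln (\<Prod>i<k. real (ns i) powr (real p * real (ns i) / 2)) = (\<Sum>i<k. real p * real (ns i) / 2 * ln (real (ns i)))"
         "(\<Prod>i<k. real (ns i) powr (real p * real (ns i) / 2)) > 0"
        by (rule ln_prod_powr; use nspos in simp)+
      have p3: "ln (ab powr (real (ntot k ns) / 2)) = real (ntot k ns) / 2 * ln ab" "ab powr (real (ntot k ns) / 2) > 0"
        using ab by (auto simp: ln_powr)
      have p4: "ln (real (ntot k ns) powr (real p * real (ntot k ns) / 2)) = real p * real (ntot k ns) / 2 * ln (real (ntot k ns))"
         "real (ntot k ns) powr (real p * real (ntot k ns) / 2) > 0"
        using Npos by (auto simp: ln_powr)
      have gen: "ln (a / b * (c / d)) = ln a - ln b + (ln c - ln d)" if "a > 0" "b > 0" "c > 0" "d > 0" for a b c d :: real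
        using that by (simp add: ln_mult ln_div)
      have "ln (Lambda p k (\<lambda>i j. Y i j \<omega>) ns) = ln (\<Prod>i<k. bi i powr (real (ns i) / 2)) - ln (ab powr (real (ntot k ns) / 2))
         + (ln (real (ntot k ns) powr (real p * real (ntot k ns) / 2)) - ln (\<Prod>i<k. real (ns i) powr (real p * real (ns i) / 2)))"
        unfolding Lambda_def bi_def[symmetric] ab_def[symmetric]
        by (rule gen[OF p1(2) p3(2) p4(2) p2(2)])
      thus ?thesis unfolding p1 p2 p3 p4 by (simp add: ln_norm_const_def)
    qed
    hence "t * ln (Lambda p k (\<lambda>i j. Y i j \<omega>) ns) = t * (\<Sum>i<k. real (ns i) / 2 * ln (bi i)) - t * (real (ntot k ns) / 2 * ln ab) + t * ln_norm_const p k ns"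
      by (simp only: distrib_left right_diff_distrib)
    also have "t * (\<Sum>i<k. real (ns i) / 2 * ln (bi i)) = (\<Sum>i<k. t * real (ns i) / 2 * ln (bi i))"
      by (simp add: sum_distrib_left mult.assoc)
    finally show ?thesis unfolding S by simp
  qed
  have Ym: "(\<lambda>\<omega>. Y i j \<omega> a) \<in> borel_measurable M" if "i < k" "j < ns i" "a < p" for i j a
    by (rule mvn_component_measurable[OF mvn[OF that(1,2)] that(3)])
  have Lm: "(\<lambda>\<omega>. Lambda p k (\<lambda>i j. Y i j \<omega>) ns) \<in> borel_measurable M"
    by (rule Lambda_measurable) (auto intro: Ym nspos)
  have "(CLINT \<omega>|M. iexp (t * ln (Lambda p k (\<lambda>i j. Y i j \<omega>) ns))) = (CLINT \<omega>|M. iexp (t * ln_norm_const p k ns - c0 t) * g t (zr \<omega>))"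
  proof (rule integral_cong_AE)
    show "AE \<omega> in M. iexp (t * ln (Lambda p k (\<lambda>i j. Y i j \<omega>) ns)) = iexp (t * ln_norm_const p k ns - c0 t) * g t (zr \<omega>)"
      using AEgood
    proof eventually_elim
      case (elim \<omega>)
      show ?case unfolding key[OF elim] g_def using elim by (simp add: exp_add distrib_left)
    qed
    show "(\<lambda>\<omega>. iexp (t * ln (Lambda p k (\<lambda>i j. Y i j \<omega>) ns))) \<in> borel_measurable M" using Lm by measurable
    show "(\<lambda>\<omega>. iexp (t * ln_norm_const p k ns - c0 t) * g t (zr \<omega>)) \<in> borel_measurable M"
      using gzm[of t] by measurable
  qed
  also have "\<dots> = iexp (t * ln_norm_const p k ns - c0 t) * (CLINT \<omega>|M. g t (zr \<omega>))" by (rule integral_mult_right_zero)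
  also have "\<dots> = iexp (t * ln_norm_const p k ns) * (\<Prod>l<p. column_cf k ns (Suc l) t)"
  proof -
    have "iexp (t * ln_norm_const p k ns - c0 t) * iexp (c0 t) = iexp (t * ln_norm_const p k ns)"
      by (simp add: exp_add[symmetric] algebra_simps)
    thus ?thesis unfolding gM by (simp only: mult.assoc[symmetric])
  qed
  finally show ?thesis .
qed

text \<open>The hypotheses start at \<open>p = 1\<close>, whereas \<open>levy_continuity\<close>
  asks for a probability distribution at every index; hence it is applied to the shifted
  sequence.\<close>

lemma weak_conv_m_Suc:
  "weak_conv_m (\<lambda>p. Mp (Suc p)) M \<Longrightarrow> weak_conv_m Mp M"
  unfolding weak_conv_m_def weak_conv_def by (auto intro: filterlim_sequentially_Suc[THEN iffD1])

theorem theorem3: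
  fixes k :: nat
    and n :: "nat \<Rightarrow> nat \<Rightarrow> nat"
    and y :: "nat \<Rightarrow> real"
    and M :: "nat \<Rightarrow> 'a measure"
    and Y :: "nat \<Rightarrow> nat \<Rightarrow> nat \<Rightarrow> 'a \<Rightarrow> nat \<Rightarrow> real"
    and mu :: "nat \<Rightarrow> nat \<Rightarrow> nat \<Rightarrow> real"
    and Sig :: "nat \<Rightarrow> nat \<Rightarrow> nat \<Rightarrow> nat \<Rightarrow> real"
  assumes k2: "k \<ge> 2"
    and n_gt: "\<And>p i. p \<ge> 1 \<Longrightarrow> i < k \<Longrightarrow> n p i > p + 1"
    and y_lim: "\<And>i. i < k \<Longrightarrow> (\<lambda>p. real p / real (n p i)) \<longlonglongrightarrow> y i"
    and y_rng: "\<And>i. i < k \<Longrightarrow> 0 < y i \<and> y i \<le> 1"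
    and prob: "\<And>p. p \<ge> 1 \<Longrightarrow> prob_space (M p)"
    and indep: "\<And>p. p \<ge> 1 \<Longrightarrow> prob_space.indep_vars (M p) (\<lambda>_. PiM {..<p} (\<lambda>_. borel))
                   (\<lambda>(i, j). Y p i j) {(i, j). i < k \<and> j < n p i}"
    and normal: "\<And>p i j. p \<ge> 1 \<Longrightarrow> i < k \<Longrightarrow> j < n p i \<Longrightarrow>
                   mvn (M p) p (Y p i j) (mu p i) (Sig p i)"
    and posdef: "\<And>p i. p \<ge> 1 \<Longrightarrow> i < k \<Longrightarrow> pos_def_mat p (Sig p i)"
    and H0_mu: "\<And>p i l. p \<ge> 1 \<Longrightarrow> i < k \<Longrightarrow> l < p \<Longrightarrow> mu p i l = mu p 0 l"
    and H0_Sig: "\<And>p i l m. p \<ge> 1 \<Longrightarrow> i < k \<Longrightarrow> l < p \<Longrightarrow> m < p \<Longrightarrow> Sig p i l m = Sig p 0 l m"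
  shows "(\<forall>p\<ge>1. sigma2_n p k (n p) > 0) \<and>
         weak_conv_m
           (\<lambda>p. distr (M p) borel
              (\<lambda>\<omega>. (ln (Lambda p k (\<lambda>i j. Y p i j \<omega>) (n p)) - mu_n p k (n p) y)
                     / (real (ntot k (n p)) * sqrt (sigma2_n p k (n p)))))
           std_normal_distribution"
proof -
  interpret H: high_dim_samples k n y
    by unfold_locales (use k2 n_gt y_lim y_rng in auto)
  define X where "X p \<omega> = (ln (Lambda p k (\<lambda>i j. Y p i j \<omega>) (n p)) - mu_n p k (n p) y)
                     / (real (ntot k (n p)) * sqrt (sigma2_n p k (n p)))" for p \<omega>
  have rows: "{(i, j). i < k \<and> j < n p i} = all_rows k (n p)" for p
    by (auto simp: all_rows_def group_rows_def)
  have Lm: "(\<lambda>\<omega>. Lambda p k (\<lambda>i j. Y p i j \<omega>) (n p)) \<in> borel_measurable (M p)" if p: "p \<ge> 1" for p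
  proof (rule Lambda_measurable)
    show "(\<lambda>\<omega>. Y p i j \<omega> a) \<in> borel_measurable (M p)" if "i < k" "j < n p i" "a < p" for i j a
      by (rule mvn_component_measurable[OF normal[OF p that(1,2)] that(3)])
    show "n p i > 0" if "i < k" for i using n_gt[OF p that] by simp
  qed
  have Xm: "X p \<in> borel_measurable (M p)" if "p \<ge> 1" for p
    unfolding X_def[abs_def] using Lm[OF that] by measurable
  have cf: "char (distr (M p) borel (X p)) s =
      exp (\<i> * of_real (s / (real (ntot k (n p)) * sqrt (sigma2_n p k (n p))) * (ln_norm_const p k (n p) - mu_n p k (n p) y)))
        * (\<Prod>l<p. column_cf k (n p) (Suc l) (s / (real (ntot k (n p)) * sqrt (sigma2_n p k (n p)))))" if p: "p \<ge> 1" for p s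
  proof -
    define t where "t = s / (real (ntot k (n p)) * sqrt (sigma2_n p k (n p)))"
    have k1: "k \<ge> 1" using k2 by simp
    have ns: "p < n p i" if "i < k" for i using n_gt[OF p that] by simp
    have "char (distr (M p) borel (X p)) s = (CLINT \<omega>|M p. iexp (s * X p \<omega>))"
      unfolding char_def using Xm[OF p] by (subst integral_distr) auto
    also have "\<dots> = (CLINT \<omega>|M p. iexp (- t * mu_n p k (n p) y) * iexp (t * ln (Lambda p k (\<lambda>i j. Y p i j \<omega>) (n p))))"
    proof (rule Bochner_Integration.integral_cong[OF refl])
      fix \<omega>
      have "s * X p \<omega> = - t * mu_n p k (n p) y + t * ln (Lambda p k (\<lambda>i j. Y p i j \<omega>) (n p))"
        by (simp add: X_def t_def right_diff_distrib diff_divide_distrib)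
      thus "iexp (s * X p \<omega>) = iexp (- t * mu_n p k (n p) y) * iexp (t * ln (Lambda p k (\<lambda>i j. Y p i j \<omega>) (n p)))"
        by (simp only: of_real_add distrib_left exp_add)
    qed
    also have "\<dots> = iexp (- t * mu_n p k (n p) y) * (CLINT \<omega>|M p. iexp (t * ln (Lambda p k (\<lambda>i j. Y p i j \<omega>) (n p))))"
      by (rule integral_mult_right_zero)
    also have "(CLINT \<omega>|M p. iexp (t * ln (Lambda p k (\<lambda>i j. Y p i j \<omega>) (n p))))
        = iexp (t * ln_norm_const p k (n p)) * (\<Prod>l<p. column_cf k (n p) (Suc l) t)"
    proof (rule ln_Lambda_cf[where mu = "mu p" and S = "Sig p"])
      show "prob_space.indep_vars (M p) (\<lambda>_. PiM {..<p} (\<lambda>_. borel)) (\<lambda>(i, j). Y p i j) (all_rows k (n p))"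
        using indep[OF p] unfolding rows .
      show "mvn (M p) p (Y p i j) (mu p i) (Sig p i)" if "i < k" "j < n p i" for i j by (rule normal[OF p that])
      show "pos_def_mat p (Sig p 0)" using posdef[OF p, of 0] k1 by simp
      show "mu p i l = mu p 0 l" if "i < k" "l < p" for i l by (rule H0_mu[OF p that])
      show "Sig p i l m = Sig p 0 l m" if "i < k" "l < p" "m < p" for i l m by (rule H0_Sig[OF p that])
    qed (use prob[OF p] k1 ns in auto)
    also have "iexp (- t * mu_n p k (n p) y) * (iexp (t * ln_norm_const p k (n p)) * (\<Prod>l<p. column_cf k (n p) (Suc l) t))
        = iexp (t * (ln_norm_const p k (n p) - mu_n p k (n p) y)) * (\<Prod>l<p. column_cf k (n p) (Suc l) t)"
      unfolding mult.assoc[symmetric] exp_add[symmetric] by (simp add: algebra_simps)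
    finally show ?thesis by (simp only: t_def)
  qed
  have "weak_conv_m (\<lambda>p. distr (M (Suc p)) borel (X (Suc p))) std_normal_distribution"
  proof (rule levy_continuity)
    show "real_distribution (distr (M (Suc p)) borel (X (Suc p)))" for p
      using prob[of "Suc p"] Xm[of "Suc p"] by (intro prob_space.real_distribution_distr) auto
    show "real_distribution std_normal_distribution" by (rule real_dist_normal_dist)
    fix s
    have "\<forall>\<^sub>F p in sequentially. exp (\<i> * of_real (s / (real (ntot k (n p)) * sqrt (sigma2_n p k (n p))) * (ln_norm_const p k (n p) - mu_n p k (n p) y)))
        * (\<Prod>l<p. column_cf k (n p) (Suc l) (s / (real (ntot k (n p)) * sqrt (sigma2_n p k (n p))))) = char (distr (M p) borel (X p)) s"
      using eventually_ge_at_top[of 1] by eventually_elim (rule cf[symmetric])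
    from Lim_transform_eventually[OF H.cf_limit this]
    have "(\<lambda>p. char (distr (M p) borel (X p)) s) \<longlonglongrightarrow> char std_normal_distribution s"
      by (simp add: char_std_normal_distribution exp_of_real[symmetric])
    thus "(\<lambda>p. char (distr (M (Suc p)) borel (X (Suc p))) s) \<longlonglongrightarrow> char std_normal_distribution s"
      by (rule LIMSEQ_Suc)
  qed
  hence "weak_conv_m (\<lambda>p. distr (M p) borel (X p)) std_normal_distribution" by (rule weak_conv_m_Suc)
  thus ?thesis using H.sigma2_pos unfolding X_def[abs_def] by blast
qed

end
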